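(* Let $(A,\mathfrak m)$ be a Noetherian local ring with infinite residue field and $M$ a finitely generated Cohen-Macaulay $A$-module of dimension $d\ge2$. Let $I$ be an $\mathfrak m$-primary ideal such that $IM\subseteq\mathfrak m^bM$, where $b$ is a positive integer. Then $$e_2(I,M)\le\binom{e_0(I,M)-b+1}{3}.$$
   Context: $\ell$ denotes length. For an $\mathfrak m$-primary ideal $I$ and a finitely generated $A$-module $M$ of dimension $d$, the Hilbert coefficients $e_0(I,M),\dots,e_d(I,M)$ are the integers with $\ell(M/I^{n+1}M)=\sum_{i=0}^d(-1)^ie_i(I,M)\binom{n+d-i}{d-i}$ for all $n\gg0$. *)

theory Defs
  imports "HOL-Algebra.Algebra" "HOL-Library.Extended_Nat"
begin

subsection \<open>Rings and ideals\<close>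

locale local_ring = cring R for R (structure) and \<mm> +
  assumes max_ideal: "maximalideal \<mm> R"
    and max_unique: "maximalideal J R \<Longrightarrow> J = \<mm>"

definition ideal_radical :: "('a, 'r) ring_scheme \<Rightarrow> 'a set \<Rightarrow> 'a set" where
  "ideal_radical R I = {a \<in> carrier R. \<exists>n::nat. a [^]\<^bsub>R\<^esub> n \<in> I}"

definition primary_to :: "('a, 'r) ring_scheme \<Rightarrow> 'a set \<Rightarrow> 'a set \<Rightarrow> bool" where
  "primary_to R P I \<longleftrightarrow>
     ideal I R \<and> I \<noteq> carrier R \<and>
     (\<forall>a\<in>carrier R. \<forall>b\<in>carrier R. a \<otimes>\<^bsub>R\<^esub> b \<in> I \<longrightarrow> a \<in> I \<or> b \<in> ideal_radical R I) \<and>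
     ideal_radical R I = P"

text \<open>
  The supremum of the lengths \<open>n\<close> of chains of primes \<open>P 0 \<subset> \<dots> \<subset> P n\<close>; the zero ring,
  which has no primes, gets the value 0.
\<close>

definition krull_dim :: "('a, 'r) ring_scheme \<Rightarrow> enat" where
  "krull_dim R = Sup {enat n |n. \<exists>P :: nat \<Rightarrow> 'a set.
     (\<forall>i\<le>n. primeideal (P i) R) \<and> (\<forall>i<n. P i \<subset> P (Suc i))}"

subsection \<open>Modules\<close>

definition module_span ::
  "('a, 'r) ring_scheme \<Rightarrow> ('a, 'b, 'm) module_scheme \<Rightarrow> 'b set \<Rightarrow> 'b set" where
  "module_span R M S = \<Inter>{N. submodule N R M \<and> S \<subseteq> N}"

definition finitely_generated ::
  "('a, 'r) ring_scheme \<Rightarrow> ('a, 'b, 'm) module_scheme \<Rightarrow> bool" where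
  "finitely_generated R M \<longleftrightarrow>
     (\<exists>S. finite S \<and> S \<subseteq> carrier M \<and> module_span R M S = carrier M)"

definition ideal_times_module ::
  "('a, 'r) ring_scheme \<Rightarrow> ('a, 'b, 'm) module_scheme \<Rightarrow> 'a set \<Rightarrow> 'b set" where
  "ideal_times_module R M I =
     module_span R M {a \<odot>\<^bsub>M\<^esub> x |a x. a \<in> I \<and> x \<in> carrier M}"

text \<open>
  The quotient \<open>M/N\<close>. The fields \<open>mult\<close> and \<open>one\<close> are there because module records extend
  ring records; they play no role in the module structure.
\<close>

definition FactModule ::
  "('a, 'b, 'm) module_scheme \<Rightarrow> 'b set \<Rightarrow> ('a, 'b set) module" where
  "FactModule M N =
     \<lparr>carrier = a_rcosets\<^bsub>M\<^esub> N, monoid.mult = rcoset_mult M N, one = N +>\<^bsub>M\<^esub> \<one>\<^bsub>M\<^esub>,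
      ring.zero = N, ring.add = set_add M, smult = (\<lambda>a C. \<Union>x\<in>C. N +>\<^bsub>M\<^esub> (a \<odot>\<^bsub>M\<^esub> x))\<rparr>"

definition module_length ::
  "('a, 'r) ring_scheme \<Rightarrow> ('a, 'b, 'm) module_scheme \<Rightarrow> enat" where
  "module_length R M = Sup {enat n |n. \<exists>N :: nat \<Rightarrow> 'b set.
     (\<forall>i\<le>n. submodule (N i) R M) \<and> (\<forall>i<n. N i \<subset> N (Suc i))}"

definition annihilator ::
  "('a, 'r) ring_scheme \<Rightarrow> ('a, 'b, 'm) module_scheme \<Rightarrow> 'a set" where
  "annihilator R M = {a \<in> carrier R. \<forall>x\<in>carrier M. a \<odot>\<^bsub>M\<^esub> x = \<zero>\<^bsub>M\<^esub>}"

definition module_dim ::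
  "('a, 'r) ring_scheme \<Rightarrow> ('a, 'b, 'm) module_scheme \<Rightarrow> enat" where
  "module_dim R M = krull_dim (R Quot annihilator R M)"

subsection \<open>Depth and Cohen-Macaulay modules\<close>

definition module_nonzerodivisor :: "('a, 'b, 'm) module_scheme \<Rightarrow> 'a \<Rightarrow> bool" where
  "module_nonzerodivisor M a \<longleftrightarrow> (\<forall>x\<in>carrier M. a \<odot>\<^bsub>M\<^esub> x = \<zero>\<^bsub>M\<^esub> \<longrightarrow> x = \<zero>\<^bsub>M\<^esub>)"

definition regular_sequence ::
  "('a, 'r) ring_scheme \<Rightarrow> ('a, 'b, 'm) module_scheme \<Rightarrow> 'a list \<Rightarrow> bool" where
  "regular_sequence R M as \<longleftrightarrow>
     set as \<subseteq> carrier R \<and>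
     (\<forall>i<length as. module_nonzerodivisor
        (FactModule M (ideal_times_module R M (Idl\<^bsub>R\<^esub> (set (take i as))))) (as ! i)) \<and>
     ideal_times_module R M (Idl\<^bsub>R\<^esub> (set as)) \<noteq> carrier M"

definition module_depth ::
  "('a, 'r) ring_scheme \<Rightarrow> 'a set \<Rightarrow> ('a, 'b, 'm) module_scheme \<Rightarrow> enat" where
  "module_depth R \<mm> M = Sup {enat (length as) |as. set as \<subseteq> \<mm> \<and> regular_sequence R M as}"

definition cohen_macaulay_module ::
  "('a, 'r) ring_scheme \<Rightarrow> 'a set \<Rightarrow> ('a, 'b, 'm) module_scheme \<Rightarrow> bool" where
  "cohen_macaulay_module R \<mm> M \<longleftrightarrow> module_depth R \<mm> M = module_dim R M"

subsection \<open>Hilbert coefficients\<close>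

text \<open>
  Powers of ideals are taken in \<^const>\<open>ideals_set\<close>, whose multiplication is the product of
  ideals and whose unit is the whole ring.
\<close>

definition hilbert_samuel ::
  "('a, 'r) ring_scheme \<Rightarrow> ('a, 'b, 'm) module_scheme \<Rightarrow> 'a set \<Rightarrow> nat \<Rightarrow> enat" where
  "hilbert_samuel R M I n =
     module_length R (FactModule M (ideal_times_module R M (I [^]\<^bsub>ideals_set R\<^esub> Suc n)))"

text \<open>
  The integers \<open>e 0, \<dots>, e d\<close> are determined by the Hilbert-Samuel function for large \<open>n\<close>;
  the sequence is continued by 0 beyond \<open>d\<close> so that it is determined as a function on \<open>nat\<close>.
\<close>

definition hilbert_coeff ::
  "('a, 'r) ring_scheme \<Rightarrow> ('a, 'b, 'm) module_scheme \<Rightarrow> 'a set \<Rightarrow> nat \<Rightarrow> int" where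
  "hilbert_coeff R M I =
     (let d = the_enat (module_dim R M) in
      THE e :: nat \<Rightarrow> int.
        (\<forall>i>d. e i = 0) \<and>
        (\<forall>\<^sub>F n in sequentially. \<exists>l::nat. hilbert_samuel R M I n = enat l \<and>
           int l = (\<Sum>i\<le>d. (- 1) ^ i * e i * int ((n + d - i) choose (d - i)))))"

end

theory Submission
  imports Defs "HOL-Library.Set_Algebras"
begin

text \<open>
  Cutting with a general element \<open>x\<close> of \<open>I\<close> (superficial, and regular on \<open>M\<close>) lowers the dimension by
  one and keeps \<open>e\<^sub>i\<close> for \<open>i < d\<close>, so \<open>d = 2\<close>. In that case, with \<open>N = M/xM\<close> and
  \<open>v\<^sub>n = e\<^sub>0 - \<ell>(I\<^sup>nN/I\<^sup>n\<^sup>+\<^sup>1N)\<close>, the equality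
  \<open>e\<^sub>2 = (\<Sum>n. n v\<^sub>n) - (\<Sum>n. \<ell>((I\<^sup>n\<^sup>+\<^sup>1M : x)/I\<^sup>nM))\<close> bounds \<open>e\<^sub>2\<close> by the first sum.
  Let \<open>y\<close> be superficial for \<open>N\<close> and \<open>s\<close> minimal with \<open>I\<^sup>s\<^sup>+\<^sup>1N = yI\<^sup>sN\<close>. Then \<open>v\<^sub>n = 0\<close> for
  \<open>n \<ge> s\<close>. For \<open>n \<le> s\<close> Nakayama's lemma shows that the submodules \<open>y\<^sup>n\<^sup>-\<^sup>iI\<^sup>iN + \<mm>I\<^sup>nN\<close> increase
  strictly with \<open>i\<close>; continued by \<open>\<mm>\<^sup>jI\<^sup>nN\<close> for \<open>j \<le> b\<close> they form a chain of length \<open>n + b\<close> from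
  \<open>\<mm>\<^sup>bI\<^sup>nN \<supseteq> I\<^sup>n\<^sup>+\<^sup>1N\<close> to \<open>I\<^sup>nN\<close>. Hence \<open>v\<^sub>n \<le> e\<^sub>0 - b - n\<close> for \<open>n < s\<close>, and \<open>\<Sum>n. n v\<^sub>n\<close> is at most
  \<open>\<Sum>n\<le>m. n (m - n)\<close> with \<open>m = e\<^sub>0 - b\<close>, which is the binomial coefficient of the claim.

  All quotients of a module \<open>F\<close> are represented by the submodule \<open>Q\<close> that is divided out: the element
  \<open>x\<close> is regular on \<open>F/Q\<close> if \<open>Q : x = Q\<close>, and \<open>F/(Q + xF)\<close> is given by \<open>cut Q x\<close>.
\<close>

section \<open>Submodules and their lengths\<close>

text \<open>Passing to \<open>M/xM\<close> changes the carrier, so an induction on \<open>d\<close>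
  over the modules themselves would run through changing types; with one module \<open>F\<close>
  fixed, only the submodule \<open>Q\<close> moves. A given module over \<open>A\<close> has no type
  of its own, so it enters as the image of a type-class module, and every statement about it is read
  off from submodules above the kernel. The general element is not found by avoiding associated
  primes of the graded module. It is a point of a moment curve through generators of
  \<open>I\<close>: Vandermonde turns conditions at enough points into a condition on all of
  \<open>I\<close>, and the chain condition reduces infinitely many degrees and points to finitely
  many, so only finitely many points with distinct residue classes can be bad. Cohen-Macaulayness
  enters as depth at least \<open>d\<close> together with dimension at most \<open>d\<close>. The
  former must survive division by the general element, which has nothing to do with the regular
  sequence that is given. The constant in the bound is natural: \<open>n (m - n)\<close> counts the
  3-subsets of \<open>{0..m}\<close> with middle element \<open>n\<close>.\<close>

locale scalar_module = Modules.module scale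
  for scale :: "'s::comm_ring_1 \<Rightarrow> 'f::ab_group_add \<Rightarrow> 'f" (infixr \<open>*s\<close> 75)
begin

lemma subspace_plus:
  assumes "subspace N" "subspace P" shows "subspace (N + P)"
proof (rule subspaceI)
  show "0 \<in> N + P" using assms set_plus_intro[of 0 N 0 P] by (simp add: subspace_0)
next
  fix x y assume "x \<in> N + P" "y \<in> N + P"
  then obtain a b c d where "x = a + b" "y = c + d" "a \<in> N" "b \<in> P" "c \<in> N" "d \<in> P"
    by (auto elim!: set_plus_elim)
  then have "x + y = (a + c) + (b + d)" "a + c \<in> N" "b + d \<in> P"
    using assms by (auto simp: algebra_simps intro: subspace_add)
  then show "x + y \<in> N + P" by auto
next
  fix c x assume "x \<in> N + P"
  then show "c *s x \<in> N + P"
    using assms by (auto simp: scale_right_distrib set_plus_intro subspace_scale elim!: set_plus_elim)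
qed

lemma plus_upper1: "subspace P \<Longrightarrow> N \<subseteq> N + P"
  by (metis add.commute set_zero_plus2 subspace_0)

lemma plus_upper2: "subspace N \<Longrightarrow> P \<subseteq> N + P"
  by (metis set_zero_plus2 subspace_0)

lemma plus_least: "subspace S \<Longrightarrow> N \<subseteq> S \<Longrightarrow> P \<subseteq> S \<Longrightarrow> N + P \<subseteq> S"
  unfolding set_plus_def by (auto intro: subspace_add)

lemma plus_absorb: "subspace N \<Longrightarrow> subspace P \<Longrightarrow> P \<subseteq> N \<Longrightarrow> N + P = N"
  by (meson antisym order_refl plus_least plus_upper1)

lemma span_Un_plus: "span (S \<union> T) = span S + span T"
  unfolding span_Un set_plus_def by auto

text \<open>The product of an ideal and a submodule. \<open>Y\<close> may be any set, so that a
  finite generating set can stand for its ideal.\<close>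

definition act :: "'s set \<Rightarrow> 'f set \<Rightarrow> 'f set"
  where "act Y N = span {y *s n | y n. y \<in> Y \<and> n \<in> N}"

definition cut :: "'f set \<Rightarrow> 's \<Rightarrow> 'f set"
  where "cut Q x = Q + range (scale x)"

definition colon :: "'f set \<Rightarrow> 's \<Rightarrow> 'f set"
  where "colon Q x = {f. x *s f \<in> Q}"

definition regular :: "'f set \<Rightarrow> 's \<Rightarrow> bool"
  where "regular Q x \<longleftrightarrow> (\<forall>f. x *s f \<in> Q \<longrightarrow> f \<in> Q)"

lemma subspace_image_scale: "subspace N \<Longrightarrow> subspace (scale x ` N)"
proof (rule subspaceI, goal_cases)
  case 1 then show ?case by (metis image_eqI scale_zero_right subspace_0)
next
  case (2 u v)
  then obtain u' v' where "u = x *s u'" "v = x *s v'" "u' \<in> N" "v' \<in> N" by auto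
  then have "u + v = x *s (u' + v')" "u' + v' \<in> N"
    using 2(1) by (auto simp: scale_right_distrib intro: subspace_add)
  then show ?case by simp
next
  case (3 c u)
  then obtain u' where "u = x *s u'" "u' \<in> N" by auto
  then have "c *s u = x *s (c *s u')" "c *s u' \<in> N"
    using 3(1) by (auto simp: mult.commute intro: subspace_scale)
  then show ?case by (simp only: imageI)
qed

lemma subspace_act [simp]: "subspace (act Y N)"
  by (simp add: act_def)

lemma subspace_cut: "subspace Q \<Longrightarrow> subspace (cut Q x)"
  unfolding cut_def by (intro subspace_plus subspace_image_scale subspace_UNIV)

lemma subspace_colon: "subspace Q \<Longrightarrow> subspace (colon Q x)"
  unfolding colon_def
proof (rule subspaceI)
  fix c f assume "subspace Q" "f \<in> {f. x *s f \<in> Q}"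
  then have "c *s x *s f \<in> Q" by (simp add: subspace_scale del: scale_scale)
  then show "c *s f \<in> {f. x *s f \<in> Q}" by (simp add: mult.commute)
qed (auto simp: subspace_0 scale_right_distrib subspace_add)

lemma cut_upper: "subspace Q \<Longrightarrow> Q \<subseteq> cut Q x"
  unfolding cut_def by (intro plus_upper1 subspace_image_scale subspace_UNIV)

lemma in_cut_iff: "f \<in> cut Q x \<longleftrightarrow> (\<exists>q\<in>Q. \<exists>g. f = q + x *s g)"
  by (auto simp: cut_def set_plus_def)

lemma scale_in_cut: "subspace Q \<Longrightarrow> x *s f \<in> cut Q x"
  unfolding in_cut_iff by (metis add_0 subspace_0)

lemma cut_commute: "cut (cut Q x) y = cut (cut Q y) x"
  unfolding cut_def by (simp add: ac_simps)

lemma scale_in_act: "y \<in> Y \<Longrightarrow> n \<in> N \<Longrightarrow> y *s n \<in> act Y N"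
  unfolding act_def by (auto intro: span_base)

lemma act_least: "subspace S \<Longrightarrow> (\<And>y n. y \<in> Y \<Longrightarrow> n \<in> N \<Longrightarrow> y *s n \<in> S) \<Longrightarrow> act Y N \<subseteq> S"
  unfolding act_def by (rule span_minimal) auto

lemma act_mono: "Y \<subseteq> Y' \<Longrightarrow> N \<subseteq> N' \<Longrightarrow> act Y N \<subseteq> act Y' N'"
  by (intro act_least) (auto intro: scale_in_act)

lemma act_le: "subspace N \<Longrightarrow> act Y N \<subseteq> N"
  by (rule act_least) (auto intro: subspace_scale)

lemma act_plus: assumes "subspace N" "subspace P" shows "act Y (N + P) = act Y N + act Y P"
proof
  show "act Y (N + P) \<subseteq> act Y N + act Y P"
    by (rule act_least) (auto simp: scale_right_distrib subspace_plus intro!: set_plus_intro scale_in_act elim!: set_plus_elim)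
  show "act Y N + act Y P \<subseteq> act Y (N + P)"
    using assms by (intro plus_least act_mono) (auto simp: plus_upper1 plus_upper2)
qed

lemma act_commute: "act Y (act Z N) = act Z (act Y N)"
proof -
  have *: "act Y (act Z N) \<subseteq> act Z (act Y N)" for Y Z
  proof (rule act_least, simp)
    fix y n assume y: "y \<in> Y" and "n \<in> act Z N"
    moreover have "act Z N \<subseteq> colon (act Z (act Y N)) y"
    proof (rule act_least)
      fix z n assume "z \<in> Z" "n \<in> N"
      then have "z *s y *s n \<in> act Z (act Y N)" using y by (intro scale_in_act)
      then show "z *s n \<in> colon (act Z (act Y N)) y"
        by (simp add: colon_def mult.commute)
    qed (simp add: subspace_colon)
    ultimately show "y *s n \<in> act Z (act Y N)" by (auto simp: colon_def)
  qed
  then show ?thesis by blast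
qed

lemma image_scale_plus: "scale x ` (N + P) = scale x ` N + scale x ` P"
proof
  show "scale x ` (N + P) \<subseteq> scale x ` N + scale x ` P"
    by (auto simp: scale_right_distrib intro!: set_plus_intro elim!: set_plus_elim)
  show "scale x ` N + scale x ` P \<subseteq> scale x ` (N + P)"
    by (auto simp: scale_right_distrib[symmetric] intro!: imageI set_plus_intro elim!: set_plus_elim)
qed

lemma image_scale_le: "subspace Q \<Longrightarrow> scale x ` Q \<subseteq> Q"
  by (auto intro: subspace_scale)

lemma image_scale_scale: "scale x ` scale y ` N = scale (x * y) ` N"
  by (simp add: image_image)

lemma act_image_scale: "act Y (scale x ` N) = scale x ` act Y N"
proof
  show "act Y (scale x ` N) \<subseteq> scale x ` act Y N"
  proof (rule act_least)
    fix y n assume "y \<in> Y" "n \<in> scale x ` N"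
    then obtain m where "m \<in> N" "n = x *s m" by auto
    then have "y *s n = x *s (y *s m)" by (simp only: scale_left_commute)
    then show "y *s n \<in> scale x ` act Y N" using \<open>y \<in> Y\<close> \<open>m \<in> N\<close> by (simp only: imageI scale_in_act)
  qed (simp add: subspace_image_scale)
  have "act Y N \<subseteq> colon (act Y (scale x ` N)) x"
  proof (rule act_least)
    fix y n assume "y \<in> Y" "n \<in> N"
    then have "y *s x *s n \<in> act Y (scale x ` N)" by (intro scale_in_act) auto
    then show "y *s n \<in> colon (act Y (scale x ` N)) x" by (simp add: colon_def mult.commute)
  qed (simp add: subspace_colon)
  then show "scale x ` act Y N \<subseteq> act Y (scale x ` N)" by (auto simp: colon_def)
qed

lemma regularD: "regular Q x \<Longrightarrow> x *s f \<in> Q \<Longrightarrow> f \<in> Q"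
  by (auto simp only: regular_def)

lemma regular_mult: assumes "regular Q x" "regular Q y" shows "regular Q (x * y)"
  unfolding regular_def
proof (intro allI impI)
  fix f assume "(x * y) *s f \<in> Q"
  then have "x *s y *s f \<in> Q" by simp
  then show "f \<in> Q" by (rule regularD[OF assms(2) regularD[OF assms(1)]])
qed

lemma regular_1: "regular Q 1"
  by (simp only: regular_def scale_one simp_thms)

lemma regular_power: "regular Q x \<Longrightarrow> regular Q (x ^ n)"
  by (induction n) (simp_all add: regular_mult regular_1)

text \<open>Exchange of the terms of a regular sequence: in \<open>a f = q + c g\<close>, regularity
  of \<open>c\<close> modulo \<open>a\<close> makes \<open>g\<close> a multiple \<open>a h\<close>
  modulo \<open>Q\<close>, and \<open>a\<close> cancels from \<open>a (f - c h)\<close>.\<close>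

lemma regular_cut_swap:
  assumes Q: "subspace Q" and a: "regular Q a" and c: "regular Q c" and ca: "regular (cut Q a) c"
  shows "regular (cut Q c) a"
  unfolding regular_def
proof (intro allI impI)
  fix f assume "a *s f \<in> cut Q c"
  then obtain q g where q: "q \<in> Q" "a *s f = q + c *s g" by (auto simp: in_cut_iff)
  then have "c *s g = (-q) + a *s f" by (simp only: minus_add_cancel)
  then have "c *s g \<in> cut Q a" unfolding in_cut_iff using subspace_neg[OF Q q(1)] by (intro bexI[of _ "-q"] exI[of _ f]) auto
  then have "g \<in> cut Q a" by (rule regularD[OF ca])
  then obtain q' h where h: "q' \<in> Q" "g = q' + a *s h" by (auto simp: in_cut_iff)
  have "a *s (f - c *s h) = q + c *s q'"
    using q h by (simp add: algebra_simps)
  moreover have "q + c *s q' \<in> Q" using q(1) h(1) Q by (intro subspace_add subspace_scale)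
  ultimately have "f - c *s h \<in> Q" by (simp only: regularD[OF a])
  then show "f \<in> cut Q c" unfolding in_cut_iff by (metis diff_add_cancel)
qed

subsection \<open>Length\<close>

text \<open>The lowest member only has to contain \<open>N\<close>, so for submodules this says that
  \<open>P/N\<close> has length at least \<open>n\<close>, and it is monotone in both ends. Lengths
  are compared through this predicate, which makes sense without finiteness.\<close>

primrec has_chain :: "nat \<Rightarrow> 'f set \<Rightarrow> 'f set \<Rightarrow> bool" where
  "has_chain 0 N P \<longleftrightarrow> N \<subseteq> P"
| "has_chain (Suc n) N P \<longleftrightarrow> (\<exists>P'. subspace P' \<and> P' \<subset> P \<and> has_chain n N P')"

definition finite_length :: "'f set \<Rightarrow> 'f set \<Rightarrow> bool"
  where "finite_length N P \<longleftrightarrow> (\<exists>k. \<forall>n. has_chain n N P \<longrightarrow> n \<le> k)"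

text \<open>A natural number, convenient in sums and differences. It is a length only together with
  \<open>finite_length\<close>, as \<open>Max\<close> of an infinite set has no specified
  value.\<close>

definition len :: "'f set \<Rightarrow> 'f set \<Rightarrow> nat"
  where "len N P = Max {n. has_chain n N P}"

lemma has_chain_top:
  assumes "has_chain n N P" "P \<subseteq> P'" shows "has_chain n N P'"
proof (cases n)
  case 0 then show ?thesis using assms by simp
next
  case (Suc m)
  then obtain U where "subspace U" "U \<subset> P" "has_chain m N U" using assms by auto
  then show ?thesis unfolding Suc has_chain.simps using psubset_subset_trans[OF _ assms(2)] by blast
qed

lemma has_chain_bot: "N' \<subseteq> N \<Longrightarrow> has_chain n N P \<Longrightarrow> has_chain n N' P"
  by (induction n arbitrary: P) auto

lemma has_chain_Suc: "has_chain (Suc n) N P \<Longrightarrow> has_chain n N P"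
  using has_chain_top by fastforce

lemma has_chain_le: "has_chain n N P \<Longrightarrow> m \<le> n \<Longrightarrow> has_chain m N P"
  by (induction n) (auto simp del: has_chain.simps simp: le_Suc_eq dest: has_chain_Suc)

lemma has_chain_trans: "has_chain i N P \<Longrightarrow> has_chain j P S \<Longrightarrow> has_chain (i + j) N S"
  by (induction j arbitrary: S) (auto intro: has_chain_top)

lemma has_chain_subset: "has_chain n N P \<Longrightarrow> N \<subseteq> P"
  by (induction n arbitrary: P) auto

text \<open>The common core of the second isomorphism theorem and of multiplication by a ring
  element: a strictly monotone map between intervals of submodules transports chains.\<close>

lemma has_chain_map:
  assumes "\<And>U. subspace U \<Longrightarrow> N \<subseteq> U \<Longrightarrow> U \<subseteq> P \<Longrightarrow> subspace (g U) \<and> N' \<subseteq> g U"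
    and "\<And>U V. subspace U \<Longrightarrow> subspace V \<Longrightarrow> N \<subseteq> U \<Longrightarrow> U \<subset> V \<Longrightarrow> V \<subseteq> P \<Longrightarrow> g U \<subset> g V"
  shows "has_chain n N P \<Longrightarrow> subspace P \<Longrightarrow> has_chain n N' (g P)"
  using assms
proof (induction n arbitrary: P)
  case (Suc n)
  then obtain P' where P': "subspace P'" "P' \<subset> P" "has_chain n N P'" by auto
  have "N \<subseteq> P'" using P' has_chain_subset by blast
  moreover have "has_chain n N' (g P')"
  proof (rule Suc.IH[OF P'(3,1)], goal_cases)
    case (1 U) then show ?case using Suc.prems(3) P'(2) by (meson psubset_imp_subset subset_trans)
  next
    case (2 U V) then show ?case using Suc.prems(4) P'(2) by (meson psubset_imp_subset subset_trans)
  qed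
  moreover have "g P' \<subset> g P" using Suc.prems(4)[OF P'(1) Suc.prems(2) \<open>N \<subseteq> P'\<close> P'(2)] by simp
  moreover have "subspace (g P')" using Suc.prems(3) P' \<open>N \<subseteq> P'\<close> by (simp add: less_imp_le)
  ultimately show ?case by (simp only: has_chain.simps) blast
qed auto

text \<open>The second isomorphism theorem: \<open>U\<close> is sent to \<open>P + U\<close>, and
  the modular law makes this strict on submodules of \<open>S\<close> above
  \<open>P \<inter> S\<close>.\<close>

lemma has_chain_plus:
  assumes "subspace P" "subspace S" "has_chain j (P \<inter> S) S"
  shows "has_chain j P (P + S)"
proof -
  have "has_chain j P (P + S)"
  proof (rule has_chain_map[where g = "\<lambda>U. P + U", OF _ _ assms(3,2)])
    fix U assume "subspace U" "P \<inter> S \<subseteq> U" "U \<subseteq> S"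
    then show "subspace (P + U) \<and> P \<subseteq> P + U" using assms by (simp add: subspace_plus plus_upper1)
  next
    fix U V assume *: "subspace U" "subspace V" "P \<inter> S \<subseteq> U" "U \<subset> V" "V \<subseteq> S"
    have "P + U \<subseteq> P + V" using * by (intro set_plus_mono2) auto
    moreover have "P + U \<noteq> P + V"
    proof
      assume eq: "P + U = P + V"
      have "V \<subseteq> U"
      proof
        fix v assume v: "v \<in> V"
        then have "v \<in> P + U" using plus_upper2[OF assms(1), of V] eq by auto
        then obtain p u where pu: "v = p + u" "p \<in> P" "u \<in> U" by (auto simp: set_plus_def)
        then have "p = v - u" by simp
        moreover have "u \<in> S" "v \<in> S" using v pu * by auto
          ultimately have "p \<in> S" by (simp add: subspace_diff[OF assms(2)])
        then show "v \<in> U" using pu * by (auto intro: subspace_add)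
      qed
      then show False using * by auto
    qed
    ultimately show "P + U \<subset> P + V" by auto
  qed
  then show ?thesis by simp
qed

text \<open>Each step of the chain from \<open>N\<close> to \<open>S\<close> is charged to the part
  inside \<open>P\<close> if it changes the intersection with \<open>P\<close>, and otherwise to the
  part above \<open>P\<close>.\<close>

lemma has_chain_split:
  assumes "subspace N" "subspace P" "N \<subseteq> P"
  shows "has_chain n N S \<Longrightarrow> subspace S \<Longrightarrow> P \<subseteq> S \<Longrightarrow>
    \<exists>i j. n \<le> i + j \<and> has_chain i N P \<and> has_chain j P S"
proof -
  \<comment> \<open>Generalized to \<open>S\<close> that need not contain \<open>P\<close>, since
    the lower members of the chain do not.\<close>
  have *: "has_chain n N S \<Longrightarrow> subspace S \<Longrightarrow>
      \<exists>i j. n = i + j \<and> has_chain i N (P \<inter> S) \<and> has_chain j (P \<inter> S) S" for S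
  proof (induction n arbitrary: S)
    case 0 then show ?case using assms(3) by (auto intro!: exI[of _ 0])
  next
    case (Suc n)
    then obtain S' where S': "subspace S'" "S' \<subset> S" "has_chain n N S'" by auto
    from Suc.IH[OF S'(3,1)] obtain i j where
      ij: "n = i + j" "has_chain i N (P \<inter> S')" "has_chain j (P \<inter> S') S'" by blast
    show ?case
    proof (cases "P \<inter> S' = P \<inter> S")
      case True
      with ij S' show ?thesis by (intro exI[of _ i] exI[of _ "Suc j"]) auto
    next
      case False
      have "has_chain (Suc i) N (P \<inter> S)"
        using False ij S' assms by (auto intro!: exI[of _ "P \<inter> S'"] subspace_inter)
      moreover have "has_chain j (P \<inter> S) S"
      proof -
        \<comment> \<open>The upper chain was built over \<open>P \<inter> S'\<close>; adding
          \<open>P \<inter> S\<close> moves it over the larger intersection.\<close>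
        have "has_chain j (P \<inter> S) (P \<inter> S + S')"
          using S' ij assms Suc.prems
          by (intro has_chain_plus) (auto intro: subspace_inter has_chain_bot
              simp: Int_assoc inf.absorb2 less_imp_le)
        moreover have "P \<inter> S + S' \<subseteq> S" using S' Suc.prems by (intro plus_least) auto
        ultimately show ?thesis using has_chain_top by blast
      qed
      ultimately show ?thesis using ij by (intro exI[of _ "Suc i"] exI[of _ j]) auto
    qed
  qed
  assume S: "has_chain n N S" "subspace S" "P \<subseteq> S"
  from S(3) have eq: "P \<inter> S = P" by blast
  from *[OF S(1,2)] obtain i j where "n = i + j" "has_chain i N P" "has_chain j P S"
    unfolding eq by blast
  then show "\<exists>i j. n \<le> i + j \<and> has_chain i N P \<and> has_chain j P S"
    by (intro exI[of _ i] exI[of _ j]) simp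
qed

lemma has_chain_iff_len:
  assumes "finite_length N P" "N \<subseteq> P" shows "has_chain n N P \<longleftrightarrow> n \<le> len N P"
proof
  have fin: "finite {n. has_chain n N P}" using assms(1) unfolding finite_length_def
    by (simp add: finite_nat_set_iff_bounded_le)
  show "n \<le> len N P" if "has_chain n N P"
    unfolding len_def by (rule Max_ge[OF fin]) (simp only: that mem_Collect_eq)
  have "0 \<in> {n. has_chain n N P}" using assms(2) by simp
  then have "len N P \<in> {n. has_chain n N P}" unfolding len_def by (intro Max_in[OF fin]) blast
  then have "has_chain (len N P) N P" by (simp only: mem_Collect_eq)
  then show "has_chain n N P" if "n \<le> len N P" using that by (rule has_chain_le)
qed

lemma len_eqI:
  assumes "\<And>n. has_chain n N P \<longleftrightarrow> n \<le> k" shows "len N P = k"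
proof -
  have "{n. has_chain n N P} = {..k}" using assms by auto
  then show ?thesis unfolding len_def by (simp add: Max_eq_iff)
qed

lemma finite_length_sub:
  assumes "finite_length N S" "N \<subseteq> N'" "P \<subseteq> S" shows "finite_length N' P"
proof -
  have "has_chain n N' P \<Longrightarrow> has_chain n N S" for n
    using has_chain_top[OF has_chain_bot[OF assms(2)] assms(3)] .
  then show ?thesis using assms(1) unfolding finite_length_def by auto
qed

lemma finite_length_trans:
  assumes "subspace N" "subspace P" "subspace S" "N \<subseteq> P" "P \<subseteq> S"
    "finite_length N P" "finite_length P S"
  shows "finite_length N S"
proof -
  obtain k l where "\<And>n. has_chain n N P \<Longrightarrow> n \<le> k" "\<And>n. has_chain n P S \<Longrightarrow> n \<le> l"
    using assms unfolding finite_length_def by auto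
  then have "n \<le> k + l" if "has_chain n N S" for n
    using has_chain_split[OF assms(1,2,4) that assms(3,5)] by (meson add_mono le_trans)
  then show ?thesis unfolding finite_length_def by blast
qed

lemma len_add:
  assumes "subspace N" "subspace P" "subspace S" "N \<subseteq> P" "P \<subseteq> S" "finite_length N S"
  shows "len N S = len N P + len P S"
proof (rule antisym)
  have fin: "finite_length N P" "finite_length P S"
    using assms finite_length_sub by blast+
  have NS: "N \<subseteq> S" using assms by blast
  have "has_chain (len N S) N S" using assms(6) NS has_chain_iff_len by blast
  from has_chain_split[OF assms(1,2,4) this assms(3,5)] obtain i j where
    "len N S \<le> i + j" "has_chain i N P" "has_chain j P S" by blast
  then show "len N S \<le> len N P + len P S"
    using has_chain_iff_len[OF fin(1) assms(4)] has_chain_iff_len[OF fin(2) assms(5)] by fastforce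
  show "len N P + len P S \<le> len N S"
    using has_chain_trans[of "len N P" N P "len P S" S] has_chain_iff_len[OF fin(1) assms(4)]
      has_chain_iff_len[OF fin(2) assms(5)] has_chain_iff_len[OF assms(6) NS] by blast
qed

lemma len_self [simp]: "len N N = 0"
proof -
  have "has_chain n N N \<longleftrightarrow> n \<le> 0" for n
    by (cases n) (auto dest: has_chain_subset)
  then show ?thesis by (rule len_eqI)
qed

text \<open>Multiplication by \<open>x\<close> and its inverse, the colon, are mutually inverse between the
  interval from \<open>colon Q x\<close> to the whole module and the interval from \<open>Q\<close> to \<open>cut Q x\<close>.\<close>

lemma has_chain_colon_iff:
  assumes Q: "subspace Q"
  shows "has_chain n (colon Q x) UNIV \<longleftrightarrow> has_chain n Q (cut Q x)"
proof
  assume *: "has_chain n (colon Q x) UNIV"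
  have "has_chain n Q (Q + range (scale x))"
  proof (rule has_chain_map[where g = "\<lambda>U. Q + scale x ` U", OF _ _ *])
    fix U assume "subspace U"
    then show "subspace (Q + scale x ` U) \<and> Q \<subseteq> Q + scale x ` U"
      using Q by (simp add: subspace_plus plus_upper1 subspace_image_scale)
  next
    fix U V assume *: "subspace U" "subspace V" "colon Q x \<subseteq> U" "U \<subset> V"
    have "Q + scale x ` U \<subseteq> Q + scale x ` V" using * by (intro set_plus_mono2) auto
    moreover have "Q + scale x ` U \<noteq> Q + scale x ` V"
    proof
      assume eq: "Q + scale x ` U = Q + scale x ` V"
      have "V \<subseteq> U"
      proof
        fix v assume "v \<in> V"
        then have "x *s v \<in> Q + scale x ` U" using eq plus_upper2[OF Q, of "scale x ` V"] by auto
        then obtain q u where qu: "q \<in> Q" "u \<in> U" "x *s v = q + x *s u"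
          by (auto simp: set_plus_def)
        then have "x *s (v - u) \<in> Q" by (simp add: algebra_simps)
        then have "v - u \<in> U" using *(3) by (auto simp: colon_def)
        then show "v \<in> U" using qu(2) *(1) by (metis diff_add_cancel subspace_add)
      qed
      then show False using * by auto
    qed
    ultimately show "Q + scale x ` U \<subset> Q + scale x ` V" by auto
  qed simp
  then show "has_chain n Q (cut Q x)" by (simp add: cut_def)
next
  assume *: "has_chain n Q (cut Q x)"
  have "has_chain n (colon Q x) (colon (cut Q x) x)"
  proof (rule has_chain_map[where g = "\<lambda>U. colon U x", OF _ _ *])
    fix U assume "subspace U" "Q \<subseteq> U"
    then show "subspace (colon U x) \<and> colon Q x \<subseteq> colon U x"
      by (auto simp: subspace_colon) (auto simp: colon_def)
  next
    fix U V assume *: "subspace U" "subspace V" "Q \<subseteq> U" "U \<subset> V" "V \<subseteq> cut Q x"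
    have "colon U x \<subseteq> colon V x" using * by (auto simp: colon_def)
    moreover have "colon U x \<noteq> colon V x"
    proof
      assume eq: "colon U x = colon V x"
      obtain v where v: "v \<in> V" "v \<notin> U" using * by auto
      then have "v \<in> cut Q x" using *(5) by auto
      then obtain q g where g: "q \<in> Q" "v = q + x *s g" unfolding in_cut_iff by auto
      have "x *s g = v - q" using g by simp
      moreover have "q \<in> V" using g * by auto
      ultimately have "x *s g \<in> V" using v subspace_diff[OF *(2)] by auto
      then have "g \<in> colon V x" by (simp add: colon_def)
      then have "x *s g \<in> U" using eq by (auto simp: colon_def)
      moreover have "q \<in> U" using g * by auto
      ultimately show False using v g subspace_add[OF *(1)] by auto
    qed
    ultimately show "colon U x \<subset> colon V x" by auto
  qed (simp add: subspace_cut Q)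
  moreover have "colon (cut Q x) x = UNIV" unfolding colon_def using scale_in_cut[OF Q] by blast
  ultimately show "has_chain n (colon Q x) UNIV" by metis
qed

lemma len_colon: "subspace Q \<Longrightarrow> len (colon Q x) UNIV = len Q (cut Q x)"
  unfolding len_def by (simp only: has_chain_colon_iff)

end

section \<open>The Rees module\<close>

context scalar_module
begin

text \<open>\<open>filt G Q n\<close> represents \<open>I\<^sup>n(F/Q)\<close> for the ideal \<open>I\<close> generated by \<open>G\<close>.\<close>

primrec filt :: "'s set \<Rightarrow> 'f set \<Rightarrow> nat \<Rightarrow> 'f set" where
  "filt G Q 0 = UNIV"
| "filt G Q (Suc n) = act G (filt G Q n) + Q"

lemma subspace_filt [simp]: "subspace Q \<Longrightarrow> subspace (filt G Q n)"
  by (cases n) (auto intro: subspace_plus)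

lemma filt_upper: "Q \<subseteq> filt G Q n"
  by (cases n) (auto intro: plus_upper2[THEN subsetD])

lemma filt_Suc_le: "subspace Q \<Longrightarrow> filt G Q (Suc n) \<subseteq> filt G Q n"
  by (simp add: plus_least act_le filt_upper)

lemma filt_antimono: "subspace Q \<Longrightarrow> m \<le> n \<Longrightarrow> filt G Q n \<subseteq> filt G Q m"
  by (rule lift_Suc_antimono_le[of "filt G Q"]) (auto simp: filt_Suc_le simp del: filt.simps)

lemma act_filt_le: "subspace Q \<Longrightarrow> act G (filt G Q n) \<subseteq> filt G Q (Suc n)"
  by (simp add: plus_upper1)

lemma scale_in_filt: "subspace Q \<Longrightarrow> x \<in> G \<Longrightarrow> f \<in> filt G Q n \<Longrightarrow> x *s f \<in> filt G Q (Suc n)"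
  using act_filt_le scale_in_act by blast

lemma filt_cut: "subspace Q \<Longrightarrow> filt G (cut Q x) n = cut (filt G Q n) x"
proof (induction n)
  case 0 then show ?case using cut_upper[of UNIV x] by auto
next
  case (Suc n)
  have "act G (cut (filt G Q n) x) = act G (filt G Q n) + act G (range (scale x))"
    unfolding cut_def using Suc.prems by (intro act_plus subspace_image_scale) auto
  moreover have "act G (range (scale x)) + range (scale x) = range (scale x)"
    unfolding add.commute[of "act G (range (scale x))"]
    by (intro plus_absorb act_le subspace_image_scale subspace_act subspace_UNIV)
  ultimately show ?case using Suc by (simp add: cut_def add.assoc add.left_commute)
qed

text \<open>With \<open>x\<close> thought of as a variable, these are the elements of degree
  \<open>m\<close> whose degree in \<open>x\<close> is below \<open>j\<close>: the sum of
  \<open>Q\<close> and all \<open>x ^ i F (m - i)\<close> with \<open>i < j\<close>. Leading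
  coefficients are taken modulo this.\<close>

primrec lower_part :: "'s \<Rightarrow> (nat \<Rightarrow> 'f set) \<Rightarrow> 'f set \<Rightarrow> nat \<Rightarrow> nat \<Rightarrow> 'f set" where
  "lower_part x F Q m 0 = Q"
| "lower_part x F Q m (Suc j) = lower_part x F Q m j + scale (x ^ j) ` F (m - j)"

context
  fixes x :: 's and G :: "'s set" and Q :: "'f set"
  assumes Q: "subspace Q"
begin

abbreviation "low \<equiv> lower_part x (filt G Q) Q"

lemma subspace_low: "subspace (low m j)"
  by (induction j) (auto simp: Q intro!: subspace_plus subspace_image_scale)

lemma low_Suc_upper: "low m j \<subseteq> low m (Suc j)"
  by (simp add: plus_upper1 subspace_image_scale Q)

lemma Q_le_low: "Q \<subseteq> low m j"
  by (induction j) (use low_Suc_upper in \<open>auto simp del: lower_part.simps(2)\<close>)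

lemma scale_low:
  assumes "c \<in> G" shows "u \<in> low m j \<Longrightarrow> c *s u \<in> low (Suc m) j"
proof (induction j arbitrary: u)
  case 0 then show ?case by (simp add: Q subspace_scale)
next
  case (Suc j)
  then obtain v f where *: "u = v + x ^ j *s f" "v \<in> low m j" "f \<in> filt G Q (m - j)"
    by (auto elim!: set_plus_elim)
  have "c *s f \<in> filt G Q (Suc (m - j))" using * assms Q scale_in_filt by blast
  then have "c *s f \<in> filt G Q (Suc m - j)"
    by (cases "j \<le> m") (simp_all add: Suc_diff_le del: filt.simps(2))
  moreover have "c *s u = c *s v + x ^ j *s c *s f"
    using * by (simp add: scale_right_distrib mult.commute)
  ultimately show ?case using Suc.IH[OF *(2)] by (simp only: lower_part.simps set_plus_intro imageI)
qed

lemma scale_low_Suc: "u \<in> low m j \<Longrightarrow> x *s u \<in> low (Suc m) (Suc j)"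
proof (induction j arbitrary: u)
  case 0
  then have "x *s u \<in> Q" by (simp add: Q subspace_scale)
  then show ?case using Q_le_low[of "Suc m" "Suc 0"] by auto
next
  case (Suc j)
  then obtain v f where *: "u = v + x ^ j *s f" "v \<in> low m j" "f \<in> filt G Q (m - j)"
    by (auto elim!: set_plus_elim)
  have "x *s u = x *s v + x ^ Suc j *s f" using * by (simp add: scale_right_distrib)
  moreover have "x *s v \<in> low (Suc m) (Suc j)" by (rule Suc.IH[OF *(2)])
  ultimately show ?case using *(3)
    by (simp only: lower_part.simps(2)[of _ _ _ _ "Suc j"] diff_Suc_Suc set_plus_intro imageI)
qed

lemma filt_insert_le_low: "filt (insert x G) Q m \<subseteq> low m (Suc m)"
proof (induction m)
  case 0 then show ?case using plus_upper2[OF Q, of UNIV] by simp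
next
  case (Suc m)
  have "act (insert x G) (filt (insert x G) Q m) \<subseteq> low (Suc m) (Suc (Suc m))"
  proof (rule act_least[OF subspace_low])
    fix y n assume y: "y \<in> insert x G" "n \<in> filt (insert x G) Q m"
    then have n: "n \<in> low m (Suc m)" using Suc by auto
    show "y *s n \<in> low (Suc m) (Suc (Suc m))"
    proof (cases "y = x")
      case True then show ?thesis using scale_low_Suc[OF n] by simp
    next
      case False
      then have "y *s n \<in> low (Suc m) (Suc m)" using y scale_low[OF _ n] by simp
      then show ?thesis using low_Suc_upper by blast
    qed
  qed
  then show ?case unfolding filt.simps by (intro plus_least subspace_low Q_le_low)
qed

end

end

section \<open>The ascending chain condition and the graded Hilbert basis theorem\<close>

locale noetherian_scalar_module = scalar_module scale
  for scale :: "'s::comm_ring_1 \<Rightarrow> 'f::ab_group_add \<Rightarrow> 'f" (infixr \<open>*s\<close> 75) +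
  fixes K :: "'f set"
  assumes subspace_K [simp]: "subspace K"
    and finitely_generated_above:
      "subspace N \<Longrightarrow> K \<subseteq> N \<Longrightarrow> \<exists>Y. finite Y \<and> N = span (Y \<union> K)"
begin

lemma ex_maximal:
  assumes "\<A> \<noteq> {}" "\<And>N. N \<in> \<A> \<Longrightarrow> subspace N \<and> K \<subseteq> N"
  obtains N where "N \<in> \<A>" "\<And>P. P \<in> \<A> \<Longrightarrow> N \<subseteq> P \<Longrightarrow> P = N"
proof -
  have "\<exists>M\<in>\<A>. \<forall>P\<in>\<A>. M \<subseteq> P \<longrightarrow> P = M"
  proof (rule subset_Zorn_nonempty[OF assms(1)])
    fix \<C> assume ne: "\<C> \<noteq> {}" and ch: "subset.chain \<A> \<C>"
    have sub: "\<C> \<subseteq> \<A>" and tot: "\<And>U V. U \<in> \<C> \<Longrightarrow> V \<in> \<C> \<Longrightarrow> U \<subseteq> V \<or> V \<subseteq> U"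
      using ch by (auto simp: subset.chain_def)
    have C: "subspace N" "K \<subseteq> N" if "N \<in> \<C>" for N
      using assms(2) sub that by blast+
    have "subspace (\<Union>\<C>)"
    proof (rule subspaceI)
      show "0 \<in> \<Union>\<C>" using ne C subspace_0 by blast
      fix u v assume "u \<in> \<Union>\<C>" "v \<in> \<Union>\<C>"
      then obtain U V where "U \<in> \<C>" "V \<in> \<C>" "u \<in> U" "v \<in> V" by blast
      then obtain W where "W \<in> \<C>" "u \<in> W" "v \<in> W" using tot by blast
      then show "u + v \<in> \<Union>\<C>" using C subspace_add by blast
    next
      fix c u assume "u \<in> \<Union>\<C>" then show "c *s u \<in> \<Union>\<C>" using C subspace_scale by blast
    qed
    moreover have "K \<subseteq> \<Union>\<C>" using ne C by blast
    ultimately obtain Y where Y: "finite Y" "\<Union>\<C> = span (Y \<union> K)"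
      using finitely_generated_above by blast
    have "Y \<subseteq> \<Union>\<C>" using Y span_superset by blast
    then obtain N where N: "N \<in> \<C>" "Y \<subseteq> N"
      using finite_subset_Union_chain[OF Y(1) _ ne ch] by blast
    then have "\<Union>\<C> \<subseteq> N" unfolding Y(2) using C[OF N(1)] by (intro span_minimal) auto
    then have "\<Union>\<C> = N" using N by blast
    then show "\<Union>\<C> \<in> \<A>" using N sub by auto
  qed
  then show ?thesis using that by blast
qed

lemma mono_seq_stabilizes:
  assumes "\<And>i. subspace (N i)" "\<And>i. K \<subseteq> N i" "\<And>i. N i \<subseteq> N (Suc i)"
  obtains j where "\<And>i. N i \<subseteq> N j"
proof -
  obtain U where U: "U \<in> range N" "\<And>P. P \<in> range N \<Longrightarrow> U \<subseteq> P \<Longrightarrow> P = U"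
    by (rule ex_maximal[of "range N"]) (use assms(1,2) in blast)+
  then obtain j where j: "U = N j" by auto
  have mono: "i \<le> k \<Longrightarrow> N i \<subseteq> N k" for i k
    by (rule lift_Suc_mono_le[of N]) (auto intro: assms(3)[THEN subsetD])
  have "N i \<subseteq> N j" for i
  proof (cases "i \<le> j")
    case False
    then have "N i = U" using U(2)[of "N i"] mono[of j i] j by simp
    then show ?thesis using j by simp
  qed (rule mono)
  then show ?thesis by (rule that)
qed

text \<open>The graded Hilbert basis theorem for the Rees module of \<open>G\<close>. As in Hilbert's proof, a
  graded submodule is replaced by the modules of leading coefficients with respect to \<open>x\<close>.\<close>

lemma rees_module_noetherian:
  assumes "finite G" and Q: "subspace Q" and KQ: "K \<subseteq> Q"
  shows "(\<And>n. subspace (N n)) \<Longrightarrow> (\<And>n. Q \<subseteq> N n) \<Longrightarrow> (\<And>n. N n \<subseteq> filt G Q n) \<Longrightarrow>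
    (\<And>n. act G (N n) \<subseteq> N (Suc n)) \<Longrightarrow> \<exists>n0. \<forall>n\<ge>n0. N (Suc n) \<subseteq> act G (N n) + Q"
  using assms(1)
proof (induction G arbitrary: N rule: finite_induct)
  case empty
  have "act {} P = {0}" for P by (simp add: act_def)
  then have "filt {} Q (Suc n) = Q" for n by simp
  then have "N (Suc n) \<subseteq> Q" for n using empty(3) by metis
  then show ?case using plus_upper2[OF subspace_act] by blast
next
  case (insert x G)
  note subN = insert.prems(1) and QN = insert.prems(2) and Nfilt = insert.prems(3)
    and actN = insert.prems(4)
  let ?F = "filt G Q" and ?low = "lower_part x (filt G Q) Q"
  \<comment> \<open>The leading coefficients at \<open>x ^ j\<close>. As \<open>x\<close> is a ring
    element and not a variable, a coefficient is not determined by the element; \<open>L n j\<close>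
    takes all \<open>f\<close> of degree \<open>n\<close> for which some element of
    \<open>N (n + j)\<close> equals \<open>x ^ j f\<close> modulo lower powers of
    \<open>x\<close>.\<close>
  define L where "L n j = ?F n \<inter> colon (N (n + j) + ?low (n + j) j) (x ^ j)" for n j
  have subNl: "subspace (N a + ?low b c)" for a b c
    by (intro subspace_plus subN subspace_low Q)
  have subL: "subspace (L n j)" for n j
    unfolding L_def using Q by (intro subspace_inter subspace_colon subNl) auto
  have LE: "\<exists>h g. h \<in> N (n + j) \<and> g \<in> ?low (n + j) j \<and> x ^ j *s f = h + g" if "f \<in> L n j" for f n j
    using that unfolding L_def colon_def by (auto elim!: set_plus_elim)
  have LI: "f \<in> L n j" if "f \<in> ?F n" "h \<in> N (n + j)" "g \<in> ?low (n + j) j" "x ^ j *s f = h + g" for f n j h g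
    using that unfolding L_def colon_def by auto
  have QL: "Q \<subseteq> L n j" for n j
  proof
    fix q assume q: "q \<in> Q"
    show "q \<in> L n j"
    proof (rule LI)
      show "x ^ j *s q \<in> N (n + j)" using q QN Q subspace_scale by blast
      show "0 \<in> ?low (n + j) j" using subspace_low[OF Q] subspace_0 by blast
    qed (use q filt_upper in auto)
  qed
  have scaleN: "c *s h \<in> N (Suc n)" if "c \<in> insert x G" "h \<in> N n" for c h n
    using actN[of n] scale_in_act[OF that] by blast
  have L3: "act G (L n j) \<subseteq> L (Suc n) j" for n j
  proof (rule act_least[OF subL])
    fix c f assume c: "c \<in> G" and f: "f \<in> L n j"
    then obtain h g where hg: "h \<in> N (n + j)" "g \<in> ?low (n + j) j" "x ^ j *s f = h + g"
      using LE by blast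
    show "c *s f \<in> L (Suc n) j"
    proof (rule LI)
      show "c *s f \<in> ?F (Suc n)" using f c scale_in_filt[OF Q] by (auto simp: L_def simp del: filt.simps)
      show "c *s h \<in> N (Suc n + j)" using scaleN c hg by simp
      show "c *s g \<in> ?low (Suc n + j) j" using scale_low[OF Q c hg(2)] by simp
      have "x ^ j *s c *s f = c *s (h + g)" unfolding hg(3)[symmetric] by (rule scale_left_commute)
      then show "x ^ j *s c *s f = c *s h + c *s g" by (simp only: scale_right_distrib)
    qed
  qed
  have L4: "L n j \<subseteq> L n (Suc j)" for n j
  proof
    fix f assume f: "f \<in> L n j"
    then obtain h g where hg: "h \<in> N (n + j)" "g \<in> ?low (n + j) j" "x ^ j *s f = h + g"
      using LE by blast
    show "f \<in> L n (Suc j)"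
    proof (rule LI)
      show "f \<in> ?F n" using f by (simp add: L_def)
      show "x *s h \<in> N (n + Suc j)" using scaleN hg by simp
      show "x *s g \<in> ?low (n + Suc j) (Suc j)" using scale_low_Suc[OF Q hg(2)] by simp
      have "x ^ Suc j *s f = x *s (x ^ j *s f)" by simp
      then show "x ^ Suc j *s f = x *s h + x *s g" unfolding hg(3) by (simp only: scale_right_distrib)
    qed
  qed
  have Lmono: "i \<le> j \<Longrightarrow> L n i \<subseteq> L n j" for n i j
    by (rule lift_Suc_mono_le[of "L n"]) (rule L4)
  \<comment> \<open>By \<open>L3\<close> and \<open>L4\<close>, multiplication by \<open>G\<close>
    raises \<open>n\<close> and multiplication by \<open>x\<close> raises \<open>j\<close>; so
    \<open>U\<close> is a graded submodule for the smaller generating set \<open>G\<close>.\<close>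
  define U where "U n = (\<Union>j. L n j)" for n
  have "\<exists>j. \<forall>i. L n i \<subseteq> L n j" for n
    by (rule mono_seq_stabilizes[of "L n"]) (use subL QL KQ L4 in blast)+
  then have "\<forall>n. \<exists>j. \<forall>i. L n i \<subseteq> L n j" by blast
  from choice[OF this] obtain J where J: "\<And>n i. L n i \<subseteq> L n (J n)" by blast
  have UJ: "U n = L n (J n)" for n unfolding U_def using J by blast
  have "\<exists>n0. \<forall>n\<ge>n0. U (Suc n) \<subseteq> act G (U n) + Q"
  proof (rule insert.IH)
    fix n
    show "subspace (U n)" "Q \<subseteq> U n" by (simp_all add: UJ subL QL)
    show "U n \<subseteq> filt G Q n" by (auto simp: UJ L_def)
    show "act G (U n) \<subseteq> U (Suc n)" unfolding UJ[of n] using L3 U_def by blast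
  qed
  then obtain n\<^sub>U where nU: "\<And>n. n \<ge> n\<^sub>U \<Longrightarrow> U (Suc n) \<subseteq> act G (U n) + Q" by blast
  \<comment> \<open>From degree \<open>n\<^sub>U\<close> on, \<open>U\<close> is generated by its
    previous component, so the finitely many indices \<open>J n\<close> up to there bound the index
    needed in every degree.\<close>
  define j0 where "j0 = Max (J ` {..n\<^sub>U})"
  have J_le: "J n \<le> j0" if "n \<le> n\<^sub>U" for n unfolding j0_def using that by (intro Max_ge) auto
  have U_le: "U n \<subseteq> L n j0" for n
  proof (induction n)
    case 0 then show ?case using UJ Lmono J_le[of 0] by blast
  next
    case (Suc n)
    show ?case
    proof (cases "Suc n \<le> n\<^sub>U")
      case True then show ?thesis using UJ Lmono J_le by blast
    next
      case False
      then have "U (Suc n) \<subseteq> act G (U n) + Q" by (intro nU) simp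
      also have "\<dots> \<subseteq> act G (L n j0) + Q" using Suc by (intro set_plus_mono2 act_mono) auto
      also have "\<dots> \<subseteq> L (Suc n) j0" by (intro plus_least subL L3 QL)
      finally show ?thesis .
    qed
  qed
  have "\<exists>n0. \<forall>n\<ge>n0. L (Suc n) j \<subseteq> act G (L n j) + Q" for j
    by (rule insert.IH) (use subL QL L3 in \<open>auto simp: L_def\<close>)
  then have "\<forall>j. \<exists>n0. \<forall>n\<ge>n0. L (Suc n) j \<subseteq> act G (L n j) + Q" by blast
  from choice[OF this] obtain n0 where n0: "\<And>j n. n \<ge> n0 j \<Longrightarrow> L (Suc n) j \<subseteq> act G (L n j) + Q"
    by blast
  define n1 where "n1 = Max (n0 ` {..j0})"
  have n1: "L (Suc n) j \<subseteq> act G (L n j) + Q" if "j \<le> j0" "n \<ge> n1" for n j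
  proof -
    have "n0 j \<le> n1" unfolding n1_def using that by (intro Max_ge) auto
    then show ?thesis using n0 that by simp
  qed
  \<comment> \<open>Division with remainder: an element of the product with \<open>N m\<close> that
    has the same term at \<open>x ^ j\<close> is subtracted, until only \<open>Q\<close> is
    left.\<close>
  have reduce: "h \<in> act (insert x G) (N m) + Q"
    if m: "m \<ge> n1 + j0" and j: "j \<le> Suc (Suc m)" and h: "h \<in> N (Suc m)" "h \<in> ?low (Suc m) j" for m j h
    using j h
  proof (induction j arbitrary: h)
    case 0 then show ?case using plus_upper2[OF subspace_act] by auto
  next
    case (Suc j)
    let ?A = "act (insert x G) (N m)"
    have subA: "subspace (?A + Q)" using Q by (intro subspace_plus) auto
    obtain g f where gf: "h = g + x ^ j *s f" "g \<in> ?low (Suc m) j" "f \<in> ?F (Suc m - j)"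
      using Suc.prems by (auto elim!: set_plus_elim)
    have jm: "j \<le> Suc m" using Suc.prems by simp
    have fL: "f \<in> L (Suc m - j) j"
    proof (rule LI[OF gf(3)])
      show "h \<in> N (Suc m - j + j)" "- g \<in> ?low (Suc m - j + j) j"
        using jm Suc.prems gf subspace_neg[OF subspace_low[OF Q]] by simp_all
      show "x ^ j *s f = h + - g" using gf by simp
    qed
    have "\<exists>w g'. w \<in> ?A \<and> g' \<in> ?low (Suc m) j \<and> x ^ j *s f = w + g'"
    proof (cases "j \<le> j0")
      case True
      \<comment> \<open>Small \<open>j\<close>: the coefficient is a combination of coefficients one
        degree lower with factors from \<open>G\<close>, hence comes from \<open>G\<close> times
        \<open>N m\<close>.\<close>
      with m have "L (Suc (m - j)) j \<subseteq> act G (L (m - j) j) + Q" by (intro n1) auto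
      moreover have "Suc m - j = Suc (m - j)" using True m by simp
      ultimately obtain a q where aq: "f = a + q" "a \<in> act G (L (m - j) j)" "q \<in> Q"
        using fL by (auto elim!: set_plus_elim)
      have "act G (L (m - j) j) \<subseteq> colon (?A + ?low (Suc m) j) (x ^ j)"
      proof (rule act_least)
        show "subspace (colon (?A + ?low (Suc m) j) (x ^ j))"
          by (intro subspace_colon subspace_plus subspace_low Q) simp
        fix c f' assume c: "c \<in> G" and "f' \<in> L (m - j) j"
        then obtain h' g' where hg: "h' \<in> N m" "g' \<in> ?low m j" "x ^ j *s f' = h' + g'"
          using LE[of f' "m - j" j] True m by auto
        have "x ^ j *s c *s f' = c *s (h' + g')" unfolding hg(3)[symmetric] by (rule scale_left_commute)
        then have "x ^ j *s c *s f' = c *s h' + c *s g'" by (simp only: scale_right_distrib)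
        moreover have "c *s h' \<in> ?A" using c hg by (intro scale_in_act) auto
        moreover have "c *s g' \<in> ?low (Suc m) j" by (rule scale_low[OF Q c hg(2)])
        ultimately show "c *s f' \<in> colon (?A + ?low (Suc m) j) (x ^ j)"
          unfolding colon_def by (simp del: scale_scale add: set_plus_intro)
      qed
      then have "x ^ j *s a \<in> ?A + ?low (Suc m) j" using aq(2) by (auto simp: colon_def)
      then obtain w g' where "x ^ j *s a = w + g'" "w \<in> ?A" "g' \<in> ?low (Suc m) j"
        by (auto elim!: set_plus_elim)
      moreover have "x ^ j *s q \<in> ?low (Suc m) j"
        using aq(3) Q Q_le_low[OF Q] subspace_scale by blast
      ultimately have "w \<in> ?A" "g' + x ^ j *s q \<in> ?low (Suc m) j" "x ^ j *s f = w + (g' + x ^ j *s q)"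
        using aq(1) subspace_add[OF subspace_low[OF Q]] by (auto simp: scale_right_distrib add.assoc)
      then show ?thesis by blast
    next
      case False
      \<comment> \<open>Large \<open>j\<close>: the coefficient already occurs at
        \<open>x ^ (j - 1)\<close>, so \<open>x\<close> times an element of \<open>N m\<close> has
        it.\<close>
      then obtain i where i: "j = Suc i" by (cases j) auto
      have "f \<in> L (Suc m - j) j0" using fL U_le by (auto simp: U_def)
      then have "f \<in> L (Suc m - j) i" using False i Lmono[of j0 i] by auto
      then obtain h' g' where hg: "h' \<in> N m" "g' \<in> ?low m i" "x ^ i *s f = h' + g'"
        using LE[of f "Suc m - j" i] i jm by auto
      have "x ^ j *s f = x *s (x ^ i *s f)" using i by simp
      then have "x ^ j *s f = x *s h' + x *s g'" unfolding hg(3) by (simp only: scale_right_distrib)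
      moreover have "x *s h' \<in> ?A" using hg by (intro scale_in_act) auto
      moreover have "x *s g' \<in> ?low (Suc m) j" using scale_low_Suc[OF Q hg(2)] i by simp
      ultimately show ?thesis by blast
    qed
    then obtain w g' where w: "w \<in> ?A" "g' \<in> ?low (Suc m) j" "x ^ j *s f = w + g'" by blast
    have "w \<in> N (Suc m)" using w(1) actN by blast
    then have "h - w \<in> N (Suc m)" using Suc.prems subN subspace_diff by blast
    moreover have "h - w = g + g'" using gf w by simp
    then have "h - w \<in> ?low (Suc m) j" using gf w subspace_add[OF subspace_low[OF Q]] by simp
    ultimately have "h - w \<in> ?A + Q" using Suc.IH Suc.prems by simp
    moreover have "w \<in> ?A + Q" using w(1) plus_upper1[OF Q] by blast
    ultimately have "(h - w) + w \<in> ?A + Q" by (rule subspace_add[OF subA])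
    then show ?case by simp
  qed
  have "N (Suc m) \<subseteq> act (insert x G) (N m) + Q" if m: "m \<ge> n1 + j0" for m
  proof
    fix h assume h: "h \<in> N (Suc m)"
    then have "h \<in> ?low (Suc m) (Suc (Suc m))"
      using Nfilt filt_insert_le_low[OF Q] by blast
    then show "h \<in> act (insert x G) (N m) + Q" using reduce[OF m order_refl h] by simp
  qed
  then show ?case by blast
qed

end

section \<open>Superficial elements\<close>

context scalar_module
begin

section \<open>Iterated multiplication by generators, and polynomials along the moment curve\<close>

declare filt.simps(2) [simp del]

text \<open>For a submodule \<open>P\<close> this says that a power of the ideal moves
  \<open>u\<close> into it. No power has to be formed, and arbitrary predicates can be carried
  along, such as the conjunctions in \<open>annihilator_products\<close>.\<close>

primrec after :: "'s set \<Rightarrow> nat \<Rightarrow> ('f \<Rightarrow> bool) \<Rightarrow> 'f \<Rightarrow> bool" where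
  "after G 0 P u \<longleftrightarrow> P u"
| "after G (Suc N) P u \<longleftrightarrow> (\<forall>g\<in>G. after G N P (g *s u))"

lemma after_add: "after G (m + n) P u \<longleftrightarrow> after G m (after G n P) u"
  by (induction m arbitrary: u) auto

lemma after_mono: "after G n P u \<Longrightarrow> (\<And>v. P v \<Longrightarrow> P' v) \<Longrightarrow> after G n P' u"
  by (induction n arbitrary: u) auto

lemma after_conj: "after G n P u \<Longrightarrow> after G n P' u \<Longrightarrow> after G n (\<lambda>v. P v \<and> P' v) u"
  by (induction n arbitrary: u) auto

lemma after_scale: "after G n P (c *s u) \<longleftrightarrow> after G n (\<lambda>v. P (c *s v)) u"
proof (induction n arbitrary: u)
  case (Suc n)
  have "after G (Suc n) P (c *s u) \<longleftrightarrow> (\<forall>g\<in>G. after G n P (c *s g *s u))"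
    by (simp only: after.simps scale_left_commute)
  then show ?case using Suc.IH by (simp del: scale_scale)
qed simp

lemma after_invariant:
  assumes "\<And>n g u. g \<in> G \<Longrightarrow> I n u \<Longrightarrow> I (Suc n) (g *s u)"
  shows "I n u \<Longrightarrow> after G N (I (n + N)) u"
proof (induction N arbitrary: n u)
  case (Suc N)
  then show ?case using Suc.IH[of "Suc n"] assms by simp
qed simp

lemma after_Suc_last: "after G (Suc n) P u \<longleftrightarrow> after G n (\<lambda>v. \<forall>g\<in>G. P (g *s v)) u"
proof -
  have "after G (n + 1) P u = after G n (after G 1 P) u" by (rule after_add)
  moreover have "after G 1 P = (\<lambda>v. \<forall>g\<in>G. P (g *s v))" by (simp add: fun_eq_iff)
  ultimately show ?thesis by (simp del: after.simps)
qed

text \<open>The points of the moment curve through a list of generators, in Horner form.\<close>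

primrec curve :: "'s list \<Rightarrow> 's \<Rightarrow> 's" where
  "curve [] t = 0"
| "curve (g # gs) t = g + t * curve gs t"

primrec vcurve :: "'f list \<Rightarrow> 's \<Rightarrow> 'f" where
  "vcurve [] t = 0"
| "vcurve (v # vs) t = v + t *s vcurve vs t"

text \<open>Horner's scheme: the coefficients of the polynomial \<open>vs\<close> minus its value at
  \<open>s\<close>, divided by the factor \<open>t - s\<close>.\<close>

fun vquot :: "'s \<Rightarrow> 'f list \<Rightarrow> 'f list" where
  "vquot s [] = []"
| "vquot s [v] = []"
| "vquot s (v # w # vs) = vcurve (w # vs) s # vquot s (w # vs)"

lemma curve_scale: "curve gs t *s u = vcurve (map (\<lambda>g. g *s u) gs) t"
proof (induction gs)
  case (Cons g gs)
  then show ?case by (simp add: scale_left_distrib scale_scale[symmetric] del: scale_scale)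
qed simp

lemma length_vquot: "length (vquot s vs) = length vs - 1"
  by (induction s vs rule: vquot.induct) auto

lemma vcurve_diff: "vcurve vs t - vcurve vs s = (t - s) *s vcurve (vquot s vs) t"
proof (induction s vs rule: vquot.induct)
  case (3 s v w vs)
  let ?a = "vcurve (w # vs) t" and ?b = "vcurve (w # vs) s" and ?r = "vcurve (vquot s (w # vs)) t"
  have "vcurve (v # w # vs) t - vcurve (v # w # vs) s = t *s ?a - s *s ?b" by simp
  also have "\<dots> = (t - s) *s ?b + t *s (?a - ?b)" by (simp add: algebra_simps)
  also have "\<dots> = (t - s) *s ?b + t *s (t - s) *s ?r" using 3 by (simp only:)
  also have "\<dots> = (t - s) *s (?b + t *s ?r)"
    by (simp only: scale_right_distrib scale_left_commute[of t])
  finally show ?case by simp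
qed auto

lemma set_subset_of_vquot:
  assumes "subspace B"
  shows "set (vquot s vs) \<subseteq> B \<Longrightarrow> vcurve vs s \<in> B \<Longrightarrow> set vs \<subseteq> B"
proof (induction s vs rule: vquot.induct)
  case (3 s v w vs)
  let ?b = "vcurve (w # vs) s"
  have b: "?b \<in> B" and "set (w # vs) \<subseteq> B" using 3 by auto
  moreover have "v = vcurve (v # w # vs) s - s *s ?b" by simp
  moreover have "vcurve (v # w # vs) s - s *s ?b \<in> B"
    by (intro subspace_diff[OF assms] subspace_scale[OF assms] 3 b)
  ultimately show ?case by simp
qed auto

text \<open>Division by \<open>t - s\<close> lowers the number of coefficients by one, and
  regularity of the differences keeps the values of the quotient in \<open>B\<close>. This is the
  Vandermonde argument without the determinant.\<close>

lemma vandermonde: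
  assumes B: "subspace B"
  shows "finite D \<Longrightarrow> length vs \<le> card D \<Longrightarrow>
    (\<And>s t. s \<in> D \<Longrightarrow> t \<in> D \<Longrightarrow> s \<noteq> t \<Longrightarrow> regular B (s - t)) \<Longrightarrow>
    (\<And>t. t \<in> D \<Longrightarrow> vcurve vs t \<in> B) \<Longrightarrow> set vs \<subseteq> B"
proof (induction "length vs" arbitrary: vs D)
  case (Suc n)
  then obtain s where s: "s \<in> D" by fastforce
  have "set (vquot s vs) \<subseteq> B"
  proof (rule Suc.hyps(1)[of "vquot s vs" "D - {s}"])
    fix t assume t: "t \<in> D - {s}"
    have "(t - s) *s vcurve (vquot s vs) t \<in> B"
      unfolding vcurve_diff[symmetric] using s t Suc.prems(4) by (intro subspace_diff[OF B]) auto
    then show "vcurve (vquot s vs) t \<in> B" using s t Suc.prems(3)[of t s]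
      by (auto dest: regularD)
  qed (use Suc s in \<open>auto simp: length_vquot\<close>)
  then show ?case using set_subset_of_vquot[OF B] Suc.prems(4)[OF s] by blast
qed simp

lemma curve_scale_mem:
  assumes "subspace P" "\<And>g. g \<in> set gs \<Longrightarrow> g *s u \<in> P" shows "curve gs t *s u \<in> P"
  using assms(2)
proof (induction gs)
  case (Cons g gs)
  have "curve (g # gs) t *s u = g *s u + t *s curve gs t *s u" by (simp add: scale_left_distrib)
  moreover have "curve gs t *s u \<in> P" using Cons by simp
  ultimately show ?case using Cons.prems subspace_add[OF assms(1)] subspace_scale[OF assms(1)]
    by (simp del: scale_scale curve.simps)
qed (simp add: subspace_0[OF assms(1)])

text \<open>Points of the curve indexed by \<open>Y\<close>, together with one point from each \<open>D\<close> in \<open>Ds\<close>, generate the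
  whole ideal by Vandermonde. The products over the \<open>D\<close> reduce to single points because the ideal
  \<open>(a b, J)\<close> contains \<open>(a, J) (b, J)\<close>.\<close>

lemma annihilator_products:
  fixes B :: "nat \<Rightarrow> 'f set"
  assumes B: "\<And>n. subspace (B n)" and actB: "\<And>n g u. g \<in> set gs \<Longrightarrow> u \<in> B n \<Longrightarrow> g *s u \<in> B (Suc n)"
    and reg: "\<And>n s t. s \<in> T \<Longrightarrow> t \<in> T \<Longrightarrow> s \<noteq> t \<Longrightarrow> regular (B n) (s - t)"
  defines "y \<equiv> curve gs"
  shows "finite Y \<Longrightarrow> Y \<subseteq> T \<Longrightarrow> length gs \<le> card Y + length Ds \<Longrightarrow>
    (\<And>D. D \<in> set Ds \<Longrightarrow> finite D \<and> D \<subseteq> T - Y) \<Longrightarrow> sorted_wrt disjnt Ds \<Longrightarrow>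
    \<exists>N. \<forall>n u. (\<forall>t\<in>Y. y t *s u \<in> B (Suc n)) \<and> (\<forall>D\<in>set Ds. (\<Prod>t\<in>D. y t) *s u \<in> B (n + card D))
      \<longrightarrow> after (set gs) N (\<lambda>v. v \<in> B (n + N)) u"
proof (induction Ds arbitrary: Y)
  case Nil
  have "after (set gs) 1 (\<lambda>v. v \<in> B (n + 1)) u" if u: "\<forall>t\<in>Y. y t *s u \<in> B (Suc n)" for n u
  proof -
    have "set (map (\<lambda>g. g *s u) gs) \<subseteq> B (Suc n)"
    proof (rule vandermonde[OF B Nil(1)])
      show "regular (B (Suc n)) (s - t)" if "s \<in> Y" "t \<in> Y" "s \<noteq> t" for s t
        using reg Nil(2) that by blast
      show "vcurve (map (\<lambda>g. g *s u) gs) t \<in> B (Suc n)" if "t \<in> Y" for t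
        using u that by (simp only: curve_scale[symmetric] y_def)
    qed (use Nil in simp)
    then show ?thesis by auto
  qed
  then show ?case by (intro exI[of _ 1]) auto
next
  case (Cons D Ds)
  \<comment> \<open>The hypotheses apart from the one on \<open>D\<close>. Multiplying
    \<open>u\<close> by an element of degree one preserves them with \<open>n\<close> raised by one,
    so they can be carried through \<open>after\<close>.\<close>
  define I where "I n u \<longleftrightarrow> (\<forall>t\<in>Y. y t *s u \<in> B (Suc n)) \<and>
    (\<forall>E\<in>set Ds. (\<Prod>t\<in>E. y t) *s u \<in> B (n + card E))" for n u
  have I_scale: "I (Suc n) (c *s u)" if "I n u" and c: "\<And>m v. v \<in> B m \<Longrightarrow> c *s v \<in> B (Suc m)" for n c u
    unfolding I_def
  proof (intro conjI ballI)
    fix t assume "t \<in> Y"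
    then have "c *s y t *s u \<in> B (Suc (Suc n))" using that by (intro c) (auto simp: I_def)
    then show "y t *s c *s u \<in> B (Suc (Suc n))" by (simp only: scale_left_commute)
  next
    fix E assume "E \<in> set Ds"
    then have "c *s (\<Prod>t\<in>E. y t) *s u \<in> B (Suc (n + card E))" using that by (intro c) (auto simp: I_def)
    then show "(\<Prod>t\<in>E. y t) *s c *s u \<in> B (Suc n + card E)"
      by (simp only: scale_left_commute add_Suc)
  qed
  have y_B: "y t *s v \<in> B (Suc m)" if "v \<in> B m" for t m v
    unfolding y_def using that actB by (intro curve_scale_mem[OF B]) auto
  \<comment> \<open>The factors of the product are split off one by one: the inner induction,
    applied to \<open>y t *s u\<close>, shows that after \<open>N1\<close> multiplications the
    vector is moved into \<open>B\<close> by \<open>y t\<close> alone, and then the outer hypothesis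
    with \<open>t\<close> added to \<open>Y\<close> applies.\<close>
  have inner: "finite E \<Longrightarrow> E \<subseteq> D \<Longrightarrow> \<exists>N. \<forall>n u. I n u \<and> (\<Prod>t\<in>E. y t) *s u \<in> B (n + card E)
      \<longrightarrow> after (set gs) N (\<lambda>v. v \<in> B (n + N)) u" for E
  proof (induction E rule: finite_induct)
    case empty show ?case by (intro exI[of _ 0]) simp
  next
    case (insert t E)
    then obtain N1 where N1: "\<And>n u. I n u \<Longrightarrow> (\<Prod>t\<in>E. y t) *s u \<in> B (n + card E)
      \<Longrightarrow> after (set gs) N1 (\<lambda>v. v \<in> B (n + N1)) u" by blast
    have "\<exists>N. \<forall>n u. (\<forall>t\<in>insert t Y. y t *s u \<in> B (Suc n)) \<and> (\<forall>D\<in>set Ds. (\<Prod>t\<in>D. y t) *s u \<in> B (n + card D))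
      \<longrightarrow> after (set gs) N (\<lambda>v. v \<in> B (n + N)) u"
    proof (rule Cons.IH)
      have "t \<in> D" "finite D" "D \<subseteq> T - Y" using insert.prems Cons.prems(4)[of D] by auto
      then show "insert t Y \<subseteq> T" "length gs \<le> card (insert t Y) + length Ds"
        using Cons.prems(1-3) by auto
      show "finite F \<and> F \<subseteq> T - insert t Y" if "F \<in> set Ds" for F
        using Cons.prems(4)[of F] Cons.prems(5) that \<open>t \<in> D\<close> by (auto simp: disjnt_def)
      show "sorted_wrt disjnt Ds" using Cons.prems(5) by simp
    qed (use Cons.prems in simp)
    then obtain N2 where N2: "\<And>n u. y t *s u \<in> B (Suc n) \<Longrightarrow> I n u
      \<Longrightarrow> after (set gs) N2 (\<lambda>v. v \<in> B (n + N2)) u" unfolding I_def by (simp only: ball_simps) blast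
    have "after (set gs) (N1 + N2) (\<lambda>v. v \<in> B (n + (N1 + N2))) u"
      if u: "I n u" "(\<Prod>t\<in>insert t E. y t) *s u \<in> B (n + card (insert t E))" for n u
    proof -
      have "(\<Prod>t\<in>insert t E. y t) *s u = (\<Prod>t\<in>E. y t) *s y t *s u"
        using insert.hyps by (simp add: mult.commute)
      then have "(\<Prod>t\<in>E. y t) *s y t *s u \<in> B (Suc n + card E)"
        using u(2) insert.hyps by simp
      then have "after (set gs) N1 (\<lambda>v. v \<in> B (Suc n + N1)) (y t *s u)"
        by (rule N1[rotated]) (rule I_scale[OF u(1)], rule y_B)
      then have a: "after (set gs) N1 (\<lambda>v. y t *s v \<in> B (Suc (n + N1))) u"
        unfolding after_scale by simp
      have b: "after (set gs) N1 (I (n + N1)) u"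
        by (rule after_invariant[where I = I, OF _ u(1)]) (rule I_scale, use actB in auto)
      show ?thesis unfolding after_add
        by (rule after_mono[OF after_conj[OF a b]]) (use N2[where n = "n + N1"] in \<open>simp add: add.assoc\<close>)
    qed
    then show ?case by blast
  qed
  have "finite D" using Cons.prems(4)[of D] by simp
  from inner[OF this order_refl] show ?case unfolding I_def by simp metis
qed

text \<open>Suppose infinitely many points are bad. Then \<open>acc\<close> yields disjoint finite
  sets \<open>D\<close> of bad points, one after the other, such that \<open>Z\<close> of each
  remaining point lies in the span over each \<open>D\<close>. The product over \<open>D\<close>
  moves it into \<open>B\<close>, and with as many sets as generators
  \<open>annihilator_products\<close> makes a remaining point good.\<close>

lemma finite_bad_points:
  fixes B :: "nat \<Rightarrow> 'f set" and Z :: "'s \<Rightarrow> nat \<Rightarrow> 'f set"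
  assumes B: "\<And>n. subspace (B n)" and actB: "\<And>n g u. g \<in> set gs \<Longrightarrow> u \<in> B n \<Longrightarrow> g *s u \<in> B (Suc n)"
    and reg: "\<And>n s t. s \<in> T \<Longrightarrow> t \<in> T \<Longrightarrow> s \<noteq> t \<Longrightarrow> regular (B n) (s - t)"
    and Z: "\<And>t n u. u \<in> Z t n \<Longrightarrow> curve gs t *s u \<in> B (Suc n)"
    and acc: "\<And>T'. T' \<subseteq> T \<Longrightarrow> T' \<noteq> {} \<Longrightarrow>
      \<exists>D. finite D \<and> D \<subseteq> T' \<and> (\<forall>t\<in>T'. \<forall>n. Z t n \<subseteq> span (\<Union>s\<in>D. Z s n))"
  shows "finite {t \<in> T. \<not> (\<exists>N. \<forall>n. \<forall>u\<in>Z t n. after (set gs) N (\<lambda>v. v \<in> B (n + N)) u)}"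
proof (rule ccontr)
  define good where "good t \<longleftrightarrow> (\<exists>N. \<forall>n. \<forall>u\<in>Z t n. after (set gs) N (\<lambda>v. v \<in> B (n + N)) u)" for t
  define bad where "bad = {t \<in> T. \<not> good t}"
  have bad_T: "bad \<subseteq> T" by (auto simp: bad_def)
  assume "\<not> finite {t \<in> T. \<not> (\<exists>N. \<forall>n. \<forall>u\<in>Z t n. after (set gs) N (\<lambda>v. v \<in> B (n + N)) u)}"
  then have inf: "infinite bad" by (simp only: bad_def good_def simp_thms)
  define P where "P k Ds T' \<longleftrightarrow> length Ds = k \<and> sorted_wrt disjnt Ds \<and>
    (\<forall>D\<in>set Ds. finite D \<and> D \<subseteq> bad \<and> D \<inter> T' = {}) \<and>
    infinite T' \<and> T' \<subseteq> bad \<and> (\<forall>t\<in>T'. \<forall>D\<in>set Ds. \<forall>n. Z t n \<subseteq> span (\<Union>s\<in>D. Z s n))" for k Ds T'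
  have "\<exists>Ds T'. P k Ds T'" for k
  proof (induction k)
    case 0
    have "P 0 [] bad" unfolding P_def using inf by simp
    then show ?case by blast
  next
    case (Suc k)
    then obtain Ds T' where "P k Ds T'" by blast
    then have *: "length Ds = k" "sorted_wrt disjnt Ds"
      "\<forall>D\<in>set Ds. finite D \<and> D \<subseteq> bad \<and> D \<inter> T' = {}" "infinite T'" "T' \<subseteq> bad"
      "\<forall>t\<in>T'. \<forall>D\<in>set Ds. \<forall>n. Z t n \<subseteq> span (\<Union>s\<in>D. Z s n)"
      unfolding P_def by simp_all
    have "T' \<subseteq> T" "T' \<noteq> {}" using *(4,5) bad_T by auto
    from acc[OF this] obtain D where D: "finite D" "D \<subseteq> T'"
      "\<forall>t\<in>T'. \<forall>n. Z t n \<subseteq> span (\<Union>s\<in>D. Z s n)" by (elim exE conjE) (rule that)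
    have "P (Suc k) (D # Ds) (T' - D)"
      unfolding P_def
    proof (intro conjI)
      show "sorted_wrt disjnt (D # Ds)" using *(2) bspec[OF *(3)] D(2) by (auto simp: disjnt_def)
      show "\<forall>D'\<in>set (D # Ds). finite D' \<and> D' \<subseteq> bad \<and> D' \<inter> (T' - D) = {}"
      proof
        fix D' assume D': "D' \<in> set (D # Ds)"
        show "finite D' \<and> D' \<subseteq> bad \<and> D' \<inter> (T' - D) = {}"
        proof (cases "D' = D")
          case True
          have "D \<subseteq> bad" by (rule subset_trans[OF D(2) *(5)])
          then show ?thesis using D(1) True by blast
        next
          case False then show ?thesis using bspec[OF *(3), of D'] D' by auto
        qed
      qed
      show "infinite (T' - D)" using *(4) D(1) by simp
      show "T' - D \<subseteq> bad" using *(5) by blast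
      show "\<forall>t\<in>T' - D. \<forall>D\<in>set (D # Ds). \<forall>n. Z t n \<subseteq> span (\<Union>s\<in>D. Z s n)"
        using *(6) D(3) by simp
    qed (use *(1) in simp)
    then show ?case by blast
  qed
  then obtain Ds T' where "P (length gs) Ds T'" by blast
  then have *: "length Ds = length gs" "sorted_wrt disjnt Ds"
      "\<forall>D\<in>set Ds. finite D \<and> D \<subseteq> bad \<and> D \<inter> T' = {}" "infinite T'" "T' \<subseteq> bad"
      "\<forall>t\<in>T'. \<forall>D\<in>set Ds. \<forall>n. Z t n \<subseteq> span (\<Union>s\<in>D. Z s n)"
      unfolding P_def by simp_all
  obtain t where t: "t \<in> T'" using *(4) by fastforce
  have "\<exists>N. \<forall>n u. (\<forall>t\<in>{}. curve gs t *s u \<in> B (Suc n)) \<and>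
      (\<forall>D\<in>set Ds. (\<Prod>t\<in>D. curve gs t) *s u \<in> B (n + card D))
      \<longrightarrow> after (set gs) N (\<lambda>v. v \<in> B (n + N)) u"
  proof (rule annihilator_products[where B = B and T = T and gs = gs, OF B actB reg])
    show "length gs \<le> card ({}::'s set) + length Ds" using *(1) by simp
    show "finite D \<and> D \<subseteq> T - {}" if "D \<in> set Ds" for D using bspec[OF *(3) that] bad_T by auto
  qed (use *(2) in auto)
  then obtain N where N: "\<And>n u. (\<And>D. D \<in> set Ds \<Longrightarrow> (\<Prod>t\<in>D. curve gs t) *s u \<in> B (n + card D)) \<Longrightarrow>
      after (set gs) N (\<lambda>v. v \<in> B (n + N)) u" by blast
  have y_B: "curve gs t *s v \<in> B (Suc m)" if "v \<in> B m" for t m v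
    using that actB by (intro curve_scale_mem[OF B]) auto
  have prod_B: "finite E \<Longrightarrow> v \<in> B m \<Longrightarrow> (\<Prod>t\<in>E. curve gs t) *s v \<in> B (m + card E)" for E v m
  proof (induction E rule: finite_induct)
    case (insert t E)
    then have "curve gs t *s (\<Prod>t\<in>E. curve gs t) *s v \<in> B (Suc (m + card E))" by (intro y_B) simp
    then show ?case using insert.hyps by simp
  qed simp
  have "after (set gs) N (\<lambda>v. v \<in> B (n + N)) u" if u: "u \<in> Z t n" for n u
  proof (rule N)
    fix D assume D: "D \<in> set Ds"
    then have fD: "finite D" using bspec[OF *(3)] by blast
    have "(\<Union>s\<in>D. Z s n) \<subseteq> colon (B (n + card D)) (\<Prod>t\<in>D. curve gs t)"
    proof
      fix v assume "v \<in> (\<Union>s\<in>D. Z s n)"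
      then obtain s where s: "s \<in> D" "v \<in> Z s n" by blast
      have "(\<Prod>t\<in>D - {s}. curve gs t) *s curve gs s *s v \<in> B (Suc n + card (D - {s}))"
        using fD s Z by (intro prod_B) auto
      moreover have "(\<Prod>t\<in>D. curve gs t) = (\<Prod>t\<in>D - {s}. curve gs t) * curve gs s"
        using fD s prod.remove[of D s "curve gs"] by (simp add: mult.commute)
      moreover have "card D = Suc (card (D - {s}))" by (rule card.remove[OF fD s(1)])
      ultimately show "v \<in> colon (B (n + card D)) (\<Prod>t\<in>D. curve gs t)" by (simp add: colon_def)
    qed
    then have "span (\<Union>s\<in>D. Z s n) \<subseteq> colon (B (n + card D)) (\<Prod>t\<in>D. curve gs t)"
      by (intro span_minimal subspace_colon B)
    then show "(\<Prod>t\<in>D. curve gs t) *s u \<in> B (n + card D)"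
      using bspec[OF bspec[OF *(6) t] D] u by (auto simp: colon_def)
  qed
  then have "good t" unfolding good_def by blast
  then show False using t *(5) by (auto simp: bad_def)
qed

end

section \<open>Regular and superficial points of the moment curve\<close>

context noetherian_scalar_module
begin

lemma finite_subfamily:
  assumes "\<And>t. t \<in> T \<Longrightarrow> subspace (Z t) \<and> K \<subseteq> Z t" "T \<noteq> {}"
  obtains D where "finite D" "D \<subseteq> T" "D \<noteq> {}" "\<And>t. t \<in> T \<Longrightarrow> Z t \<subseteq> span (\<Union>s\<in>D. Z s)"
proof -
  let ?A = "{span (\<Union>s\<in>D. Z s) |D. finite D \<and> D \<subseteq> T \<and> D \<noteq> {}}"
  have sub: "subspace N \<and> K \<subseteq> N" if N: "N \<in> ?A" for N
  proof -
    obtain D where D: "N = span (\<Union>s\<in>D. Z s)" "D \<subseteq> T" "D \<noteq> {}" using N by blast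
    then obtain s where s: "s \<in> D" by blast
    then have "K \<subseteq> Z s" using assms(1) D by blast
    also have "\<dots> \<subseteq> N" using D s span_superset[of "\<Union>s\<in>D. Z s"] by blast
    finally show ?thesis using D(1) by simp
  qed
  obtain t where "t \<in> T" using assms(2) by blast
  then have ne: "?A \<noteq> {}" by (auto intro!: exI[of _ "{t}"])
  obtain N where N: "N \<in> ?A" "\<And>P. P \<in> ?A \<Longrightarrow> N \<subseteq> P \<Longrightarrow> P = N"
    using ex_maximal[OF ne sub] by blast
  then obtain D where D: "N = span (\<Union>s\<in>D. Z s)" "finite D" "D \<subseteq> T" "D \<noteq> {}" by blast
  have "Z t \<subseteq> N" if "t \<in> T" for t
  proof -
    let ?P = "span (\<Union>s\<in>insert t D. Z s)"
    have "?P \<in> ?A" using D that by blast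
    moreover have "N \<subseteq> ?P" unfolding D(1) by (intro span_mono) auto
    ultimately have "?P = N" by (rule N(2))
    then show ?thesis using span_superset[of "\<Union>s\<in>insert t D. Z s"] by blast
  qed
  then show ?thesis using that D by blast
qed

text \<open>Dividing by the units \<open>s - t\<close> is what the infinite residue field is needed for.\<close>

lemma finite_nonregular_points:
  assumes Q: "subspace Q" "K \<subseteq> Q"
    and reg: "\<And>s t. s \<in> T \<Longrightarrow> t \<in> T \<Longrightarrow> s \<noteq> t \<Longrightarrow> regular Q (s - t)"
  shows "finite {t \<in> T. \<not> (\<exists>N. \<forall>u. curve gs t *s u \<in> Q \<longrightarrow> after (set gs) N (\<lambda>v. v \<in> Q) u)}"
proof -
  have "finite {t \<in> T. \<not> (\<exists>N. \<forall>n::nat. \<forall>u\<in>colon Q (curve gs t). after (set gs) N (\<lambda>v. v \<in> Q) u)}"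
  proof (rule finite_bad_points[where B = "\<lambda>_. Q" and Z = "\<lambda>t _. colon Q (curve gs t)"])
    fix T' assume T': "T' \<subseteq> T" "T' \<noteq> {}"
    have "K \<subseteq> colon Q (curve gs t)" for t unfolding colon_def using Q subspace_scale by blast
    then show "\<exists>D. finite D \<and> D \<subseteq> T' \<and> (\<forall>t\<in>T'. \<forall>n::nat. colon Q (curve gs t) \<subseteq> span (\<Union>s\<in>D. colon Q (curve gs s)))"
      using finite_subfamily[of T' "\<lambda>t. colon Q (curve gs t)"] subspace_colon[OF Q(1)] T'(2) by metis
  qed (use Q reg subspace_scale in \<open>auto simp: colon_def\<close>)
  then show ?thesis by (simp add: colon_def)
qed

text \<open>For all but finitely many points, the kernel of multiplication on the associated graded
  module is annihilated by a power of the ideal. Being generated in bounded degrees, such a kernel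
  vanishes in large degrees.\<close>

lemma finite_nonsuperficial_points:
  assumes Q: "subspace Q" "K \<subseteq> Q" and reg: "\<And>s t n. s \<in> T \<Longrightarrow> t \<in> T \<Longrightarrow> s \<noteq> t \<Longrightarrow> regular (filt (set gs) Q n) (s - t)"
  shows "finite {t \<in> T. \<not> (\<exists>n0. \<forall>n\<ge>n0. \<forall>u\<in>filt (set gs) Q n.
    curve gs t *s u \<in> filt (set gs) Q (n + 2) \<longrightarrow> u \<in> filt (set gs) Q (Suc n))}"
proof -
  let ?G = "set gs"
  let ?E = "filt ?G Q"
  \<comment> \<open>The kernel of multiplication by the point from degree \<open>n\<close> to degree
    \<open>n + 1\<close> of the associated graded module, lifted to \<open>?E n\<close>. Hence the
    target \<open>?E (n + 2)\<close>, and the shift in the choice of \<open>B\<close> below.\<close>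
  define Z where "Z t n = ?E n \<inter> colon (?E (n + 2)) (curve gs t)" for t n
  have subZ: "subspace (Z t n)" for t n
    unfolding Z_def using Q by (intro subspace_inter subspace_colon) auto
  have QZ: "Q \<subseteq> Z t n" for t n
    unfolding Z_def colon_def using filt_upper Q subspace_scale by blast
  have actZ: "act ?G (Z t n) \<subseteq> Z t (Suc n)" for t n
  proof (rule act_least[OF subZ])
    fix g u assume g: "g \<in> ?G" and u: "u \<in> Z t n"
    have "g *s u \<in> ?E (Suc n)" using u by (intro scale_in_filt[OF Q(1) g]) (simp add: Z_def)
    moreover have "g *s curve gs t *s u \<in> ?E (Suc (n + 2))"
      using u by (intro scale_in_filt[OF Q(1) g]) (simp add: Z_def colon_def)
    then have "curve gs t *s g *s u \<in> ?E (Suc n + 2)" by (simp only: scale_left_commute add_Suc)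
    ultimately show "g *s u \<in> Z t (Suc n)" by (simp add: Z_def colon_def del: filt.simps)
  qed
  have Zfilt: "Z t n \<subseteq> ?E n" for t n by (simp add: Z_def)
  have fin: "finite {t \<in> T. \<not> (\<exists>N. \<forall>n. \<forall>u\<in>Z t n. after ?G N (\<lambda>v. v \<in> ?E (Suc (n + N))) u)}"
  proof (rule finite_bad_points[where B = "\<lambda>n. ?E (Suc n)" and Z = Z])
    fix T' assume T': "T' \<subseteq> T" "T' \<noteq> {}"
    \<comment> \<open>One finite set of points must serve every degree. From degree
      \<open>n0\<close> on, the sum \<open>W\<close> is generated by its previous component, so the
      points chosen in the degrees up to \<open>n0\<close> suffice.\<close>
    define W where "W n = span (\<Union>t\<in>T'. Z t n)" for n
    have ZW: "Z t n \<subseteq> W n" if "t \<in> T'" for t n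
      unfolding W_def using that span_superset[of "\<Union>t\<in>T'. Z t n"] by blast
    have act_span: "act ?G (span (\<Union>t\<in>D. Z t n)) \<subseteq> span (\<Union>t\<in>D. Z t (Suc n))" for D n
    proof (rule act_least[OF subspace_span])
      fix g u assume g: "g \<in> ?G" and u: "u \<in> span (\<Union>t\<in>D. Z t n)"
      have "(\<Union>t\<in>D. Z t n) \<subseteq> colon (span (\<Union>t\<in>D. Z t (Suc n))) g"
        using actZ scale_in_act[OF g] by (auto simp: colon_def intro!: span_base) blast
      then have "span (\<Union>t\<in>D. Z t n) \<subseteq> colon (span (\<Union>t\<in>D. Z t (Suc n))) g"
        by (intro span_minimal subspace_colon subspace_span)
      then show "g *s u \<in> span (\<Union>t\<in>D. Z t (Suc n))" using u by (auto simp: colon_def)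
    qed
    have "\<exists>n0. \<forall>n\<ge>n0. W (Suc n) \<subseteq> act ?G (W n) + Q"
    proof (rule rees_module_noetherian[OF _ Q])
      fix n
      show "subspace (W n)" by (simp add: W_def)
      show "Q \<subseteq> W n" using T'(2) QZ ZW by blast
      show "W n \<subseteq> ?E n" unfolding W_def using Zfilt Q(1) by (intro span_minimal) auto
      show "act ?G (W n) \<subseteq> W (Suc n)" unfolding W_def by (rule act_span)
    qed simp
    then obtain n0 where n0: "\<And>n. n \<ge> n0 \<Longrightarrow> W (Suc n) \<subseteq> act ?G (W n) + Q" by blast
    have "\<exists>D. finite D \<and> D \<subseteq> T' \<and> D \<noteq> {} \<and> (\<forall>t\<in>T'. Z t n \<subseteq> span (\<Union>s\<in>D. Z s n))" for n
      by (rule finite_subfamily[of T' "\<lambda>t. Z t n"]) (use subZ QZ Q T'(2) in blast)+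
    then have "\<forall>n. \<exists>D. finite D \<and> D \<subseteq> T' \<and> D \<noteq> {} \<and> (\<forall>t\<in>T'. Z t n \<subseteq> span (\<Union>s\<in>D. Z s n))" by blast
    from choice[OF this] obtain E where E: "\<And>n. finite (E n) \<and> E n \<subseteq> T' \<and> E n \<noteq> {}"
      "\<And>n t. t \<in> T' \<Longrightarrow> Z t n \<subseteq> span (\<Union>s\<in>E n. Z s n)" by blast
    define D where "D = (\<Union>n\<le>n0. E n)"
    have D: "finite D" "D \<subseteq> T'" "D \<noteq> {}" using E(1) by (auto simp: D_def)
    have QD: "Q \<subseteq> span (\<Union>s\<in>D. Z s n)" for n
    proof -
      obtain s where "s \<in> D" using D(3) by blast
      then have "Q \<subseteq> (\<Union>s\<in>D. Z s n)" using QZ by blast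
      then show ?thesis using span_superset by blast
    qed
    have W_le: "W n \<subseteq> span (\<Union>s\<in>D. Z s n)" for n
    proof (cases "n \<le> n0")
      case True
      then have "span (\<Union>s\<in>E n. Z s n) \<subseteq> span (\<Union>s\<in>D. Z s n)"
        by (intro span_mono) (auto simp: D_def)
      then show ?thesis unfolding W_def using E(2)[of _ n] by (intro span_minimal) auto
    next
      case False
      then have "n0 \<le> n" by simp
      then show ?thesis
      proof (induction n rule: dec_induct)
        case base
        have "span (\<Union>s\<in>E n0. Z s n0) \<subseteq> span (\<Union>s\<in>D. Z s n0)"
          by (intro span_mono) (auto simp: D_def)
        then show ?case unfolding W_def using E(2)[of _ n0] by (intro span_minimal) auto
      next
        case (step n)
        have "W (Suc n) \<subseteq> act ?G (W n) + Q" by (rule n0[OF step(1)])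
        also have "\<dots> \<subseteq> act ?G (span (\<Union>s\<in>D. Z s n)) + Q"
          using step by (intro set_plus_mono2 act_mono) auto
        also have "\<dots> \<subseteq> span (\<Union>s\<in>D. Z s (Suc n))"
          by (intro plus_least subspace_span act_span QD)
        finally show ?case .
      qed
    qed
    show "\<exists>D. finite D \<and> D \<subseteq> T' \<and> (\<forall>t\<in>T'. \<forall>n. Z t n \<subseteq> span (\<Union>s\<in>D. Z s n))"
      by (intro exI[of _ D] conjI ballI allI D(1,2)) (rule subset_trans[OF ZW W_le])
  next
    show "g *s u \<in> ?E (Suc (Suc n))" if "g \<in> ?G" "u \<in> ?E (Suc n)" for n g u
      by (rule scale_in_filt[OF Q(1) that])
    show "regular (?E (Suc n)) (s - t)" if "s \<in> T" "t \<in> T" "s \<noteq> t" for n s t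
      using reg that by blast
    show "subspace (?E (Suc n))" for n by (rule subspace_filt[OF Q(1)])
    show "curve gs t *s u \<in> ?E (Suc (Suc n))" if "u \<in> Z t n" for t n u
      using that by (simp add: Z_def colon_def del: filt.simps)
  qed
  have imp: "\<exists>n0. \<forall>n\<ge>n0. \<forall>u\<in>?E n. curve gs t *s u \<in> ?E (n + 2) \<longrightarrow> u \<in> ?E (Suc n)"
    if ex: "\<exists>N. \<forall>n. \<forall>u\<in>Z t n. after ?G N (\<lambda>v. v \<in> ?E (Suc (n + N))) u" for t
  proof -
    obtain N where N: "\<And>n u. u \<in> Z t n \<Longrightarrow> after ?G N (\<lambda>v. v \<in> ?E (Suc (n + N))) u" using ex by blast
    have "\<exists>n0. \<forall>n\<ge>n0. Z t (Suc n) \<subseteq> act ?G (Z t n) + Q"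
      by (rule rees_module_noetherian[OF _ Q subZ QZ Zfilt actZ]) simp
    then obtain n0 where n0: "\<And>n. n \<ge> n0 \<Longrightarrow> Z t (Suc n) \<subseteq> act ?G (Z t n) + Q" by blast
    \<comment> \<open>From degree \<open>n0\<close> on, going up \<open>j\<close> degrees amounts to
      multiplying by \<open>j\<close> generators, up to \<open>Q\<close>.\<close>
    have push: "Z t (n + j) \<subseteq> P"
      if "n \<ge> n0" "subspace P" "Q \<subseteq> P" "\<And>u. u \<in> Z t n \<Longrightarrow> after ?G j (\<lambda>v. v \<in> P) u" for n j P
      using that(2-4)
    proof (induction j arbitrary: P)
      case (Suc j)
      have "act ?G (Z t (n + j)) \<subseteq> P"
      proof (rule act_least[OF Suc.prems(1)])
        fix g u assume g: "g \<in> ?G" and u: "u \<in> Z t (n + j)"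
        have "Z t (n + j) \<subseteq> colon P g"
        proof (rule Suc.IH[OF subspace_colon[OF Suc.prems(1)]])
          show "Q \<subseteq> colon P g" using Suc.prems(1,2) subspace_scale by (auto simp: colon_def)
          fix u assume "u \<in> Z t n"
          then have "after ?G (Suc j) (\<lambda>v. v \<in> P) u" by (rule Suc.prems(3))
          then show "after ?G j (\<lambda>v. v \<in> colon P g) u"
            unfolding after_Suc_last by (rule after_mono) (use g in \<open>auto simp: colon_def\<close>)
        qed
        then show "g *s u \<in> P" using u by (auto simp: colon_def)
      qed
      then have "act ?G (Z t (n + j)) + Q \<subseteq> P" using Suc.prems by (intro plus_least)
      then show ?case using n0[of "n + j"] that(1) by auto
    qed auto
    have "u \<in> ?E (Suc n)" if n: "n \<ge> n0 + N" and u: "u \<in> ?E n" "curve gs t *s u \<in> ?E (n + 2)" for n u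
    proof -
      have "Z t (n - N + N) \<subseteq> ?E (Suc (n - N + N))"
      proof (rule push)
        show "Q \<subseteq> ?E (Suc (n - N + N))" by (rule filt_upper)
        show "after ?G N (\<lambda>v. v \<in> ?E (Suc (n - N + N))) u" if "u \<in> Z t (n - N)" for u
          using N[OF that] .
      qed (use n Q subspace_filt in auto)
      moreover have "u \<in> Z t n" using u by (simp add: Z_def colon_def del: filt.simps)
      ultimately show ?thesis using n by auto
    qed
    then show ?thesis by blast
  qed
  show ?thesis
  proof (rule finite_subset[OF _ fin], rule subsetI)
    fix t assume "t \<in> {t \<in> T. \<not> (\<exists>n0. \<forall>n\<ge>n0. \<forall>u\<in>?E n. curve gs t *s u \<in> ?E (n + 2) \<longrightarrow> u \<in> ?E (Suc n))}"
    then have "t \<in> T" "\<not> (\<exists>n0. \<forall>n\<ge>n0. \<forall>u\<in>?E n. curve gs t *s u \<in> ?E (n + 2) \<longrightarrow> u \<in> ?E (Suc n))"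
      by simp_all
    then show "t \<in> {t \<in> T. \<not> (\<exists>N. \<forall>n. \<forall>u\<in>Z t n. after ?G N (\<lambda>v. v \<in> ?E (Suc (n + N))) u)}"
      using imp[of t] by (simp only: mem_Collect_eq) metis
  qed
qed

text \<open>The Rees module argument, applied to the filtration induced on \<open>cut Q x\<close>,
  leaves in degree \<open>n0 + j\<close> only elements \<open>x f + q\<close> with \<open>f\<close>
  in degree \<open>j\<close> and \<open>q\<close> in \<open>Q\<close>; regularity then identifies
  \<open>u\<close> with \<open>f\<close> modulo \<open>Q\<close>.\<close>

lemma artin_rees_regular:
  assumes Q: "subspace Q" "K \<subseteq> Q" and G: "finite G" and x: "regular Q x"
  obtains k where "\<And>n u. x *s u \<in> filt G Q (k + n) \<Longrightarrow> u \<in> filt G Q n"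
proof -
  let ?E = "filt G Q"
  let ?N = "\<lambda>n. ?E n \<inter> cut Q x"
  have "\<exists>n0. \<forall>n\<ge>n0. ?N (Suc n) \<subseteq> act G (?N n) + Q"
  proof (rule rees_module_noetherian[OF G Q])
    fix n
    show "subspace (?N n)" using Q by (intro subspace_inter subspace_cut) auto
    show "Q \<subseteq> ?N n" using filt_upper cut_upper[OF Q(1)] by blast
    have "act G (?N n) \<subseteq> act G (?E n)" "act G (?N n) \<subseteq> act G (cut Q x)" by (intro act_mono; blast)+
    then show "act G (?N n) \<subseteq> ?N (Suc n)"
      using act_filt_le[OF Q(1), of G n] act_le[OF subspace_cut[OF Q(1)]] by blast
  qed simp
  then obtain n0 where n0: "\<And>n. n \<ge> n0 \<Longrightarrow> ?N (Suc n) \<subseteq> act G (?N n) + Q" by blast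
  have le: "?N (n0 + j) \<subseteq> scale x ` ?E j + Q" for j
  proof (induction j)
    case 0 then show ?case by (auto simp: cut_def add.commute)
  next
    case (Suc j)
    have sub: "subspace (scale x ` ?E j)" using Q by (intro subspace_image_scale) auto
    have "?N (Suc (n0 + j)) \<subseteq> act G (?N (n0 + j)) + Q" by (rule n0) simp
    also have "\<dots> \<subseteq> act G (scale x ` ?E j + Q) + Q"
      using Suc by (intro set_plus_mono2 act_mono) auto
    also have "\<dots> = scale x ` act G (?E j) + act G Q + Q"
      by (simp add: act_plus[OF sub Q(1)] act_image_scale)
    also have "\<dots> \<subseteq> scale x ` ?E (Suc j) + Q"
    proof -
      have S: "subspace (scale x ` ?E (Suc j) + Q)"
        using Q subspace_filt by (intro subspace_plus subspace_image_scale) auto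
      have Q': "Q \<subseteq> scale x ` ?E (Suc j) + Q"
        using Q subspace_filt by (intro plus_upper2 subspace_image_scale) auto
      have "act G Q \<subseteq> scale x ` ?E (Suc j) + Q" using act_le[OF Q(1)] Q' by blast
      moreover have "scale x ` act G (?E j) \<subseteq> scale x ` ?E (Suc j)" by (intro image_mono act_filt_le Q)
      then have "scale x ` act G (?E j) \<subseteq> scale x ` ?E (Suc j) + Q"
        using plus_upper1[OF Q(1)] by blast
      ultimately show ?thesis by (intro plus_least S Q')
    qed
    finally show ?case by simp
  qed
  have "u \<in> ?E n" if "x *s u \<in> ?E (n0 + n)" for n u
  proof -
    have "x *s u \<in> ?N (n0 + n)" using that scale_in_cut[OF Q(1)] by blast
    then obtain f q where fq: "x *s u = x *s f + q" "f \<in> ?E n" "q \<in> Q"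
      using le by (blast elim!: set_plus_elim)
    then have "x *s (u - f) \<in> Q" by (simp add: scale_right_diff_distrib)
    then have "u - f \<in> Q" by (rule regularD[OF x])
    then have "u - f \<in> ?E n" using filt_upper by blast
    then have "(u - f) + f \<in> ?E n" using fq(2) Q(1) subspace_filt subspace_add by blast
    then show ?thesis by simp
  qed
  then show ?thesis by (rule that)
qed

end

section \<open>Modules over a local ring\<close>

definition ring_ideal :: "'s::comm_ring_1 set \<Rightarrow> bool" where
  "ring_ideal P \<longleftrightarrow> 0 \<in> P \<and> (\<forall>a\<in>P. \<forall>b\<in>P. a + b \<in> P) \<and> (\<forall>c. \<forall>a\<in>P. c * a \<in> P)"

definition prime_ring_ideal :: "'s::comm_ring_1 set \<Rightarrow> bool" where
  "prime_ring_ideal P \<longleftrightarrow> ring_ideal P \<and> 1 \<notin> P \<and> (\<forall>a b. a * b \<in> P \<longrightarrow> a \<in> P \<or> b \<in> P)"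

lemma ring_idealD:
  assumes "ring_ideal P"
  shows "0 \<in> P" "a \<in> P \<Longrightarrow> b \<in> P \<Longrightarrow> a + b \<in> P" "a \<in> P \<Longrightarrow> c * a \<in> P"
    "a \<in> P \<Longrightarrow> a * c \<in> P" "a \<in> P \<Longrightarrow> b \<in> P \<Longrightarrow> a - b \<in> P"
proof -
  show "0 \<in> P" "a \<in> P \<Longrightarrow> b \<in> P \<Longrightarrow> a + b \<in> P" and *: "a \<in> P \<Longrightarrow> c * a \<in> P" for a b c
    using assms by (auto simp: ring_ideal_def)
  show "a \<in> P \<Longrightarrow> a * c \<in> P" using * by (metis mult.commute)
  show "a \<in> P \<Longrightarrow> b \<in> P \<Longrightarrow> a - b \<in> P"
    using assms *[of b "-1"] unfolding ring_ideal_def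
    by (metis diff_conv_add_uminus mult_minus1)
qed

lemma ring_ideal_add_principal:
  assumes "ring_ideal P" shows "ring_ideal {p + c * a |p c. p \<in> P}"
  unfolding ring_ideal_def
proof (intro conjI ballI allI)
  show "0 \<in> {p + c * a |p c. p \<in> P}"
    using ring_idealD(1)[OF assms] by (intro CollectI exI[of _ 0]) simp
next
  fix u v assume "u \<in> {p + c * a |p c. p \<in> P}" "v \<in> {p + c * a |p c. p \<in> P}"
  then obtain p c q d where "u = p + c * a" "v = q + d * a" "p \<in> P" "q \<in> P" by blast
  then have "u + v = (p + q) + (c + d) * a" "p + q \<in> P"
    using ring_idealD(2)[OF assms] by (auto simp: algebra_simps)
  then show "u + v \<in> {p + c * a |p c. p \<in> P}" by blast
next
  fix d u assume "u \<in> {p + c * a |p c. p \<in> P}"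
  then obtain p c where "u = p + c * a" "p \<in> P" by blast
  then have "d * u = d * p + (d * c) * a" "d * p \<in> P"
    by (simp add: algebra_simps, intro ring_idealD(3)[OF assms])
  then show "d * u \<in> {p + c * a |p c. p \<in> P}" by blast
qed

text \<open>An ideal that is maximal among those containing \<open>J\<close> and missing
  \<open>S\<close> is prime. Maximality is kept in the conclusion because \<open>S = {1}\<close>
  later produces a maximal ideal.\<close>

lemma ex_prime_avoiding:
  assumes J: "ring_ideal J" and S: "1 \<in> S" "\<And>a b. a \<in> S \<Longrightarrow> b \<in> S \<Longrightarrow> a * b \<in> S" and JS: "J \<inter> S = {}"
  obtains P where "prime_ring_ideal P" "J \<subseteq> P" "P \<inter> S = {}"
    "\<And>P'. ring_ideal P' \<Longrightarrow> P' \<inter> S = {} \<Longrightarrow> P \<subseteq> P' \<Longrightarrow> P' = P"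
proof -
  let ?A = "{P. ring_ideal P \<and> J \<subseteq> P \<and> P \<inter> S = {}}"
  have "\<exists>M\<in>?A. \<forall>P\<in>?A. M \<subseteq> P \<longrightarrow> P = M"
  proof (rule subset_Zorn_nonempty)
    show "?A \<noteq> {}" using J JS by blast
    fix \<C> assume ne: "\<C> \<noteq> {}" and ch: "subset.chain ?A \<C>"
    have C: "\<And>P. P \<in> \<C> \<Longrightarrow> ring_ideal P \<and> J \<subseteq> P \<and> P \<inter> S = {}"
      and tot: "\<And>U V. U \<in> \<C> \<Longrightarrow> V \<in> \<C> \<Longrightarrow> U \<subseteq> V \<or> V \<subseteq> U"
      using ch unfolding subset.chain_def by blast+
    have "ring_ideal (\<Union>\<C>)"
      unfolding ring_ideal_def
    proof (intro conjI ballI allI)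
      show "0 \<in> \<Union>\<C>" using ne C ring_idealD(1) by blast
      fix u v assume "u \<in> \<Union>\<C>" "v \<in> \<Union>\<C>"
      then obtain U V where "U \<in> \<C>" "V \<in> \<C>" "u \<in> U" "v \<in> V" by blast
      then obtain W where "W \<in> \<C>" "u \<in> W" "v \<in> W" using tot by blast
      then show "u + v \<in> \<Union>\<C>" using C ring_idealD(2) by blast
    next
      fix c u assume "u \<in> \<Union>\<C>" then show "c * u \<in> \<Union>\<C>" using C ring_idealD(3) by blast
    qed
    then show "\<Union>\<C> \<in> ?A" using ne C by blast
  qed
  then obtain P where PA: "P \<in> ?A" and maxA: "\<forall>P'\<in>?A. P \<subseteq> P' \<longrightarrow> P' = P" by (rule bexE)
  then have P: "ring_ideal P" "J \<subseteq> P" "P \<inter> S = {}" by simp_all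
  have max: "P' = P" if "ring_ideal P'" "J \<subseteq> P'" "P' \<inter> S = {}" "P \<subseteq> P'" for P'
    using bspec[OF maxA, of P'] that by simp
  have meet: "\<exists>p c. p \<in> P \<and> p + c * a \<in> S" if a: "a \<notin> P" for a
  proof (rule ccontr)
    assume no: "\<not> ?thesis"
    let ?P = "{p + c * a |p c. p \<in> P}"
    have "P \<subseteq> ?P" by (intro subsetI CollectI, rule exI, rule exI[of _ 0]) simp
    moreover have "?P \<inter> S = {}" using no by blast
    ultimately have "?P = P" using P by (intro max ring_ideal_add_principal) auto
    moreover have "a \<in> ?P" using ring_idealD(1)[OF P(1)] by (intro CollectI exI[of _ 0] exI[of _ 1]) simp
    ultimately show False using a by blast
  qed
  have "a \<in> P \<or> b \<in> P" if ab: "a * b \<in> P" for a b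
  proof (rule ccontr)
    assume "\<not> ?thesis"
    then obtain p c q d where pq: "p \<in> P" "p + c * a \<in> S" "q \<in> P" "q + d * b \<in> S"
      using meet[of a] meet[of b] by blast
    have "(p + c * a) * (q + d * b) = p * (q + d * b) + ((c * a) * q + (c * d) * (a * b))"
      by (simp add: algebra_simps)
    also have "\<dots> \<in> P" using pq ab ring_idealD(2-4)[OF P(1)] by simp
    finally show False using S(2)[OF pq(2,4)] P(3) by blast
  qed
  then have "prime_ring_ideal P" using P S(1) by (auto simp: prime_ring_ideal_def)
  moreover have "P' = P" if "ring_ideal P'" "P' \<inter> S = {}" "P \<subseteq> P'" for P'
    using max[OF that(1) _ that(2,3)] P(2) that(3) by simp
  ultimately show ?thesis using that P by simp
qed

context scalar_module
begin

definition ann :: "'f set \<Rightarrow> 's set"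
  where "ann Q = {s. \<forall>f. s *s f \<in> Q}"

text \<open>Only upper bounds for the dimension occur: they lead to dimension zero after enough
  cuts, whereas depth supplies the regular elements.\<close>

definition dim_le :: "nat \<Rightarrow> 'f set \<Rightarrow> bool" where
  "dim_le d Q \<longleftrightarrow> (\<forall>n P. (\<forall>i\<le>n. prime_ring_ideal (P i)) \<and> (\<forall>i<n. P i \<subset> P (Suc i)) \<and> ann Q \<subseteq> P 0 \<longrightarrow> n \<le> d)"

lemma ring_ideal_ann: "subspace Q \<Longrightarrow> ring_ideal (ann Q)"
  unfolding ring_ideal_def ann_def
  by (auto simp: subspace_0 scale_left_distrib subspace_add scale_scale[symmetric] subspace_scale
      simp del: scale_scale)

text \<open>A chain of primes above the annihilator of the cut is prolonged downwards. Its lowest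
  prime \<open>P 0\<close> contains \<open>x\<close>; a smaller prime without \<open>x\<close> is
  found by avoiding all \<open>s * x ^ k\<close> with \<open>s\<close> outside \<open>P 0\<close>,
  and regularity of \<open>x\<close> keeps these products out of \<open>ann Q\<close>.\<close>

lemma dim_le_cut:
  assumes Q: "subspace Q" and x: "regular Q x" and dim: "dim_le (Suc d) Q"
  shows "dim_le d (cut Q x)"
  unfolding dim_le_def
proof (intro allI impI)
  fix n P assume P: "(\<forall>i\<le>n. prime_ring_ideal (P i)) \<and> (\<forall>i<n. P i \<subset> P (Suc i)) \<and> ann (cut Q x) \<subseteq> P 0"
  then have P0: "prime_ring_ideal (P 0)" by simp
  have xP: "x \<in> P 0" and QP: "ann Q \<subseteq> P 0"
proof -
    have "x \<in> ann (cut Q x)" unfolding ann_def using scale_in_cut[OF Q] by blast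
    then show "x \<in> P 0" using P by blast
    have "ann Q \<subseteq> ann (cut Q x)" unfolding ann_def using cut_upper[OF Q, of x] by blast
    then show "ann Q \<subseteq> P 0" using P by blast
  qed
  define S where "S = {s * x ^ k |s k. s \<notin> P 0}"
  have "ann Q \<inter> S = {}"
  proof (rule ccontr)
    assume "ann Q \<inter> S \<noteq> {}"
    then obtain s k where s: "s \<notin> P 0" "s * x ^ k \<in> ann Q" by (auto simp: S_def)
    have "s *s f \<in> Q" for f
    proof (rule regularD[OF regular_power[OF x]])
      show "x ^ k *s s *s f \<in> Q" using s(2) by (simp add: ann_def mult.commute)
    qed
    then show False using s QP by (auto simp: ann_def)
  qed
  moreover have "1 \<in> S" unfolding S_def
    using P0 by (intro CollectI exI[of _ 1] exI[of _ 0]) (simp add: prime_ring_ideal_def)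
  moreover have "a * b \<in> S" if ab: "a \<in> S" "b \<in> S" for a b
  proof -
    obtain s k t l where *: "a = s * x ^ k" "b = t * x ^ l" "s \<notin> P 0" "t \<notin> P 0"
      using ab by (auto simp: S_def)
    then have "a * b = (s * t) * x ^ (k + l)" by (simp add: power_add algebra_simps)
    moreover have "s * t \<notin> P 0" using * P0 by (auto simp: prime_ring_ideal_def)
    ultimately show ?thesis by (auto simp: S_def)
  qed
  ultimately obtain P' where P': "prime_ring_ideal P'" "ann Q \<subseteq> P'" "P' \<inter> S = {}"
    using ex_prime_avoiding[OF ring_ideal_ann[OF Q], of S] by metis
  have "P' \<subseteq> P 0"
  proof
    fix s assume "s \<in> P'"
    then have "s \<notin> S" using P' by blast
    then show "s \<in> P 0" unfolding S_def by (metis (mono_tags, lifting) mem_Collect_eq mult.right_neutral power_0)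
  qed
  moreover have "x \<in> S" unfolding S_def
    using P0 by (intro CollectI exI[of _ 1] exI[of _ 1]) (simp add: prime_ring_ideal_def)
  then have "x \<notin> P'" using P' by blast
  ultimately have "P' \<subset> P 0" using xP by blast
  define P'' where "P'' i = (case i of 0 \<Rightarrow> P' | Suc j \<Rightarrow> P j)" for i
  have "(\<forall>i\<le>Suc n. prime_ring_ideal (P'' i)) \<and> (\<forall>i<Suc n. P'' i \<subset> P'' (Suc i)) \<and> ann Q \<subseteq> P'' 0"
    using P P' \<open>P' \<subset> P 0\<close> by (auto simp: P''_def split: nat.split)
  then have "Suc n \<le> Suc d" using dim unfolding dim_le_def by blast
  then show "n \<le> d" by simp
qed

end

text \<open>The quotient by \<open>K\<close> is a module over a local ring with infinite residue field: \<open>mm\<close> is the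
  preimage of the maximal ideal, \<open>T\<close> a set of lifts of residue classes, and \<open>zs\<close> and \<open>gs\<close> lift
  generators of the maximal ideal and of a primary ideal.\<close>

locale local_scalar_module = noetherian_scalar_module scale K
  for scale :: "'s::comm_ring_1 \<Rightarrow> 'f::ab_group_add \<Rightarrow> 'f" (infixr \<open>*s\<close> 75) and K :: "'f set" +
  fixes mm T :: "'s set" and zs gs :: "'s list"
  assumes mm: "ring_ideal mm" and one_notin_mm: "1 \<notin> mm"
    and unit: "s \<notin> mm \<Longrightarrow> \<exists>c. \<forall>f. (c * s) *s f - f \<in> K"
    and zs_mm: "set zs \<subseteq> mm"
    and zs_gen: "a \<in> mm \<Longrightarrow> subspace P \<Longrightarrow> K \<subseteq> P \<Longrightarrow> (\<And>z. z \<in> set zs \<Longrightarrow> z *s u \<in> P) \<Longrightarrow> a *s u \<in> P"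
    and gs_mm: "set gs \<subseteq> mm"
    and gs_primary: "a \<in> mm \<Longrightarrow> \<exists>k. \<forall>P u. subspace P \<and> K \<subseteq> P \<and> (\<forall>g\<in>set gs. g *s u \<in> P) \<longrightarrow> a ^ k *s u \<in> P"
    and infinite_T: "infinite T"
    and T_diff: "s \<in> T \<Longrightarrow> t \<in> T \<Longrightarrow> s \<noteq> t \<Longrightarrow> s - t \<notin> mm"
begin

abbreviation "G \<equiv> set gs"

lemma regular_unit:
  assumes "s \<notin> mm" "subspace Q" "K \<subseteq> Q" shows "regular Q s"
  unfolding regular_def
proof (intro allI impI)
  fix f assume "s *s f \<in> Q"
  obtain c where c: "(c * s) *s f - f \<in> K" using unit[OF assms(1)] by blast
  have "(c * s) *s f \<in> Q" using subspace_scale[OF assms(2) \<open>s *s f \<in> Q\<close>, of c] by simp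
  then have "(c * s) *s f - ((c * s) *s f - f) \<in> Q"
    by (rule subspace_diff[OF assms(2) _ subsetD[OF assms(3) c]])
  then show "f \<in> Q" by simp
qed

lemma curve_mm: "set xs \<subseteq> mm \<Longrightarrow> curve xs t \<in> mm"
  by (induction xs) (auto intro: ring_idealD[OF mm])

text \<open>Choose \<open>N'\<close> maximal among the proper submodules of \<open>N + P\<close>
  above \<open>N\<close>. One element \<open>u\<close> generates \<open>N + P\<close> over
  \<open>N'\<close>, and the hypothesis becomes \<open>(1 - a) u \<in> N'\<close> with
  \<open>a\<close> in the maximal ideal. The chain condition takes the place of a list of generators
  of \<open>P\<close>.\<close>

lemma nakayama:
  assumes N: "subspace N" "K \<subseteq> N" and P: "subspace P" and le: "P \<subseteq> N + act mm P"
  shows "P \<subseteq> N"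
proof (rule ccontr)
  assume PN: "\<not> P \<subseteq> N"
  let ?A = "{N'. subspace N' \<and> N \<subseteq> N' \<and> N' \<subset> N + P}"
  have "N \<subset> N + P" using PN plus_upper1[OF P, of N] plus_upper2[OF N(1), of P] by blast
  then have "N \<in> ?A" using N by simp
  then have ne: "?A \<noteq> {}" by blast
  have sub: "subspace N' \<and> K \<subseteq> N'" if "N' \<in> ?A" for N' using that N(2) by auto
  obtain N' where N': "N' \<in> ?A" and max: "\<And>P. P \<in> ?A \<Longrightarrow> N' \<subseteq> P \<Longrightarrow> P = N'"
    by (rule ex_maximal[OF ne sub]) (simp, rule that)
  then obtain u where u: "u \<in> N + P" "u \<notin> N'" by blast
  have sN': "subspace N'" "N \<subseteq> N'" "N' \<subseteq> N + P" using N' by auto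
  let ?U = "N' + span {u}"
  have "?U \<subseteq> N + P" using sN' u by (intro plus_least subspace_plus N P span_minimal) auto
  moreover have "u \<in> ?U" using plus_upper2[OF sN'(1), of "span {u}"] span_base[of u "{u}"] by blast
  moreover have "N' \<subseteq> ?U" by (intro plus_upper1) simp
  moreover have "subspace ?U" using sN' by (intro subspace_plus) auto
  ultimately have U: "?U = N + P" using max[of ?U] u(2) sN'(2) by blast
  have "act mm P \<subseteq> {n + a *s u |n a. n \<in> N' \<and> a \<in> mm}" (is "_ \<subseteq> ?W")
  proof (rule act_least)
    show "subspace ?W"
    proof (rule subspaceI)
      show "0 \<in> ?W" using subspace_0[OF sN'(1)] ring_idealD(1)[OF mm]
        by (intro CollectI exI[of _ 0]) simp
      fix v w assume "v \<in> ?W" "w \<in> ?W"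
      then obtain n a m b where "v = n + a *s u" "w = m + b *s u" "n \<in> N'" "m \<in> N'" "a \<in> mm" "b \<in> mm"
        by blast
      then have "v + w = (n + m) + (a + b) *s u" "n + m \<in> N'" "a + b \<in> mm"
        using subspace_add[OF sN'(1)] ring_idealD(2)[OF mm] by (auto simp: algebra_simps)
      then show "v + w \<in> ?W" by blast
    next
      fix c v assume "v \<in> ?W"
      then obtain n a where "v = n + a *s u" "n \<in> N'" "a \<in> mm" by blast
      then have "c *s v = c *s n + (c * a) *s u" "c *s n \<in> N'" "c * a \<in> mm"
        using subspace_scale[OF sN'(1)] ring_idealD(3)[OF mm] by (auto simp: algebra_simps)
      then show "c *s v \<in> ?W" by blast
    qed
    fix a p assume a: "a \<in> mm" and "p \<in> P"
    then have "p \<in> ?U" using U plus_upper2[OF N(1), of P] by blast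
    then obtain n c where "p = n + c *s u" "n \<in> N'" by (auto simp: span_singleton elim!: set_plus_elim)
    then have "a *s p = a *s n + (a * c) *s u" "a *s n \<in> N'"
      using subspace_scale[OF sN'(1)] by (auto simp: scale_right_distrib)
    moreover have "a * c \<in> mm" by (rule ring_idealD(4)[OF mm a])
    ultimately show "a *s p \<in> ?W" by blast
  qed
  moreover have "u \<in> N + act mm P"
  proof -
    have "N + P \<subseteq> N + act mm P" using le N by (intro plus_least subspace_plus plus_upper1) auto
    then show ?thesis using u(1) by blast
  qed
  ultimately obtain n w where nw: "u = n + w" "n \<in> N" "w \<in> ?W"
    by (meson set_plus_elim subsetD)
  then obtain n' a where w: "w = n' + a *s u" "n' \<in> N'" "a \<in> mm" by blast
  have *: "u = n + (n' + a *s u)" "n \<in> N" "n' \<in> N'" "a \<in> mm" using nw(1,2) w by simp_all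
  have "(1 - a) *s u = u - a *s u" by (simp add: algebra_simps)
  also have "\<dots> = n + n'" using *(1) by (metis add.assoc add_diff_cancel_right')
  moreover have "n + n' \<in> N'" using * sN' by (intro subspace_add) auto
  ultimately have "(1 - a) *s u \<in> N'" by simp
  moreover have "1 - a \<notin> mm"
  proof
    assume "1 - a \<in> mm"
    then have "(1 - a) + a \<in> mm" using *(4) by (rule ring_idealD(2)[OF mm])
    then show False using one_notin_mm by simp
  qed
  then have "regular N' (1 - a)" using sN' N by (intro regular_unit) auto
  ultimately have "u \<in> N'" by (metis regularD)
  then show False using u by blast
qed

section \<open>Socles, finite length and common regular elements\<close>

definition socle_free :: "'f set \<Rightarrow> bool"
  where "socle_free Q \<longleftrightarrow> (\<forall>u. (\<forall>a\<in>mm. a *s u \<in> Q) \<longrightarrow> u \<in> Q)"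

text \<open>Multiply by the highest power of each generator of the maximal ideal that does not yet
  lead into \<open>Q\<close>, one generator after the other.\<close>

lemma ex_socle_multiple:
  assumes Q: "subspace Q" "K \<subseteq> Q" and u: "u \<notin> Q" "\<And>a. a \<in> mm \<Longrightarrow> \<exists>k. a ^ k *s u \<in> Q"
  obtains c where "c *s u \<notin> Q" "\<And>a. a \<in> mm \<Longrightarrow> a *s c *s u \<in> Q"
proof -
  have "set ws \<subseteq> mm \<Longrightarrow> \<exists>c. c *s u \<notin> Q \<and> (\<forall>z\<in>set ws. z *s c *s u \<in> Q)" for ws
  proof (induction ws)
    case Nil then show ?case using u(1) by (intro exI[of _ 1]) simp
  next
    case (Cons z ws)
    then obtain c where c: "c *s u \<notin> Q" "\<And>w. w \<in> set ws \<Longrightarrow> w *s c *s u \<in> Q" by auto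
    obtain k where "z ^ k *s u \<in> Q" using u(2)[of z] Cons.prems by auto
    then have "c *s z ^ k *s u \<in> Q" by (rule subspace_scale[OF Q(1)])
    then have ex: "z ^ k *s c *s u \<in> Q" by (simp only: scale_left_commute)
    define l where "l = (LEAST k. z ^ k *s c *s u \<in> Q)"
    have l: "z ^ l *s c *s u \<in> Q" unfolding l_def using ex by (rule LeastI)
    have "l \<noteq> 0" using l c(1) by (cases l) auto
    then obtain m where m: "l = Suc m" by (cases l) auto
    have nm: "z ^ m *s c *s u \<notin> Q" using not_less_Least[of m "\<lambda>k. z ^ k *s c *s u \<in> Q"] m l_def by simp
    have "w *s z ^ m *s c *s u \<in> Q" if w: "w \<in> set (z # ws)" for w
    proof (cases "w = z")
      case True then show ?thesis using l m by (simp add: mult.assoc)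
    next
      case False
      then have "w *s c *s u \<in> Q" using w c(2)[of w] by simp
      then have "z ^ m *s w *s c *s u \<in> Q" by (rule subspace_scale[OF Q(1)])
      then show ?thesis by (simp only: scale_left_commute[of w])
    qed
    then show ?case using nm by (intro exI[of _ "z ^ m * c"]) (simp only: scale_scale[symmetric], blast)
  qed
  from this[OF zs_mm] obtain c where "c *s u \<notin> Q" "\<And>z. z \<in> set zs \<Longrightarrow> z *s c *s u \<in> Q" by blast
  then show ?thesis using zs_gen[OF _ Q] that by blast
qed

text \<open>Noetherian induction: over a maximal counterexample \<open>P\<close> a socle element
  \<open>v\<close> generates a simple module, so finite length and nilpotency both pass from
  \<open>P + span {v}\<close> to \<open>P\<close>. The former serves the Hilbert function, the
  latter the vanishing of high powers in dimension zero.\<close>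

lemma nil_imp_finite_length:
  assumes "subspace Q" "K \<subseteq> Q" "\<And>a. a \<in> mm \<Longrightarrow> \<exists>k. \<forall>f. a ^ k *s f \<in> Q"
  shows "finite_length Q UNIV \<and> (\<exists>r. (act mm ^^ r) UNIV \<subseteq> Q)"
proof (rule ccontr)
  define bad where "bad Q \<longleftrightarrow> subspace Q \<and> K \<subseteq> Q \<and> (\<forall>a\<in>mm. \<exists>k. \<forall>f. a ^ k *s f \<in> Q) \<and>
    \<not> (finite_length Q UNIV \<and> (\<exists>r. (act mm ^^ r) UNIV \<subseteq> Q))" for Q
  assume "\<not> ?thesis"
  then have "bad Q" using assms by (simp add: bad_def)
  then have "{Q. bad Q} \<noteq> {}" by blast
  then obtain P where "P \<in> {Q. bad Q}" and max0: "\<And>P'. P' \<in> {Q. bad Q} \<Longrightarrow> P \<subseteq> P' \<Longrightarrow> P' = P"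
    by (rule ex_maximal) (simp_all add: bad_def)
  then have bad: "bad P" and max: "\<And>P'. bad P' \<Longrightarrow> P \<subseteq> P' \<Longrightarrow> P' = P" by auto
  then have P: "subspace P" "K \<subseteq> P" and nil: "\<And>a. a \<in> mm \<Longrightarrow> \<exists>k. \<forall>f. a ^ k *s f \<in> P"
    and nP: "\<not> (finite_length P UNIV \<and> (\<exists>r. (act mm ^^ r) UNIV \<subseteq> P))" by (auto simp: bad_def)
  have "finite_length UNIV UNIV" unfolding finite_length_def
  proof (intro exI[of _ 0] allI impI)
    fix n assume "has_chain n UNIV (UNIV::'f set)"
    then show "n \<le> 0" by (cases n) (auto dest: has_chain_subset)
  qed
  then have "P \<noteq> UNIV" using nP by auto
  then obtain u where u: "u \<notin> P" by blast
  have "\<exists>k. a ^ k *s u \<in> P" if "a \<in> mm" for a using nil[OF that] by blast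
  then obtain c where c: "c *s u \<notin> P" "\<And>a. a \<in> mm \<Longrightarrow> a *s c *s u \<in> P"
    using ex_socle_multiple[OF P u] by metis
  define v where "v = c *s u"
  let ?P = "P + span {v}"
  have PP: "P \<subseteq> ?P" by (intro plus_upper1) simp
  have vP: "v \<in> ?P" using plus_upper2[OF P(1), of "span {v}"] span_base[of v "{v}"] by blast
  have subP: "subspace ?P" using P by (intro subspace_plus) auto
  have "?P \<noteq> P" using vP c(1) v_def by blast
  then have "\<not> bad ?P" using max PP by blast
  moreover have "\<exists>k. \<forall>f. a ^ k *s f \<in> ?P" if "a \<in> mm" for a using nil[OF that] PP by blast
  ultimately have fin: "finite_length ?P UNIV" and r: "\<exists>r. (act mm ^^ r) UNIV \<subseteq> ?P"
    using subP P PP unfolding bad_def by blast+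
  have elem: "\<exists>p s. w = p + s *s v \<and> p \<in> P" if "w \<in> ?P" for w
    using that by (auto simp: span_singleton elim!: set_plus_elim)
  have simple: "W = P" if W: "subspace W" "P \<subseteq> W" "W \<subset> ?P" for W
  proof (rule ccontr)
    assume "W \<noteq> P"
    then obtain w where w: "w \<in> W" "w \<notin> P" using W by blast
    then obtain p s where ps: "w = p + s *s v" "p \<in> P" using elem W by blast
    have "s \<notin> mm"
    proof
      assume "s \<in> mm"
      then have "s *s v \<in> P" using c by (simp add: v_def)
      then show False using ps w subspace_add[OF P(1)] by blast
    qed
    have "s *s v = w - p" using ps by simp
    moreover have "p \<in> W" using ps(2) W(2) by blast
    ultimately have "s *s v \<in> W" using subspace_diff[OF W(1) w(1)] by simp
    then have "v \<in> W" using regular_unit[OF \<open>s \<notin> mm\<close> W(1)] W(2) P(2) by (metis regularD subset_trans)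
    then have "?P \<subseteq> W" using W by (intro plus_least span_minimal) auto
    then show False using W by blast
  qed
  have "finite_length P ?P" unfolding finite_length_def
  proof (intro exI[of _ 1] allI impI)
    fix n assume n: "has_chain n P ?P"
    show "n \<le> 1"
    proof (rule ccontr)
      assume "\<not> n \<le> 1"
      then have "Suc (Suc 0) \<le> n" by simp
      then have "has_chain (Suc (Suc 0)) P ?P" by (rule has_chain_le[OF n])
      then obtain W W' where "subspace W" "W \<subset> ?P" "subspace W'" "W' \<subset> W" "P \<subseteq> W'" by auto
      then show False using simple[of W] by blast
    qed
  qed
  then have "finite_length P UNIV"
    using fin P subP PP by (intro finite_length_trans[of P ?P UNIV]) auto
  moreover have "act mm ?P \<subseteq> P"
  proof (rule act_least[OF P(1)])
    fix a w assume a: "a \<in> mm" and "w \<in> ?P"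
    then obtain p s where ps: "w = p + s *s v" "p \<in> P" using elem by blast
    have "a *s w = a *s p + s *s a *s v"
      unfolding ps(1) scale_right_distrib by (simp only: scale_left_commute)
    moreover have "a *s p \<in> P" by (rule subspace_scale[OF P(1) ps(2)])
    moreover have "s *s a *s v \<in> P"
      unfolding v_def by (rule subspace_scale[OF P(1) c(2)[OF a]])
    ultimately show "a *s w \<in> P" using subspace_add[OF P(1)] by simp
  qed
  moreover obtain r where "(act mm ^^ r) UNIV \<subseteq> ?P" using r by blast
  then have "(act mm ^^ Suc r) UNIV \<subseteq> act mm ?P" by (simp add: act_mono)
  ultimately have "(act mm ^^ Suc r) UNIV \<subseteq> P" by (meson subset_trans)
  then show False using nP \<open>finite_length P UNIV\<close> by blast
qed

lemma filt_nil:
  assumes Q: "subspace Q" "K \<subseteq> Q" and a: "a \<in> mm" shows "\<exists>k. \<forall>f. a ^ k *s f \<in> filt G Q n"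
proof -
  obtain k where k: "\<And>P u. subspace P \<Longrightarrow> K \<subseteq> P \<Longrightarrow> (\<And>g. g \<in> G \<Longrightarrow> g *s u \<in> P) \<Longrightarrow> a ^ k *s u \<in> P"
    using gs_primary[OF a] by blast
  have "a ^ (k * n) *s f \<in> filt G Q n" for f
  proof (induction n)
    case (Suc n)
    have "a ^ k *s a ^ (k * n) *s f \<in> filt G Q (Suc n)"
    proof (rule k)
      show "K \<subseteq> filt G Q (Suc n)" using Q(2) filt_upper by blast
      show "g *s a ^ (k * n) *s f \<in> filt G Q (Suc n)" if "g \<in> G" for g
        by (rule scale_in_filt[OF Q(1) that Suc])
    qed (rule subspace_filt[OF Q(1)])
    then show ?case by (simp add: power_add)
  qed simp
  then show ?thesis by blast
qed

lemma finite_length_filt: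
  assumes Q: "subspace Q" "K \<subseteq> Q" shows "finite_length (filt G Q n) UNIV"
proof -
  have "K \<subseteq> filt G Q n" using Q filt_upper by blast
  then show ?thesis using nil_imp_finite_length[OF subspace_filt[OF Q(1)]] filt_nil[OF Q] by blast
qed

lemma socle_free_after_zs:
  assumes Q: "subspace Q" "K \<subseteq> Q" "socle_free Q"
  shows "after (set zs) n (\<lambda>v. v \<in> Q) u \<Longrightarrow> u \<in> Q"
proof (induction n arbitrary: u)
  case (Suc n)
  then have "z *s u \<in> Q" if "z \<in> set zs" for z using that by simp
  then have "\<forall>a\<in>mm. a *s u \<in> Q" using zs_gen[OF _ Q(1,2)] by blast
  then show ?case using Q(3) unfolding socle_free_def by blast
qed simp

text \<open>The socle refers to the maximal ideal while \<open>gs\<close> generates only a primary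
  one, so an element outside \<open>Q\<close> is first multiplied into the socle.\<close>

lemma socle_free_after_gs:
  assumes Q: "subspace Q" "K \<subseteq> Q" "socle_free Q"
  shows "after G n (\<lambda>v. v \<in> Q) u \<Longrightarrow> u \<in> Q"
proof (induction n arbitrary: u)
  case (Suc n)
  then have gu: "\<forall>g\<in>G. g *s u \<in> Q" by simp
  show ?case
  proof (rule ccontr)
    assume u: "u \<notin> Q"
    have "\<exists>k. a ^ k *s u \<in> Q" if "a \<in> mm" for a using gs_primary[OF that] Q gu by blast
    then obtain c where c: "c *s u \<notin> Q" "\<And>a. a \<in> mm \<Longrightarrow> a *s c *s u \<in> Q"
      using ex_socle_multiple[OF Q(1,2) u] by metis
    then show False using Q(3) unfolding socle_free_def by blast
  qed
qed simp

lemma regular_T_diff: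
  "subspace Q \<Longrightarrow> K \<subseteq> Q \<Longrightarrow> s \<in> T \<Longrightarrow> t \<in> T \<Longrightarrow> s \<noteq> t \<Longrightarrow> regular Q (s - t)"
  by (intro regular_unit T_diff)

lemma finite_nonregular:
  assumes Q: "subspace Q" "K \<subseteq> Q" "socle_free Q" and xs: "xs = zs \<or> xs = gs"
  shows "finite {t \<in> T. \<not> regular Q (curve xs t)}"
proof -
  have fin: "finite {t \<in> T. \<not> (\<exists>N. \<forall>u. curve xs t *s u \<in> Q \<longrightarrow> after (set xs) N (\<lambda>v. v \<in> Q) u)}"
    using regular_T_diff Q by (intro finite_nonregular_points) auto
  have "regular Q (curve xs t)"
    if "\<exists>N. \<forall>u. curve xs t *s u \<in> Q \<longrightarrow> after (set xs) N (\<lambda>v. v \<in> Q) u" for t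
    using that xs socle_free_after_zs[OF Q] socle_free_after_gs[OF Q] unfolding regular_def by blast
  then have "{t \<in> T. \<not> regular Q (curve xs t)} \<subseteq>
      {t \<in> T. \<not> (\<exists>N. \<forall>u. curve xs t *s u \<in> Q \<longrightarrow> after (set xs) N (\<lambda>v. v \<in> Q) u)}"
    by (intro Collect_mono) metis
  then show ?thesis using fin finite_subset by blast
qed

text \<open>Takes the place of prime avoidance: each quotient excludes only finitely many points of
  the curve through \<open>zs\<close>.\<close>

lemma ex_common_regular:
  assumes "finite \<Q>" "\<And>Q. Q \<in> \<Q> \<Longrightarrow> subspace Q \<and> K \<subseteq> Q \<and> socle_free Q"
  obtains c where "c \<in> mm" "\<And>Q. Q \<in> \<Q> \<Longrightarrow> regular Q c"
proof -
  have "finite (\<Union>Q\<in>\<Q>. {t \<in> T. \<not> regular Q (curve zs t)})"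
    using assms by (intro finite_UN_I finite_nonregular) auto
  then have "infinite (T - (\<Union>Q\<in>\<Q>. {t \<in> T. \<not> regular Q (curve zs t)}))"
    using infinite_T by (intro Diff_infinite_finite)
  then obtain t where t: "t \<in> T - (\<Union>Q\<in>\<Q>. {t \<in> T. \<not> regular Q (curve zs t)})"
    using infinite_imp_nonempty by blast
  show ?thesis
  proof (rule that)
    show "curve zs t \<in> mm" by (rule curve_mm[OF zs_mm])
    show "regular Q (curve zs t)" if "Q \<in> \<Q>" for Q using t that by blast
  qed
qed

subsection \<open>Depth\<close>

primrec depth_ge :: "nat \<Rightarrow> 'f set \<Rightarrow> bool" where
  "depth_ge 0 Q \<longleftrightarrow> Q \<noteq> UNIV"
| "depth_ge (Suc d) Q \<longleftrightarrow> (\<exists>a\<in>mm. regular Q a \<and> depth_ge d (cut Q a))"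

lemma depth_ge_proper: "subspace Q \<Longrightarrow> depth_ge d Q \<Longrightarrow> Q \<noteq> UNIV"
proof (induction d arbitrary: Q)
  case (Suc d)
  then obtain a where "depth_ge d (cut Q a)" by auto
  then have "cut Q a \<noteq> UNIV" using Suc subspace_cut by blast
  then show ?case using cut_upper[OF Suc.prems(1)] by blast
qed simp

lemma cut_proper:
  assumes Q: "subspace Q" "K \<subseteq> Q" "Q \<noteq> UNIV" and x: "x \<in> mm" shows "cut Q x \<noteq> UNIV"
proof
  assume U: "cut Q x = UNIV"
  have "range (scale x) \<subseteq> act mm UNIV" using x scale_in_act by auto
  then have "cut Q x \<subseteq> Q + act mm UNIV" unfolding cut_def by (intro set_plus_mono2) auto
  then have "UNIV \<subseteq> Q" using U by (intro nakayama[OF Q(1,2) subspace_UNIV]) auto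
  then show False using Q by blast
qed

lemma regular_imp_socle_free: "a \<in> mm \<Longrightarrow> regular Q a \<Longrightarrow> socle_free Q"
  unfolding socle_free_def by (metis regularD)

text \<open>The socle of the quotient by \<open>cut Q x\<close> is \<open>Ext\<^sup>1\<close> of the residue field and the quotient by \<open>Q\<close>,
  so it does not depend on the regular element \<open>x\<close>; the isomorphism is \<open>u \<mapsto> w\<close> with
  \<open>a u = x w\<close> modulo \<open>Q\<close>.\<close>

lemma socle_free_cut_exchange:
  assumes Q: "subspace Q" and a: "a \<in> mm" "regular Q a" and x: "x \<in> mm" "regular Q x"
    and sf: "socle_free (cut Q a)"
  shows "socle_free (cut Q x)"
  unfolding socle_free_def
proof (intro allI impI)
  fix u assume u: "\<forall>c\<in>mm. c *s u \<in> cut Q x"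
  have rep: "\<exists>q w. q \<in> Q \<and> c *s u = q + x *s w" if "c \<in> mm" for c
    using u that in_cut_iff[of "c *s u" Q x] by blast
  obtain q w where w: "q \<in> Q" "a *s u = q + x *s w" using rep[OF a(1)] by blast
  have "\<forall>c\<in>mm. c *s w \<in> cut Q a"
  proof
    fix c assume "c \<in> mm"
    then obtain q' u' where u': "q' \<in> Q" "c *s u = q' + x *s u'" using rep by blast
    have "x *s (c *s w - a *s u') = c *s (a *s u - q) - a *s (c *s u - q')"
      unfolding w(2) u'(2) by (simp add: algebra_simps)
    also have "\<dots> = a *s q' - c *s q" by (simp add: algebra_simps)
    finally have "x *s (c *s w - a *s u') \<in> Q"
      using w(1) u'(1) Q subspace_diff subspace_scale by simp
    then have "c *s w - a *s u' \<in> Q" by (rule regularD[OF x(2)])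
    then show "c *s w \<in> cut Q a" unfolding in_cut_iff by (metis diff_add_cancel)
  qed
  then have "w \<in> cut Q a" using sf unfolding socle_free_def by blast
  then obtain q'' w' where w': "q'' \<in> Q" "w = q'' + a *s w'" unfolding in_cut_iff by blast
  have "a *s (u - x *s w') = q + x *s q''" using w w' by (simp add: algebra_simps)
  then have "a *s (u - x *s w') \<in> Q" using w w' Q subspace_add subspace_scale by simp
  then have "u - x *s w' \<in> Q" by (rule regularD[OF a(2)])
  then show "u \<in> cut Q x" unfolding in_cut_iff by (metis diff_add_cancel)
qed

text \<open>The element \<open>x\<close> may differ from the first term \<open>a\<close> of the
  sequence witnessing depth. An element \<open>c\<close> that is regular on the quotients by
  \<open>Q\<close>, \<open>cut Q a\<close> and \<open>cut Q x\<close> mediates: one passes from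
  \<open>a, c\<close> to \<open>c, a\<close>, replaces \<open>a\<close> by \<open>x\<close> with the
  induction hypothesis, and reads \<open>c, x\<close> as \<open>x, c\<close>. That \<open>c\<close>
  can be regular modulo \<open>x\<close> as well is the exchange of socles.\<close>

lemma depth_ge_cut:
  "subspace Q \<Longrightarrow> K \<subseteq> Q \<Longrightarrow> depth_ge (Suc d) Q \<Longrightarrow> x \<in> mm \<Longrightarrow> regular Q x \<Longrightarrow> depth_ge d (cut Q x)"
proof (induction d arbitrary: Q x)
  case 0
  then have "Q \<noteq> UNIV" using depth_ge_proper by blast
  then show ?case using cut_proper 0 by simp
next
  case (Suc d)
  then obtain a where a: "a \<in> mm" "regular Q a" "depth_ge (Suc d) (cut Q a)" by auto
  then obtain b where "b \<in> mm" "regular (cut Q a) b" by auto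
  then have sfa: "socle_free (cut Q a)" by (rule regular_imp_socle_free)
  then have sfx: "socle_free (cut Q x)" using socle_free_cut_exchange Suc.prems a by blast
  have sfQ: "socle_free Q" using a regular_imp_socle_free by blast
  have subs: "subspace (cut Q y)" "K \<subseteq> cut Q y" for y
    using Suc.prems(1,2) cut_upper[of Q y] subspace_cut by blast+
  obtain c where c: "c \<in> mm" "\<And>P. P \<in> {Q, cut Q a, cut Q x} \<Longrightarrow> regular P c"
  proof (rule ex_common_regular[of "{Q, cut Q a, cut Q x}"])
    show "subspace P \<and> K \<subseteq> P \<and> socle_free P" if "P \<in> {Q, cut Q a, cut Q x}" for P
      using that Suc.prems(1,2) subs sfQ sfa sfx by blast
  qed (simp, rule that)
  have "depth_ge d (cut (cut Q a) c)"
    using Suc.IH[OF subs a(3) c(1)] c(2) by blast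
  moreover have "regular (cut Q c) a"
    using regular_cut_swap[OF Suc.prems(1) a(2)] c(2) by blast
  ultimately have "depth_ge (Suc d) (cut Q c)" using a(1) by (auto simp: cut_commute[of Q a])
  moreover have "regular (cut Q c) x"
    using regular_cut_swap[OF Suc.prems(1,5)] c(2) by blast
  ultimately have "depth_ge d (cut (cut Q c) x)"
    using Suc.IH[OF subs _ Suc.prems(4)] by blast
  then show ?case using c by (auto simp: cut_commute[of Q c])
qed

text \<open>Almost every point of the curve is regular and superficial. Superficiality only speaks
  about elements already in \<open>?E n\<close>; Artin-Rees first puts an element of the colon into
  \<open>?E n0\<close>, from where it climbs one degree at a time.\<close>

lemma ex_superficial:
  assumes Q: "subspace Q" "K \<subseteq> Q" and depth: "depth_ge (Suc d) Q"
  obtains x n1 where "x \<in> mm" "regular Q x" "depth_ge d (cut Q x)"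
    "\<And>n f. f \<in> filt G Q n \<Longrightarrow> x *s f \<in> filt G Q (Suc n)"
    "\<And>n. n \<ge> n1 \<Longrightarrow> colon (filt G Q (Suc n)) x = filt G Q n"
proof -
  let ?E = "filt G Q"
  define good where "good t \<longleftrightarrow> (\<exists>n0. \<forall>n\<ge>n0. \<forall>u\<in>?E n. curve gs t *s u \<in> ?E (n + 2) \<longrightarrow> u \<in> ?E (Suc n))" for t
  obtain a where "a \<in> mm" "regular Q a" using depth by auto
  then have sf: "socle_free Q" by (rule regular_imp_socle_free)
  have "finite ({t \<in> T. \<not> regular Q (curve gs t)} \<union> {t \<in> T. \<not> good t})"
    unfolding good_def
  proof (intro finite_UnI finite_nonregular finite_nonsuperficial_points Q sf)
    fix s t n assume "s \<in> T" "t \<in> T" "s \<noteq> t"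
    then show "regular (?E n) (s - t)"
      using Q filt_upper[of Q G n] by (intro regular_T_diff subspace_filt) blast+
  qed simp
  then have "infinite (T - ({t \<in> T. \<not> regular Q (curve gs t)} \<union> {t \<in> T. \<not> good t}))"
    using infinite_T by (intro Diff_infinite_finite)
  then obtain t where "t \<in> T - ({t \<in> T. \<not> regular Q (curve gs t)} \<union> {t \<in> T. \<not> good t})"
    using infinite_imp_nonempty by (metis ex_in_conv)
  then have t: "regular Q (curve gs t)" "good t" by blast+
  define x where "x = curve gs t"
  obtain n0 where n0: "\<And>n u. n \<ge> n0 \<Longrightarrow> u \<in> ?E n \<Longrightarrow> x *s u \<in> ?E (n + 2) \<Longrightarrow> u \<in> ?E (Suc n)"
    using t(2) unfolding x_def good_def by blast
  have x: "x \<in> mm" "regular Q x" using t(1) curve_mm[OF gs_mm] by (simp_all add: x_def)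
  obtain k where k: "\<And>n u. x *s u \<in> ?E (k + n) \<Longrightarrow> u \<in> ?E n"
    by (rule artin_rees_regular[OF Q _ x(2), of G]) auto
  have x_filt: "x *s f \<in> ?E (Suc n)" if "f \<in> ?E n" for f n
    unfolding x_def using that Q(1) scale_in_filt by (intro curve_scale_mem subspace_filt) auto
  have "colon (?E (Suc n)) x = ?E n" if n: "n \<ge> n0 + k" for n
  proof
    show "?E n \<subseteq> colon (?E (Suc n)) x" using x_filt by (auto simp: colon_def)
    show "colon (?E (Suc n)) x \<subseteq> ?E n"
    proof
      fix u assume "u \<in> colon (?E (Suc n)) x"
      then have xu: "x *s u \<in> ?E (Suc n)" by (simp add: colon_def)
      have "k + n0 \<le> Suc n" using n by simp
      then have "x *s u \<in> ?E (k + n0)" using xu filt_antimono[OF Q(1)] by blast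
      then have u0: "u \<in> ?E n0" by (rule k)
      have "n0 \<le> n" using n by simp
      have up: "n0 \<le> m \<Longrightarrow> m \<le> n \<Longrightarrow> u \<in> ?E m" for m
      proof (induction m rule: dec_induct)
        case (step m)
        have "x *s u \<in> ?E (m + 2)"
          using xu filt_antimono[OF Q(1), of "m + 2" "Suc n" G] step.prems by auto
        then show ?case using n0 step by auto
      qed (rule u0)
      from up show "u \<in> ?E n" using \<open>n0 \<le> n\<close> by simp
    qed
  qed
  then show ?thesis using that[of x "n0 + k"] x x_filt depth_ge_cut[OF Q depth x] by blast
qed

subsection \<open>Dimension zero\<close>

text \<open>Otherwise some prime above \<open>ann Q\<close> avoids all powers of \<open>a\<close>.
  It lies strictly inside \<open>mm\<close>, since elements outside \<open>mm\<close> are units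
  modulo \<open>ann Q\<close>, and the two primes form a chain of length one.\<close>

lemma dim_le_0_nil:
  assumes Q: "subspace Q" "K \<subseteq> Q" and dim: "dim_le 0 Q" and a: "a \<in> mm"
  shows "\<exists>k. \<forall>f. a ^ k *s f \<in> Q"
proof (rule ccontr)
  assume no: "\<not> ?thesis"
  then have QU: "Q \<noteq> UNIV" by blast
  have annK: "ann K \<subseteq> ann Q" using Q(2) by (auto simp: ann_def)
  have ann_mm: "ann Q \<subseteq> mm"
  proof (rule ccontr)
    assume "\<not> ann Q \<subseteq> mm"
    then obtain s where s: "s \<in> ann Q" "s \<notin> mm" by blast
    have "f \<in> Q" for f by (rule regularD[OF regular_unit[OF s(2) Q]]) (use s in \<open>simp add: ann_def\<close>)
    then show False using QU by blast
  qed
  have unit': "\<exists>c. c * s - 1 \<in> ann Q" if "s \<notin> mm" for s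
  proof -
    obtain c where "\<And>f. (c * s) *s f - f \<in> K" using unit[OF \<open>s \<notin> mm\<close>] by blast
    then have "c * s - 1 \<in> ann K" by (simp add: ann_def scale_left_diff_distrib)
    then show ?thesis using annK by blast
  qed
  let ?S = "range (\<lambda>k. a ^ k)"
  have "ann Q \<inter> ?S = {}" using no by (auto simp: ann_def)
  moreover have "1 \<in> ?S" by (metis power_0 rangeI)
  moreover have "s * t \<in> ?S" if "s \<in> ?S" "t \<in> ?S" for s t
    using that by (auto simp: power_add[symmetric])
  ultimately obtain P where P: "prime_ring_ideal P" "ann Q \<subseteq> P" "P \<inter> ?S = {}"
    using ex_prime_avoiding[OF ring_ideal_ann[OF Q(1)], of ?S] by metis
  have Pi: "ring_ideal P" "1 \<notin> P" using P(1) by (auto simp: prime_ring_ideal_def)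
  have "P \<subseteq> mm"
  proof
    fix s assume s: "s \<in> P"
    show "s \<in> mm"
    proof (rule ccontr)
      assume "s \<notin> mm"
      then obtain c where "c * s - 1 \<in> P" using unit' P(2) by blast
      then have "c * s - (c * s - 1) \<in> P"
        using ring_idealD(3)[OF Pi(1) s] ring_idealD(5)[OF Pi(1)] by blast
      then show False using Pi(2) by simp
    qed
  qed
  moreover have "a \<in> ?S" by (metis power_one_right rangeI)
  then have "a \<notin> P" using P(3) by blast
  ultimately have "P \<subset> mm" using a by blast
  moreover have "prime_ring_ideal mm"
    unfolding prime_ring_ideal_def
  proof (intro conjI allI impI mm one_notin_mm)
    fix s t assume st: "s * t \<in> mm"
    show "s \<in> mm \<or> t \<in> mm"
    proof (rule ccontr)
      assume "\<not> ?thesis"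
      then obtain c where c: "c * s - 1 \<in> mm" "t \<notin> mm" using unit' ann_mm by blast
      have "c * (s * t) - (c * s - 1) * t \<in> mm"
        by (intro ring_idealD[OF mm] st c)
      moreover have "c * (s * t) - (c * s - 1) * t = t" by (simp add: algebra_simps)
      ultimately show False using c(2) by simp
    qed
  qed
  ultimately have "(\<forall>i\<le>Suc 0. prime_ring_ideal (case i of 0 \<Rightarrow> P | Suc j \<Rightarrow> mm)) \<and>
      (\<forall>i<Suc 0. (case i of 0 \<Rightarrow> P | Suc j \<Rightarrow> mm) \<subset> (case Suc i of 0 \<Rightarrow> P | Suc j \<Rightarrow> mm)) \<and>
      ann Q \<subseteq> (case 0 of 0 \<Rightarrow> P | Suc j \<Rightarrow> mm)"
    using P(1,2) by (auto split: nat.split)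
  then have "Suc 0 \<le> 0" using dim[unfolded dim_le_def, rule_format, of "Suc 0" "\<lambda>i. case i of 0 \<Rightarrow> P | Suc j \<Rightarrow> mm"]
    by blast
  then show False by simp
qed

lemma filt_eventually_eq:
  assumes Q: "subspace Q" "K \<subseteq> Q" and dim: "dim_le 0 Q"
  obtains r where "\<And>n. n \<ge> r \<Longrightarrow> filt G Q n = Q"
proof -
  obtain r where r: "(act mm ^^ r) UNIV \<subseteq> Q"
    using nil_imp_finite_length[OF Q dim_le_0_nil[OF Q dim]] by blast
  have "filt G Q n \<subseteq> (act mm ^^ n) UNIV + Q" for n
  proof (induction n)
    case (Suc n)
    have sub: "subspace ((act mm ^^ n) UNIV)" by (cases n) auto
    have "act G (filt G Q n) \<subseteq> act mm ((act mm ^^ n) UNIV + Q)"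
      using Suc gs_mm by (intro act_mono)
    also have "\<dots> \<subseteq> (act mm ^^ Suc n) UNIV + Q"
      unfolding act_plus[OF sub Q(1)] using act_le[OF Q(1)] by (intro set_plus_mono2) auto
    finally show ?case unfolding filt.simps
      using Q by (intro plus_least subspace_plus plus_upper2) auto
  qed (use Q plus_upper1 in auto)
  then have "filt G Q r \<subseteq> (act mm ^^ r) UNIV + Q" .
  also have "\<dots> \<subseteq> Q" using r Q by (intro plus_least) auto
  finally have "filt G Q n = Q" if "n \<ge> r" for n
    using filt_antimono[OF Q(1) that] filt_upper by blast
  then show ?thesis by (rule that)
qed

end

section \<open>Hilbert coefficients\<close>

text \<open>Pascal's rule termwise: the difference of a combination of degree \<open>d + 1\<close>
  has degree \<open>d\<close> and the same coefficients. It serves both the return from a cut and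
  the uniqueness of Hilbert coefficients.\<close>

lemma binomial_combination_Suc:
  fixes c :: "nat \<Rightarrow> int"
  shows "(\<Sum>i\<le>d. c i * int ((Suc n + Suc d - i) choose (Suc d - i))) =
    (\<Sum>i\<le>d. c i * int ((n + Suc d - i) choose (Suc d - i))) +
    (\<Sum>i\<le>d. c i * int ((Suc n + d - i) choose (d - i)))"
proof -
  have "int ((Suc n + Suc d - i) choose (Suc d - i)) =
      int ((n + Suc d - i) choose (Suc d - i)) + int ((Suc n + d - i) choose (d - i))" if "i \<le> d" for i
  proof -
    have "Suc n + Suc d - i = Suc (Suc n + d - i)" "Suc d - i = Suc (d - i)"
      "n + Suc d - i = Suc n + d - i" using that by auto
    then show ?thesis by (simp only: binomial_Suc_Suc of_nat_add add.commute)
  qed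
  then show ?thesis unfolding sum.distrib[symmetric]
    by (intro sum.cong) (simp_all add: algebra_simps)
qed

context local_scalar_module
begin

lemma filt_proper_above: "subspace Q \<Longrightarrow> K \<subseteq> Q \<Longrightarrow> K \<subseteq> filt G Q n"
  using filt_upper by blast

text \<open>With \<open>E = filt G Q\<close>, multiplication by \<open>x\<close> from
  \<open>F/E n\<close> to \<open>F/E (n + 1)\<close> has kernel \<open>colon (E (n + 1)) x\<close>
  modulo \<open>E n\<close>, and its cokernel is the quotient by \<open>cut (E (n + 1)) x\<close>;
  the lengths along this exact sequence alternate to zero.\<close>

lemma hilbert_recursion:
  assumes Q: "subspace Q" "K \<subseteq> Q" and x: "\<And>n f. f \<in> filt G Q n \<Longrightarrow> x *s f \<in> filt G Q (Suc n)"
  shows "len (filt G Q (Suc n)) UNIV + len (filt G Q n) (colon (filt G Q (Suc n)) x) =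
    len (filt G Q n) UNIV + len (cut (filt G Q (Suc n)) x) UNIV"
proof -
  let ?E = "filt G Q"
  have sub: "subspace (?E k)" "finite_length (?E k) UNIV" for k
    using Q finite_length_filt by auto
  have le: "?E n \<subseteq> colon (?E (Suc n)) x" using x by (auto simp: colon_def)
  have "len (?E (Suc n)) UNIV = len (?E (Suc n)) (cut (?E (Suc n)) x) + len (cut (?E (Suc n)) x) UNIV"
    by (intro len_add sub subspace_cut cut_upper) auto
  moreover have "len (?E n) UNIV = len (?E n) (colon (?E (Suc n)) x) + len (colon (?E (Suc n)) x) UNIV"
    by (intro len_add sub subspace_colon le) auto
  ultimately show ?thesis using len_colon[OF sub(1)] by simp
qed

definition hilbert_form :: "nat \<Rightarrow> 'f set \<Rightarrow> (nat \<Rightarrow> int) \<Rightarrow> bool" where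
  "hilbert_form d Q e \<longleftrightarrow> (\<forall>\<^sub>F n in sequentially. int (len (filt G Q (Suc n)) UNIV) =
     (\<Sum>i\<le>d. (- 1) ^ i * e i * int ((n + d - i) choose (d - i))))"

text \<open>Summing the polynomial of \<open>cut Q x\<close> keeps its coefficients, and the
  constant of summation becomes the new last one.\<close>

lemma hilbert_form_step:
  assumes Q: "subspace Q" "K \<subseteq> Q" and x: "\<And>n f. f \<in> filt G Q n \<Longrightarrow> x *s f \<in> filt G Q (Suc n)"
    and col: "\<And>n. n \<ge> n1 \<Longrightarrow> colon (filt G Q (Suc n)) x = filt G Q n"
    and e: "hilbert_form d (cut Q x) e"
  shows "\<exists>c. hilbert_form (Suc d) Q (e(Suc d := c))"
proof -
  let ?l = "\<lambda>n. int (len (filt G Q n) UNIV)"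
  let ?l' = "\<lambda>n. int (len (filt G (cut Q x) n) UNIV)"
  obtain n2 where n2: "\<And>n. n \<ge> n2 \<Longrightarrow> ?l' (Suc n) = (\<Sum>i\<le>d. (- 1) ^ i * e i * int ((n + d - i) choose (d - i)))"
    using e unfolding hilbert_form_def eventually_sequentially by blast
  have diff: "?l (Suc n) = ?l n + ?l' (Suc n)" if "n \<ge> n1" for n
    using hilbert_recursion[OF Q x, of n] col[OF that] Q by (simp add: filt_cut)
  define g where "g n = (\<Sum>i\<le>d. (- 1) ^ i * e i * int ((n + Suc d - i) choose (Suc d - i)))" for n
  have g_Suc: "g (Suc n) = g n + (\<Sum>i\<le>d. (- 1) ^ i * e i * int ((Suc n + d - i) choose (d - i)))" for n
    unfolding g_def by (rule binomial_combination_Suc)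
  define N where "N = max n1 n2"
  have const: "?l (Suc n) - g n = ?l (Suc N) - g N" if "n \<ge> N" for n
    using that
  proof (induction n rule: dec_induct)
    case (step n)
    have "?l (Suc (Suc n)) = ?l (Suc n) + ?l' (Suc (Suc n))" using step by (intro diff) (simp add: N_def)
    moreover have "?l' (Suc (Suc n)) = (\<Sum>i\<le>d. (- 1) ^ i * e i * int ((Suc n + d - i) choose (d - i)))"
      using step by (intro n2) (simp add: N_def)
    ultimately show ?case using step g_Suc[of n] by simp
  qed simp
  define c where "c = (- 1) ^ Suc d * (?l (Suc N) - g N)"
  have "?l (Suc n) = (\<Sum>i\<le>Suc d. (- 1) ^ i * (e(Suc d := c)) i * int ((n + Suc d - i) choose (Suc d - i)))"
    if "n \<ge> N" for n
  proof -
    have "(- 1) ^ Suc d * c = ?l (Suc N) - g N"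
      unfolding c_def mult.assoc[symmetric] power_mult_distrib[symmetric] by simp
    moreover have "(\<Sum>i\<le>d. (- 1) ^ i * (e(Suc d := c)) i * int ((n + Suc d - i) choose (Suc d - i))) = g n"
      unfolding g_def by (intro sum.cong) auto
    ultimately show ?thesis using const[OF that] by (simp add: sum.atMost_Suc)
  qed
  then show ?thesis unfolding hilbert_form_def eventually_sequentially by blast
qed

subsection \<open>Dimension one\<close>

context
  fixes b :: nat
  assumes b: "b > 0" and act_b: "act G UNIV \<subseteq> (act mm ^^ b) UNIV + K"
begin

context
  fixes Q y k0
  assumes Q: "subspace Q" "K \<subseteq> Q" "Q \<noteq> UNIV"
    and y_filt: "\<And>n f. f \<in> filt G Q n \<Longrightarrow> y *s f \<in> filt G Q (Suc n)"
    and y_reg: "regular Q y"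
    and reduction: "filt G Q (Suc k0) \<subseteq> scale y ` filt G Q k0 + Q"
begin

private abbreviation "E \<equiv> filt G Q"

private definition "stabilized n \<longleftrightarrow> E (Suc n) \<subseteq> scale y ` E n + Q"

private definition "s = (LEAST n. stabilized n)"

text \<open>The quotient of \<open>E k\<close> by this is the component of degree \<open>k\<close>
  of the fiber cone.\<close>

private definition "W k = act mm (E k) + Q"

private lemma subE: "subspace (E n)" "K \<subseteq> E n"
  using Q filt_proper_above by auto

private lemma subW: "subspace (W k)" "Q \<subseteq> W k"
  unfolding W_def using Q(1) by (auto intro: subspace_plus plus_upper2[THEN subsetD])

private lemma y_power_filt: "f \<in> E n \<Longrightarrow> y ^ k *s f \<in> E (n + k)"
proof (induction k)
  case (Suc k)
  then have "y *s y ^ k *s f \<in> E (Suc (n + k))" by (intro y_filt)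
  then show ?case by simp
qed simp

private lemma stabilized_Suc: "stabilized n \<Longrightarrow> stabilized (Suc n)"
proof -
  assume *: "stabilized n"
  have sub: "subspace (scale y ` E n)" using subE by (intro subspace_image_scale)
  have sub': "subspace (scale y ` E (Suc n) + Q)" using subE Q by (intro subspace_plus subspace_image_scale)
  have "act G (E (Suc n)) \<subseteq> act G (scale y ` E n + Q)" using * by (intro act_mono) (auto simp: stabilized_def)
  also have "\<dots> = scale y ` act G (E n) + act G Q" by (simp add: act_plus[OF sub Q(1)] act_image_scale)
  also have "\<dots> \<subseteq> scale y ` E (Suc n) + Q"
    using act_filt_le[OF Q(1)] act_le[OF Q(1)] by (intro set_plus_mono2 image_mono) auto
  finally show ?thesis unfolding stabilized_def filt.simps(2)[of _ _ "Suc n"]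
    using subE by (intro plus_least sub' plus_upper2 subspace_image_scale) auto
qed

private lemma stabilized_s: "stabilized s"
  unfolding s_def using reduction by (intro LeastI[of stabilized k0]) (simp add: stabilized_def)

private lemma stabilized_above: "s \<le> n \<Longrightarrow> stabilized n"
  by (induction n rule: dec_induct) (auto intro: stabilized_s stabilized_Suc)

private lemma not_stab_below: "n < s \<Longrightarrow> \<not> stabilized n"
  unfolding s_def by (rule not_less_Least)

private lemma filt_above_s: "E (s + j) \<subseteq> scale (y ^ j) ` E s + Q"
proof (induction j)
  case 0 then show ?case using plus_upper1[OF Q(1)] by simp
next
  case (Suc j)
  have "E (Suc (s + j)) \<subseteq> scale y ` E (s + j) + Q" using stabilized_above[of "s + j"] by (simp add: stabilized_def)
  also have "\<dots> \<subseteq> scale y ` (scale (y ^ j) ` E s + Q) + Q"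
    using Suc by (intro set_plus_mono2 image_mono) auto
  also have "\<dots> \<subseteq> scale (y ^ Suc j) ` E s + Q"
  proof -
    have "scale y ` (scale (y ^ j) ` E s + Q) = scale (y ^ Suc j) ` E s + scale y ` Q"
      by (simp add: image_scale_plus image_image)
    moreover have "scale y ` Q + Q \<subseteq> Q" by (intro plus_least Q image_scale_le order_refl)
    ultimately show ?thesis by (simp only: add.assoc) (intro set_plus_mono2 order_refl)
  qed
  finally show ?case by simp
qed

private lemma filt_not_le: "\<not> E n \<subseteq> Q"
proof
  assume "E n \<subseteq> Q"
  then have "y ^ n *s f \<in> Q" for f using y_power_filt[of f 0 n] by auto
  then have "f \<in> Q" for f by (rule regularD[OF regular_power[OF y_reg]])
  then show False using Q(3) by blast
qed

private lemma act_W_le: "act G (W k) \<subseteq> W (Suc k)"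
proof -
  have "act G (act mm (E k)) \<subseteq> act mm (E (Suc k))"
    unfolding act_commute[of G] using act_filt_le[OF Q(1)] by (intro act_mono) auto
  then show ?thesis unfolding W_def act_plus[OF subspace_act Q(1)]
    using act_le[OF Q(1)] by (intro set_plus_mono2) auto
qed

private lemma y_power_W: "scale (y ^ j) ` W k \<subseteq> W (k + j)"
proof -
  have "scale (y ^ j) ` act mm (E k) = act mm (scale (y ^ j) ` E k)" by (simp add: act_image_scale)
  also have "\<dots> \<subseteq> act mm (E (k + j))" using y_power_filt by (intro act_mono) auto
  finally show ?thesis unfolding W_def image_scale_plus
    using image_scale_le[OF Q(1)] by (intro set_plus_mono2) auto
qed

text \<open>If \<open>yE i\<close> and \<open>E (i + 1)\<close> agreed modulo \<open>mm\<close> in degree \<open>n\<close>, then so they would in all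
  higher degrees, and Nakayama's lemma in a large degree would give \<open>E s = yE (s - 1)\<close>.\<close>

private lemma chain_strict:
  assumes "i + r < s" shows "\<not> scale (y ^ r) ` E (Suc i) \<subseteq> scale (y ^ Suc r) ` E i + W (Suc (i + r))"
proof
  assume le: "scale (y ^ r) ` E (Suc i) \<subseteq> scale (y ^ Suc r) ` E i + W (Suc (i + r))"
  have sub: "subspace (scale (y ^ a) ` E c + W k)" for a c k
    using subE subW by (intro subspace_plus subspace_image_scale)
  \<comment> \<open>Multiplication by \<open>G\<close> carries the inclusion into all higher
    degrees; the surplus factor \<open>y ^ r\<close> stays.\<close>
  have A: "scale (y ^ r) ` E (Suc (i + j)) \<subseteq> scale (y ^ Suc r) ` E (i + j) + W (Suc (i + j + r))" for j
  proof (induction j)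
    case 0 then show ?case using le by simp
  next
    case (Suc j)
    let ?R = "scale (y ^ Suc r) ` E (i + Suc j) + W (Suc (i + Suc j + r))"
    have "scale (y ^ r) ` E (Suc (i + Suc j)) = act G (scale (y ^ r) ` E (Suc (i + j))) + scale (y ^ r) ` Q"
      by (simp add: filt.simps(2)[of _ _ "Suc (i + j)"] image_scale_plus act_image_scale)
    moreover have "act G (scale (y ^ r) ` E (Suc (i + j))) \<subseteq> ?R"
    proof -
      have "act G (scale (y ^ r) ` E (Suc (i + j))) \<subseteq>
          act G (scale (y ^ Suc r) ` E (i + j) + W (Suc (i + j + r)))"
        using Suc by (intro act_mono) auto
      also have "\<dots> = scale (y ^ Suc r) ` act G (E (i + j)) + act G (W (Suc (i + j + r)))"
        using subE subW by (simp add: act_plus subspace_image_scale act_image_scale del: power_Suc)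
      also have "\<dots> \<subseteq> ?R"
        using act_filt_le[OF Q(1), of G "i + j"] act_W_le[of "Suc (i + j + r)"]
        by (intro set_plus_mono2 image_mono) auto
      finally show ?thesis .
    qed
    moreover have "scale (y ^ r) ` Q \<subseteq> ?R"
    proof -
      have "scale (y ^ r) ` Q \<subseteq> W (Suc (i + Suc j + r))"
        using image_scale_le[OF Q(1)] subW(2) by blast
      also have "\<dots> \<subseteq> ?R" by (intro plus_upper2 subspace_image_scale subE)
      finally show ?thesis .
    qed
    ultimately show ?case using plus_least[OF sub] by metis
  qed
  \<comment> \<open>Because \<open>s\<close> is the reduction number, \<open>E D\<close> lies in
    \<open>y ^ r E s + Q\<close>. This degree is large enough to compare the inclusions below with
    all of \<open>E D\<close>.\<close>
  define D where "D = s + r"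
  \<comment> \<open>Telescoping: the factors \<open>y\<close> are pulled out one at a time, down to
    \<open>E i\<close>; the power \<open>y ^ q\<close> brings each inclusion \<open>A\<close> into
    degree \<open>D\<close>.\<close>
  have B: "i + j \<le> s \<Longrightarrow> scale (y ^ (D - (i + j))) ` E (i + j) \<subseteq> scale (y ^ (D - i)) ` E i + W D" for j
  proof (induction j)
    case 0 then show ?case using plus_upper1[OF subW(1)] by simp
  next
    case (Suc j)
    define q where "q = s - Suc (i + j)"
    have D1: "D - (i + Suc j) = q + r" and D2: "D - (i + j) = q + Suc r" and D3: "Suc (i + j + r) + q = D"
      using Suc.prems by (auto simp: q_def D_def)
    have "scale (y ^ (D - (i + Suc j))) ` E (i + Suc j) = scale (y ^ q) ` scale (y ^ r) ` E (Suc (i + j))"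
      unfolding D1 image_scale_scale by (simp add: power_add)
    also have "\<dots> \<subseteq> scale (y ^ q) ` (scale (y ^ Suc r) ` E (i + j) + W (Suc (i + j + r)))"
      by (intro image_mono A)
    also have "\<dots> = scale (y ^ (D - (i + j))) ` E (i + j) + scale (y ^ q) ` W (Suc (i + j + r))"
      unfolding D2 image_scale_plus image_scale_scale power_add ..
    also have "\<dots> \<subseteq> scale (y ^ (D - i)) ` E i + W D"
    proof (intro plus_least sub)
      show "scale (y ^ (D - (i + j))) ` E (i + j) \<subseteq> scale (y ^ (D - i)) ` E i + W D"
        using Suc by simp
      have "scale (y ^ q) ` W (Suc (i + j + r)) \<subseteq> W D"
        using y_power_W[of q "Suc (i + j + r)"] unfolding D3 .
      also have "\<dots> \<subseteq> scale (y ^ (D - i)) ` E i + W D"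
        by (intro plus_upper2 subspace_image_scale subE)
      finally show "scale (y ^ q) ` W (Suc (i + j + r)) \<subseteq> scale (y ^ (D - i)) ` E i + W D" .
    qed
    finally show ?case .
  qed
  have "scale (y ^ r) ` E s \<subseteq> scale (y ^ (D - i)) ` E i + W D"
    using B[of "s - i"] assms by (simp add: D_def)
  moreover have "E D \<subseteq> scale (y ^ r) ` E s + Q" unfolding D_def by (rule filt_above_s)
  moreover have "Q \<subseteq> scale (y ^ (D - i)) ` E i + W D"
    using subW(2) plus_upper2[of "scale (y ^ (D - i)) ` E i" "W D"] subE subspace_image_scale by blast
  ultimately have "E D \<subseteq> scale (y ^ (D - i)) ` E i + W D" using plus_least[OF sub] by (meson subset_trans)
  then have "E D \<subseteq> (scale (y ^ (D - i)) ` E i + Q) + act mm (E D)"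
    by (simp add: W_def ac_simps)
  moreover have "subspace (scale (y ^ (D - i)) ` E i + Q)" using subE Q by (intro subspace_plus subspace_image_scale)
  moreover have "K \<subseteq> scale (y ^ (D - i)) ` E i + Q"
    using Q(2) plus_upper2[of "scale (y ^ (D - i)) ` E i" Q] subE subspace_image_scale by blast
  ultimately have ED: "E D \<subseteq> scale (y ^ (D - i)) ` E i + Q" using nakayama subE by blast
  \<comment> \<open>Here \<open>D - i = r + (s - i)\<close>, so regularity cancels
    \<open>y ^ r\<close>, and a factor \<open>y\<close> is left because
    \<open>i < s\<close>.\<close>
  have "E s \<subseteq> scale y ` E (s - 1) + Q"
  proof
    fix f assume "f \<in> E s"
    then have "y ^ r *s f \<in> E D" unfolding D_def by (rule y_power_filt)
    then obtain g q where g: "y ^ r *s f = y ^ (D - i) *s g + q" "g \<in> E i" "q \<in> Q"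
      using ED by (auto elim!: set_plus_elim)
    have "D - i = r + (s - i)" using assms by (simp add: D_def)
    then have "y ^ r *s (f - y ^ (s - i) *s g) = q"
      using g(1) by (simp add: scale_right_diff_distrib power_add)
    then have "y ^ r *s (f - y ^ (s - i) *s g) \<in> Q" using g(3) by simp
    then have fQ: "f - y ^ (s - i) *s g \<in> Q" by (rule regularD[OF regular_power[OF y_reg]])
    have "s - i = Suc (s - 1 - i)" using assms by simp
    then have "y ^ (s - i) *s g = y *s y ^ (s - 1 - i) *s g" by simp
    moreover have "y ^ (s - 1 - i) *s g \<in> E (s - 1)"
      using y_power_filt[OF g(2), of "s - 1 - i"] assms by simp
    ultimately have "y ^ (s - i) *s g + (f - y ^ (s - i) *s g) \<in> scale y ` E (s - 1) + Q"
      using fQ by (metis imageI set_plus_intro)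
    then show "f \<in> scale y ` E (s - 1) + Q" by simp
  qed
  then have "stabilized (s - 1)" using assms by (simp add: stabilized_def)
  then show False using not_stab_below[of "s - 1"] assms by simp
qed

text \<open>Otherwise multiplying by \<open>s\<close> generators carries the inclusion into degree
  \<open>n + s\<close>, where \<open>y ^ n E s\<close> is everything modulo \<open>Q\<close>.
  Nakayama's lemma would then make \<open>E (s + n)\<close> vanish modulo \<open>Q\<close>, against
  regularity of \<open>y\<close>.\<close>

private lemma chain_bottom: "\<not> range (scale (y ^ n)) \<subseteq> W n"
proof
  assume le: "range (scale (y ^ n)) \<subseteq> W n"
  have "scale (y ^ n) ` E p \<subseteq> W (n + p)" for p
  proof (induction p)
    case 0 then show ?case using le by simp
  next
    case (Suc p)
    have "scale (y ^ n) ` E (Suc p) = act G (scale (y ^ n) ` E p) + scale (y ^ n) ` Q"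
      by (simp add: filt.simps(2) image_scale_plus act_image_scale)
    moreover have "act G (scale (y ^ n) ` E p) \<subseteq> W (n + Suc p)"
      using act_mono[OF order_refl Suc, of G] act_W_le[of "n + p"] by simp
    moreover have "scale (y ^ n) ` Q \<subseteq> W (n + Suc p)"
      using image_scale_le[OF Q(1)] subW(2) by blast
    ultimately show ?case by (metis plus_least[OF subW(1)])
  qed
  then have "scale (y ^ n) ` E s + Q \<subseteq> W (n + s)" by (intro plus_least subW)
  then have "E (s + n) \<subseteq> W (s + n)" using filt_above_s[of n] by (simp add: add.commute)
  then have "E (s + n) \<subseteq> Q + act mm (E (s + n))" by (simp add: W_def add.commute)
  then have "E (s + n) \<subseteq> Q" using nakayama[OF Q(1,2) subE(1)] by blast
  then show False using filt_not_le by blast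
qed

text \<open>The powers of \<open>mm\<close> applied to \<open>E n\<close>, read modulo
  \<open>Q\<close>; in particular \<open>M n 1\<close> is \<open>W n\<close>.\<close>

private primrec M :: "nat \<Rightarrow> nat \<Rightarrow> 'f set" where
  "M n 0 = E n"
| "M n (Suc j) = act mm (M n j) + Q"

private lemma subM: "subspace (M n j)" "Q \<subseteq> M n j"
  using filt_upper Q(1) by (cases j; auto intro: subE subspace_plus plus_upper2[THEN subsetD])+

private lemma act_M: "act G (M n j) \<subseteq> M (Suc n) j"
proof (induction j)
  case (Suc j)
  have "act G (act mm (M n j)) \<subseteq> act mm (M (Suc n) j)"
    unfolding act_commute[of G] using Suc by (intro act_mono) auto
  then show ?case unfolding M.simps act_plus[OF subspace_act Q(1)]
    using act_le[OF Q(1)] by (intro set_plus_mono2) auto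
qed (simp add: act_filt_le Q)

text \<open>The hypothesis relating \<open>G\<close> to the power of \<open>mm\<close> is the case
  of degree zero; multiplication by generators gives the others.\<close>

private lemma filt_Suc_le_M: "E (Suc n) \<subseteq> M n b"
proof -
  have "act G (E n) \<subseteq> M n b"
  proof (induction n)
    case 0
    have "(act mm ^^ j) UNIV \<subseteq> M 0 j" for j
    proof (induction j)
      case (Suc j)
      have "(act mm ^^ Suc j) UNIV \<subseteq> act mm (M 0 j)" using Suc by (simp add: act_mono)
      then show ?case using plus_upper1[OF Q(1)] by auto
    qed simp
    then show ?case using act_b plus_least[OF subM(1), of "(act mm ^^ b) UNIV" 0 b K] subM(2) Q(2)
      by (simp del: M.simps) blast
  next
    case (Suc n)
    have "act G (E (Suc n)) = act G (act G (E n)) + act G Q"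
      by (simp add: filt.simps(2) act_plus[OF subspace_act Q(1)])
    moreover have "act G (act G (E n)) \<subseteq> M (Suc n) b"
      using act_mono[OF order_refl Suc, of G] act_M by blast
    moreover have "act G Q \<subseteq> M (Suc n) b" using act_le[OF Q(1)] subM(2) by blast
    ultimately show ?case using plus_least[OF subM(1)] by metis
  qed
  then show ?thesis unfolding filt.simps by (intro plus_least subM)
qed

text \<open>Equality would put \<open>M n j\<close> inside \<open>Q\<close> by Nakayama, yet it
  contains \<open>E (n + j)\<close>, which is nonzero modulo \<open>Q\<close> because
  \<open>y\<close> is regular.\<close>

private lemma M_strict: "M n (Suc j) \<subset> M n j"
proof
  show "M n (Suc j) \<subseteq> M n j" unfolding M.simps by (intro plus_least act_le subM)
  have E_le: "E (n + k) \<subseteq> M n k" for k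
  proof (induction k)
    case (Suc k)
    have "act G (E (n + k)) \<subseteq> act mm (M n k)" using Suc gs_mm by (intro act_mono)
    then have "act G (E (n + k)) + Q \<subseteq> act mm (M n k) + Q" by (rule set_plus_mono2) simp
    then show ?case by (simp add: filt.simps(2))
  qed simp
  show "M n (Suc j) \<noteq> M n j"
  proof
    assume "M n (Suc j) = M n j"
    then have "M n j \<subseteq> Q + act mm (M n j)" by (simp add: add.commute)
    then have "M n j \<subseteq> Q" using nakayama[OF Q(1,2) subM(1)] by blast
    then show False using E_le[of j] filt_not_le[of "n + j"] by blast
  qed
qed

private lemma length_ge: assumes "n \<le> s" shows "n + b \<le> len (E (Suc n)) (E n)"
proof -
  define C where "C i = scale (y ^ (n - i)) ` E i + W n" for i
  have subC: "subspace (C i)" for i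
    unfolding C_def using subE subW by (intro subspace_plus subspace_image_scale)
  have W_C: "W n \<subseteq> C i" for i unfolding C_def using subE by (intro plus_upper2 subspace_image_scale)
  have strict: "C i \<subset> C (Suc i)" if "i < n" for i
  proof
    define k where "k = n - Suc i"
    have k: "n - i = Suc k" "n - Suc i = k" "Suc (i + k) = n" using that by (auto simp: k_def)
    have "scale (y ^ Suc k) ` E i \<subseteq> scale (y ^ k) ` E (Suc i)"
    proof
      fix u assume "u \<in> scale (y ^ Suc k) ` E i"
      then obtain f where f: "f \<in> E i" "u = y ^ Suc k *s f" by blast
      then have "u = y ^ k *s y *s f" by (simp add: mult.commute)
      then show "u \<in> scale (y ^ k) ` E (Suc i)" using y_filt[OF f(1)] by blast
    qed
    then show "C i \<subseteq> C (Suc i)" unfolding C_def k by (intro set_plus_mono2) auto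
    have "i + k < s" using assms k(3) by simp
    then have "\<not> scale (y ^ k) ` E (Suc i) \<subseteq> C i"
      using chain_strict[of i k] unfolding C_def k by simp
    moreover have "scale (y ^ k) ` E (Suc i) \<subseteq> C (Suc i)"
      unfolding C_def k using subW by (intro plus_upper1)
    ultimately show "C i \<noteq> C (Suc i)" by blast
  qed
  have "i \<le> n \<Longrightarrow> has_chain i (C 0) (C i)" for i
  proof (induction i)
    case (Suc i)
    then show ?case using strict[of i] subC by auto
  qed simp
  then have "has_chain n (C 0) (C n)" by simp
  moreover have "C n \<subseteq> E n"
    unfolding C_def W_def using act_le[OF subE(1)] filt_upper by (intro plus_least subE) simp_all
  ultimately have top: "has_chain n (C 0) (E n)" by (rule has_chain_top)
  \<comment> \<open>The lower \<open>b\<close> steps are \<open>b - 1\<close> steps from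
    \<open>M n b\<close> to \<open>M n 1 = W n\<close>, and one from \<open>W n\<close> to
    \<open>C 0\<close>, which is strict by \<open>chain_bottom\<close>.\<close>
  obtain c where c: "b = Suc c" using b by (cases b) auto
  have "has_chain c (M n (Suc c)) (M n 1)"
  proof (induction c)
    case (Suc c)
    have "has_chain 1 (M n (Suc (Suc c))) (M n (Suc c))"
      using M_strict[of n "Suc c"] subM by (simp del: M.simps) blast
    from has_chain_trans[OF this Suc] show ?case by simp
  qed simp
  moreover have "M n 1 \<subset> C 0"
  proof -
    have "\<not> C 0 \<subseteq> W n"
      using chain_bottom[of n] plus_upper1[OF subW(1)[of n], of "scale (y ^ n) ` E 0"] unfolding C_def by auto
    moreover have "M n 1 = W n" by (simp add: W_def)
    ultimately show ?thesis using W_C[of 0] by blast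
  qed
  ultimately have "has_chain b (M n b) (C 0)"
    unfolding c has_chain.simps using subM(1) by blast
  from has_chain_trans[OF this top] have "has_chain (b + n) (M n b) (E n)" .
  then have "has_chain (b + n) (E (Suc n)) (E n)" by (rule has_chain_bot[OF filt_Suc_le_M])
  moreover have "finite_length (E (Suc n)) (E n)"
    using finite_length_filt[OF Q(1,2)] by (rule finite_length_sub) auto
  ultimately show ?thesis using has_chain_iff_len filt_Suc_le[OF Q(1)] by (simp add: add.commute)
qed

lemma dim_one_hilbert:
  "\<exists>e0 m v. e0 = int b + int m \<and> (\<forall>n. int (len (E (Suc n)) UNIV) = int (len (E n) UNIV) + e0 - int (v n)) \<and>
    (\<forall>n. v n \<le> m - n)"
proof -
  define e0 where "e0 = len (cut Q y) UNIV"
  \<comment> \<open>Written as a sum of lengths instead of a difference, so that it is visibly a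
    natural number: one term measures how far the cokernel is from \<open>F/(Q + yF)\<close>, the
    other is the kernel in \<open>hilbert_recursion\<close>.\<close>
  define v where "v n = len (cut Q y) (cut (E (Suc n)) y) + len (E n) (colon (E (Suc n)) y)" for n
  have cut_le: "cut Q y \<subseteq> cut (E n) y" for n unfolding cut_def using filt_upper by (intro set_plus_mono2) auto
  have subs: "subspace (cut Q y)" "subspace (cut (E n) y)" for n using Q subE subspace_cut by blast+
  have Kc: "K \<subseteq> cut Q y" using cut_upper[OF Q(1)] Q(2) by blast
  have E_le_cut: "E n \<subseteq> cut Q y" if n: "n > s" for n
  proof -
    obtain m where m: "n = Suc m" "s \<le> m" using n by (cases n) auto
    have "E n \<subseteq> scale y ` E m + Q" using stabilized_above[OF m(2)] m(1) by (simp add: stabilized_def)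
    also have "\<dots> \<subseteq> cut Q y" unfolding cut_def add.commute[of _ Q] by (intro set_plus_mono2) auto
    finally show ?thesis .
  qed
  have "finite_length (E (Suc s)) UNIV" by (rule finite_length_filt[OF Q(1,2)])
  then have fin: "finite_length (cut Q y) UNIV"
    by (rule finite_length_sub) (auto intro: E_le_cut[of "Suc s", THEN subsetD])
  have e0: "e0 = len (cut Q y) (cut (E n) y) + len (cut (E n) y) UNIV" for n
    unfolding e0_def by (intro len_add subs cut_le fin) auto
  have rec: "len (E (Suc n)) UNIV + v n = len (E n) UNIV + e0" for n
    using hilbert_recursion[OF Q(1,2) y_filt, of n] e0[of "Suc n"] by (simp add: v_def)
  have len_E: "len (E (Suc n)) UNIV = len (E (Suc n)) (E n) + len (E n) UNIV" for n
    by (intro len_add subE filt_Suc_le finite_length_filt Q) auto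
  have v_eq: "len (E (Suc n)) (E n) + v n = e0" for n using rec[of n] len_E[of n] by simp
  have v0: "v n = 0" if "s \<le> n" for n
  proof -
    have "cut (E (Suc n)) y \<subseteq> cut Q y"
      unfolding cut_def[of "E (Suc n)"] using E_le_cut[of "Suc n"] that scale_in_cut[OF Q(1)]
      by (intro plus_least subs) auto
    then have "cut (E (Suc n)) y = cut Q y" using cut_le by blast
    moreover have "colon (E (Suc n)) y = E n"
    proof
      show "E n \<subseteq> colon (E (Suc n)) y" using y_filt by (auto simp: colon_def)
      show "colon (E (Suc n)) y \<subseteq> E n"
      proof
        fix u assume "u \<in> colon (E (Suc n)) y"
        then have "y *s u \<in> scale y ` E n + Q"
          using stabilized_above[OF that] by (auto simp: colon_def stabilized_def)
        then obtain g q where g: "y *s u = y *s g + q" "g \<in> E n" "q \<in> Q" by (auto elim!: set_plus_elim)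
        then have "y *s (u - g) \<in> Q" by (simp add: scale_right_diff_distrib)
        then have "u - g \<in> Q" by (rule regularD[OF y_reg])
        then have "u - g \<in> E n" using filt_upper by blast
        then have "(u - g) + g \<in> E n" using g(2) subE subspace_add by blast
        then show "u \<in> E n" by simp
      qed
    qed
    ultimately show ?thesis unfolding v_def by simp
  qed
  have bound: "n + b + v n \<le> e0" if "n \<le> s" for n using length_ge[OF that] v_eq[of n] by simp
  have "v n \<le> e0 - b - n" for n
  proof (cases "n \<le> s")
    case True then show ?thesis using bound[OF True] by simp
  next
    case False then show ?thesis using v0[of n] by simp
  qed
  \<comment> \<open>The bound at \<open>n = 0\<close> gives \<open>b \<le> e0\<close>, so this
    difference is not truncated.\<close>
  moreover have "int e0 = int b + int (e0 - b)" using bound[of 0] by simp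
  moreover have "int (len (E (Suc n)) UNIV) = int (len (E n) UNIV) + int e0 - int (v n)" for n
    using rec[of n] by simp
  ultimately show ?thesis by blast
qed

end

lemma ex_dim_one_data:
  assumes Q: "subspace Q" "K \<subseteq> Q" and depth: "depth_ge 1 Q" and dim: "dim_le 1 Q"
  obtains m v where "\<And>n. int (len (filt G Q (Suc n)) UNIV) =
      int (len (filt G Q n) UNIV) + (int b + int m) - int (v n)" "\<And>n. v n \<le> m - n"
proof -
  obtain y n1 where y: "y \<in> mm" "regular Q y" "depth_ge 0 (cut Q y)"
    "\<And>n f. f \<in> filt G Q n \<Longrightarrow> y *s f \<in> filt G Q (Suc n)"
    "\<And>n. n \<ge> n1 \<Longrightarrow> colon (filt G Q (Suc n)) y = filt G Q n"
    using ex_superficial[OF Q, of 0] depth by (metis One_nat_def)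
  have "dim_le 0 (cut Q y)" using dim by (intro dim_le_cut[OF Q(1) y(2)]) simp
  moreover have "subspace (cut Q y)" "K \<subseteq> cut Q y"
    using Q subspace_cut cut_upper by blast+
  ultimately obtain r where r: "\<And>n. n \<ge> r \<Longrightarrow> filt G (cut Q y) n = cut Q y"
    using filt_eventually_eq by metis
  \<comment> \<open>Beyond \<open>r\<close> the powers vanish in the cut, so the power of degree
    \<open>k + 1\<close> lies in \<open>Q + yF\<close>; beyond \<open>n1\<close> the cofactor of
    \<open>y\<close> can be taken from the power of degree \<open>k\<close>.\<close>
  define k where "k = max n1 r"
  have "filt G Q (Suc k) \<subseteq> scale y ` filt G Q k + Q"
  proof
    fix f assume f: "f \<in> filt G Q (Suc k)"
    have "filt G Q (Suc k) \<subseteq> cut (filt G Q (Suc k)) y" using Q by (intro cut_upper) simp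
    also have "\<dots> = cut Q y" using r[of "Suc k"] by (simp add: filt_cut[OF Q(1)] k_def)
    finally obtain q g where g: "q \<in> Q" "f = q + y *s g" using f in_cut_iff by blast
    have "y *s g = f - q" using g by simp
    moreover have "q \<in> filt G Q (Suc k)" using g(1) filt_upper by blast
    ultimately have "y *s g \<in> filt G Q (Suc k)" using f subspace_diff[OF subspace_filt[OF Q(1)]] by simp
    then have "g \<in> filt G Q k" using y(5)[of k] by (auto simp: colon_def k_def)
    then show "f \<in> scale y ` filt G Q k + Q" using g by (simp add: add.commute[of q] set_plus_intro)
  qed
  from dim_one_hilbert[OF Q depth_ge_proper[OF Q(1) depth] y(4,2) this] show ?thesis using that by blast
qed

subsection \<open>The bound\<close>

text \<open>The right-hand side is six times the binomial coefficient of \<open>m + 1\<close> over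
  3; the factor avoids division of integers.\<close>

lemma cubic_sum: "6 * (\<Sum>i\<le>m. int i * (int m - int i)) = (int m + 1) * int m * (int m - 1)"
proof -
  have 1: "2 * (\<Sum>i\<le>m. int i) = int m * (int m + 1)" for m :: nat
    by (induction m) (auto simp: algebra_simps)
  have 2: "6 * (\<Sum>i\<le>m. int i * int i) = int m * (int m + 1) * (2 * int m + 1)" for m :: nat
    by (induction m) (auto simp: algebra_simps)
  have "(\<Sum>i\<le>m. int i * (int m - int i)) = int m * (\<Sum>i\<le>m. int i) - (\<Sum>i\<le>m. int i * int i)"
    by (simp add: algebra_simps sum_subtractf sum_distrib_left)
  then have "6 * (\<Sum>i\<le>m. int i * (int m - int i)) =
      3 * int m * (2 * (\<Sum>i\<le>m. int i)) - 6 * (\<Sum>i\<le>m. int i * int i)" by (simp add: algebra_simps)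
  also have "\<dots> = (int m + 1) * int m * (int m - 1)" unfolding 1 2 by (simp add: algebra_simps)
  finally show ?thesis .
qed

lemma dim_two_bound:
  assumes Q: "subspace Q" "K \<subseteq> Q" and depth: "depth_ge 2 Q" and dim: "dim_le 2 Q"
  shows "\<exists>e m. hilbert_form 2 Q e \<and> e 0 = int b + int m \<and> 6 * e 2 \<le> (int m + 1) * int m * (int m - 1)"
proof -
  let ?E = "filt G Q"
  obtain x n1 where x: "x \<in> mm" "regular Q x" "depth_ge 1 (cut Q x)"
    "\<And>n f. f \<in> ?E n \<Longrightarrow> x *s f \<in> ?E (Suc n)"
    "\<And>n. n \<ge> n1 \<Longrightarrow> colon (?E (Suc n)) x = ?E n"
    using ex_superficial[OF Q, of 1] depth by (metis Suc_1)
  have "dim_le 1 (cut Q x)" using dim by (intro dim_le_cut[OF Q(1) x(2)]) (simp add: numeral_2_eq_2)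
  moreover have "subspace (cut Q x)" "K \<subseteq> cut Q x"
    using Q subspace_cut cut_upper by blast+
  ultimately obtain m v where v: "\<And>n. int (len (filt G (cut Q x) (Suc n)) UNIV) =
      int (len (filt G (cut Q x) n) UNIV) + (int b + int m) - int (v n)" "\<And>n. v n \<le> m - n"
    using ex_dim_one_data x(3) by metis
  define e0 where "e0 = int b + int m"
  define k where "k n = int (len (?E n) (colon (?E (Suc n)) x))" for n
  define V where "V n = (\<Sum>i\<le>n. int (v i))" for n
  define V1 where "V1 n = (\<Sum>i\<le>n. int i * int (v i))" for n
  define k1 where "k1 n = (\<Sum>i\<le>n. k i)" for n
  have l1: "int (len (filt G (cut Q x) (Suc n)) UNIV) = int (Suc n) * e0 - V n" for n
  proof (induction n)
    case 0 then show ?case using v(1)[of 0] by (simp add: V_def e0_def)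
  next
    case (Suc n) then show ?case using v(1)[of "Suc n"] by (simp add: V_def e0_def algebra_simps)
  qed
  have rec: "int (len (?E (Suc n)) UNIV) = int (len (?E n) UNIV) + int (Suc n) * e0 - V n - k n" for n
  proof -
    have "int (len (?E (Suc n)) UNIV) + k n = int (len (?E n) UNIV) + int (len (filt G (cut Q x) (Suc n)) UNIV)"
      using hilbert_recursion[OF Q x(4), of n] by (simp add: k_def filt_cut[OF Q(1)])
    then show ?thesis unfolding l1 by simp
  qed
  \<comment> \<open>Summation by parts: the sum of \<open>V i\<close> over \<open>i \<le> n\<close>
    is \<open>(n + 1) V n - V1 n\<close>.\<close>
  have formula: "int (len (?E (Suc n)) UNIV) =
      e0 * int ((n + 2) choose 2) - int (Suc n) * V n + V1 n - k1 n" for n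
  proof (induction n)
    case 0 then show ?case using rec[of 0] by (simp add: V_def V1_def k1_def numeral_2_eq_2)
  next
    case (Suc n)
    have "(Suc n + 2) choose 2 = ((n + 2) choose 2) + (n + 2)" by (simp add: numeral_2_eq_2)
    then show ?case using Suc rec[of "Suc n"] by (simp add: V_def V1_def k1_def algebra_simps)
  qed
  \<comment> \<open>From here on \<open>v\<close> and \<open>k\<close> vanish, so the three sums are
    constant; their final values give \<open>e 1\<close> and \<open>e 2\<close>.\<close>
  define N where "N = max n1 (Suc m)"
  have k0: "k n = 0" if "n \<ge> n1" for n using x(5)[OF that] by (simp add: k_def)
  have v0: "v n = 0" if "n \<ge> m" for n using v(2)[of n] that by simp
  have const: "V n = V N \<and> V1 n = V1 N \<and> k1 n = k1 N" if "N \<le> n" for n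
    using that
  proof (induction n rule: dec_induct)
    case (step n)
    then show ?case using v0[of "Suc n"] k0[of "Suc n"] by (simp add: V_def V1_def k1_def N_def)
  qed simp
  define e where "e = (\<lambda>i::nat. if i = 0 then e0 else if i = 1 then V N else V1 N - k1 N)"
  have "hilbert_form 2 Q e"
    unfolding hilbert_form_def eventually_sequentially
  proof (intro exI[of _ N] allI impI)
    fix n assume "N \<le> n"
    have "(\<Sum>i\<le>(2::nat). (- 1) ^ i * e i * int ((n + 2 - i) choose (2 - i))) =
        e0 * int ((n + 2) choose 2) - V N * int (Suc n) + (V1 N - k1 N)"
      by (simp add: numeral_2_eq_2 e_def)
    then show "int (len (?E (Suc n)) UNIV) = (\<Sum>i\<le>(2::nat). (- 1) ^ i * e i * int ((n + 2 - i) choose (2 - i)))"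
      using formula[of n] const[OF \<open>N \<le> n\<close>] by (simp add: algebra_simps)
  qed
  moreover have "e 0 = int b + int m" by (simp add: e_def e0_def)
  moreover have "6 * e 2 \<le> (int m + 1) * int m * (int m - 1)"
  proof -
    have "k1 N \<ge> 0" unfolding k1_def k_def by (intro sum_nonneg) simp
    moreover have "V1 m = V1 N"
    proof -
      have "V1 n = V1 m" if "m \<le> n" for n
        using that by (induction n rule: dec_induct) (use v0 in \<open>auto simp: V1_def\<close>)
      from this[of N] show ?thesis by (simp add: N_def)
    qed
    moreover have "V1 m \<le> (\<Sum>i\<le>m. int i * (int m - int i))"
      unfolding V1_def
    proof (intro sum_mono mult_left_mono)
      fix i assume "i \<in> {..m}"
      then show "int (v i) \<le> int m - int i" using v(2)[of i] by simp
    qed simp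
    ultimately have "e 2 \<le> (\<Sum>i\<le>m. int i * (int m - int i))" by (simp add: e_def)
    then show ?thesis using cubic_sum[of m] by linarith
  qed
  ultimately show ?thesis by blast
qed

lemma second_coefficient_bound:
  assumes "subspace Q" "K \<subseteq> Q" "d \<ge> 2" "depth_ge d Q" "dim_le d Q"
  shows "\<exists>e m. hilbert_form d Q e \<and> e 0 = int b + int m \<and> 6 * e 2 \<le> (int m + 1) * int m * (int m - 1)"
  using assms(3,1,2,4,5)
proof (induction d arbitrary: Q rule: dec_induct)
  case base then show ?case by (rule dim_two_bound)
next
  case (step d)
  obtain x n1 where x: "x \<in> mm" "regular Q x" "depth_ge d (cut Q x)"
    "\<And>n f. f \<in> filt G Q n \<Longrightarrow> x *s f \<in> filt G Q (Suc n)"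
    "\<And>n. n \<ge> n1 \<Longrightarrow> colon (filt G Q (Suc n)) x = filt G Q n"
    using ex_superficial[OF step.prems(1-3)] by metis
  have "dim_le d (cut Q x)" by (rule dim_le_cut[OF step.prems(1) x(2) step.prems(4)])
  moreover have "subspace (cut Q x)" "K \<subseteq> cut Q x"
    using step.prems subspace_cut cut_upper by blast+
  ultimately obtain e m where e: "hilbert_form d (cut Q x) e" "e 0 = int b + int m"
    "6 * e 2 \<le> (int m + 1) * int m * (int m - 1)"
    using step.IH x(3) by blast
  obtain c where "hilbert_form (Suc d) Q (e(Suc d := c))"
    using hilbert_form_step[OF step.prems(1,2) x(4,5) e(1)] by blast
  \<comment> \<open>Only the entry \<open>d + 1\<close> is changed, and it is at least 3.\<close>
  moreover have "(e(Suc d := c)) 0 = e 0" "(e(Suc d := c)) 2 = e 2" using step.hyps(1) by simp_all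
  ultimately show ?case using e(2,3) by (metis (no_types))
qed

end

end

section \<open>Covering a module by a total one\<close>

text \<open>The family of all elements of all commutative rings with carrier in a given type is a
  type-class ring that projects onto each of these rings; the factor \<open>int\<close> keeps it nontrivial.\<close>

typedef ('a, 'r) ring_family = "{p :: int \<times> (('a, 'r) ring_scheme \<Rightarrow> 'a).
    \<forall>R. if cring R then snd p R \<in> carrier R else snd p R = undefined}"
proof
  show "(0, \<lambda>R. if cring R then \<zero>\<^bsub>R\<^esub> else undefined) \<in> {p :: int \<times> (('a, 'r) ring_scheme \<Rightarrow> 'a).
    \<forall>R. if cring R then snd p R \<in> carrier R else snd p R = undefined}"
    by (simp add: cring.cring_simprules)
qed

definition ring_at :: "('a, 'r) ring_scheme \<Rightarrow> ('a, 'r) ring_family \<Rightarrow> 'a"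
  where "ring_at R p = snd (Rep_ring_family p) R"

definition int_at :: "('a, 'r) ring_family \<Rightarrow> int"
  where "int_at p = fst (Rep_ring_family p)"

definition mk_ring_family :: "int \<Rightarrow> (('a, 'r) ring_scheme \<Rightarrow> 'a) \<Rightarrow> ('a, 'r) ring_family"
  where "mk_ring_family k h = Abs_ring_family (k, \<lambda>R. if cring R then h R else undefined)"

lemma ring_at_closed: "cring R \<Longrightarrow> ring_at R p \<in> carrier R"
  using Rep_ring_family[of p] by (auto simp: ring_at_def)

lemma mk_ring_family:
  fixes h :: "('a, 'r) ring_scheme \<Rightarrow> 'a"
  assumes "\<And>R. cring R \<Longrightarrow> h R \<in> carrier R"
  shows "int_at (mk_ring_family k h) = k" "cring R \<Longrightarrow> ring_at R (mk_ring_family k h) = h R"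
proof -
  have "(k, \<lambda>R. if cring R then h R else undefined) \<in> {p :: int \<times> (('a, 'r) ring_scheme \<Rightarrow> 'a).
    \<forall>R. if cring R then snd p R \<in> carrier R else snd p R = undefined}"
    using assms by simp
  then show "int_at (mk_ring_family k h) = k" "cring R \<Longrightarrow> ring_at R (mk_ring_family k h) = h R"
    by (simp_all add: int_at_def ring_at_def mk_ring_family_def Abs_ring_family_inverse)
qed

lemma ring_family_eqI:
  assumes "int_at p = int_at q" "\<And>R. cring R \<Longrightarrow> ring_at R p = ring_at R q"
  shows "p = q"
proof -
  have "snd (Rep_ring_family p) R = snd (Rep_ring_family q) R" for R
    using assms(2)[of R] Rep_ring_family[of p] Rep_ring_family[of q]
    by (cases "cring R") (auto simp: ring_at_def)
  then have "Rep_ring_family p = Rep_ring_family q"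
    using assms(1) by (simp add: int_at_def prod_eq_iff fun_eq_iff)
  then show ?thesis by (simp add: Rep_ring_family_inject)
qed

instantiation ring_family :: (type, type) comm_ring_1
begin

definition "0 = mk_ring_family 0 (\<lambda>R. \<zero>\<^bsub>R\<^esub>)"
definition "1 = mk_ring_family 1 (\<lambda>R. \<one>\<^bsub>R\<^esub>)"
definition "p + q = mk_ring_family (int_at p + int_at q) (\<lambda>R. ring_at R p \<oplus>\<^bsub>R\<^esub> ring_at R q)"
definition "p * q = mk_ring_family (int_at p * int_at q) (\<lambda>R. ring_at R p \<otimes>\<^bsub>R\<^esub> ring_at R q)"
definition "- p = mk_ring_family (- int_at p) (\<lambda>R. \<ominus>\<^bsub>R\<^esub> ring_at R p)"
definition "p - q = mk_ring_family (int_at p - int_at q) (\<lambda>R. ring_at R p \<ominus>\<^bsub>R\<^esub> ring_at R q)"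

lemma int_at_simps:
  "int_at (0 :: ('a, 'b) ring_family) = 0" "int_at (1 :: ('a, 'b) ring_family) = 1"
  "int_at (p + q) = int_at p + int_at q" "int_at (p * q) = int_at p * int_at q"
  "int_at (- p) = - int_at p" "int_at (p - q) = int_at p - int_at q" for p q :: "('a, 'b) ring_family"
  unfolding zero_ring_family_def one_ring_family_def plus_ring_family_def times_ring_family_def
    uminus_ring_family_def minus_ring_family_def
  by (simp_all add: mk_ring_family ring_at_closed cring.cring_simprules)

lemma ring_at_simps:
  fixes p q :: "('a, 'b) ring_family"
  assumes "cring R"
  shows "ring_at R (0 :: ('a, 'b) ring_family) = \<zero>\<^bsub>R\<^esub>" "ring_at R (1 :: ('a, 'b) ring_family) = \<one>\<^bsub>R\<^esub>"
  "ring_at R (p + q) = ring_at R p \<oplus>\<^bsub>R\<^esub> ring_at R q" "ring_at R (p * q) = ring_at R p \<otimes>\<^bsub>R\<^esub> ring_at R q"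
  "ring_at R (- p) = \<ominus>\<^bsub>R\<^esub> ring_at R p" "ring_at R (p - q) = ring_at R p \<ominus>\<^bsub>R\<^esub> ring_at R q"
  unfolding zero_ring_family_def one_ring_family_def plus_ring_family_def times_ring_family_def
    uminus_ring_family_def minus_ring_family_def
  using assms by (simp_all add: mk_ring_family ring_at_closed cring.cring_simprules)

instance
proof
  fix a b c :: "('a, 'b) ring_family"
  note simps = ring_at_simps int_at_simps ring_at_closed cring.cring_simprules
  show "a * b * c = a * (b * c)" by (rule ring_family_eqI) (simp_all add: simps)
  show "a * b = b * a" by (rule ring_family_eqI) (simp_all add: simps)
  show "1 * a = a" by (rule ring_family_eqI) (simp_all add: simps)
  show "a + b + c = a + (b + c)" by (rule ring_family_eqI) (simp_all add: simps)
  show "a + b = b + a" by (rule ring_family_eqI) (simp_all add: simps)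
  show "0 + a = a" by (rule ring_family_eqI) (simp_all add: simps)
  show "- a + a = 0" by (rule ring_family_eqI) (simp_all add: simps)
  show "a - b = a + - b" by (rule ring_family_eqI) (simp_all add: simps)
  show "(a + b) * c = a * c + b * c" by (rule ring_family_eqI) (simp_all add: simps algebra_simps)
  have "int_at (0 :: ('a, 'b) ring_family) \<noteq> int_at (1 :: ('a, 'b) ring_family)" by (simp add: int_at_simps)
  then show "(0 :: ('a, 'b) ring_family) \<noteq> 1" by metis
qed

end

lemma ring_at_surj:
  assumes "cring R" "x \<in> carrier R" shows "\<exists>p. ring_at R p = x"
proof -
  have "ring_at R (mk_ring_family 0 (\<lambda>R'. if R' = R then x else \<zero>\<^bsub>R'\<^esub>)) = x"
    using assms by (subst mk_ring_family(2)) (auto simp: cring.cring_simprules)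
  then show ?thesis by blast
qed

text \<open>Indexed by ring and module together, since a type cannot depend on the given
  \<open>A\<close> and \<open>M\<close>. The value \<open>undefined\<close> off the modules makes
  elements equal as soon as their components at all modules agree.\<close>

typedef ('a, 'r, 'b, 'm) module_family =
  "{h :: ('a, 'r) ring_scheme \<times> ('a, 'b, 'm) module_scheme \<Rightarrow> 'b.
    \<forall>R M. if module R M then h (R, M) \<in> carrier M else h (R, M) = undefined}"
proof
  show "(\<lambda>(R, M). if module R M then \<zero>\<^bsub>M\<^esub> else undefined)
    \<in> {h :: ('a, 'r) ring_scheme \<times> ('a, 'b, 'm) module_scheme \<Rightarrow> 'b.
    \<forall>R M. if module R M then h (R, M) \<in> carrier M else h (R, M) = undefined}"
    by (auto dest!: module.axioms(2) simp: abelian_group.axioms abelian_monoid.zero_closed)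
qed

definition module_at where "module_at R M p = Rep_module_family p (R, M)"

definition mk_module_family where
  "mk_module_family h = Abs_module_family (\<lambda>(R, M). if module R M then h R M else undefined)"

lemma module_at_closed: "module R M \<Longrightarrow> module_at R M p \<in> carrier M"
  using Rep_module_family[of p] by (auto simp: module_at_def)

lemma mk_module_family:
  assumes "\<And>R M. module R M \<Longrightarrow> h R M \<in> carrier M"
  shows "module R M \<Longrightarrow> module_at R M (mk_module_family h) = h R M"
  using assms by (simp add: module_at_def mk_module_family_def Abs_module_family_inverse)

lemma module_family_eqI:
  assumes "\<And>R M. module R M \<Longrightarrow> module_at R M p = module_at R M q"
  shows "p = q"
proof -
  have "Rep_module_family p (R, M) = Rep_module_family q (R, M)" for R M
    using assms[of R M] Rep_module_family[of p] Rep_module_family[of q]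
    by (cases "module R M") (auto simp: module_at_def)
  then have "Rep_module_family p = Rep_module_family q" by (simp add: fun_eq_iff)
  then show ?thesis by (simp add: Rep_module_family_inject)
qed

lemma module_abelian_simprules:
  assumes "module R M"
  shows "\<zero>\<^bsub>M\<^esub> \<in> carrier M" "x \<in> carrier M \<Longrightarrow> y \<in> carrier M \<Longrightarrow> x \<oplus>\<^bsub>M\<^esub> y \<in> carrier M"
    "x \<in> carrier M \<Longrightarrow> \<ominus>\<^bsub>M\<^esub> x \<in> carrier M" "x \<in> carrier M \<Longrightarrow> \<zero>\<^bsub>M\<^esub> \<oplus>\<^bsub>M\<^esub> x = x"
    "x \<in> carrier M \<Longrightarrow> y \<in> carrier M \<Longrightarrow> z \<in> carrier M \<Longrightarrow> x \<oplus>\<^bsub>M\<^esub> y \<oplus>\<^bsub>M\<^esub> z = x \<oplus>\<^bsub>M\<^esub> (y \<oplus>\<^bsub>M\<^esub> z)"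
    "x \<in> carrier M \<Longrightarrow> y \<in> carrier M \<Longrightarrow> x \<oplus>\<^bsub>M\<^esub> y = y \<oplus>\<^bsub>M\<^esub> x"
    "x \<in> carrier M \<Longrightarrow> \<ominus>\<^bsub>M\<^esub> x \<oplus>\<^bsub>M\<^esub> x = \<zero>\<^bsub>M\<^esub>"
    "x \<ominus>\<^bsub>M\<^esub> y = x \<oplus>\<^bsub>M\<^esub> (\<ominus>\<^bsub>M\<^esub> y)"
proof -
  interpret module R M by fact
  show "\<zero>\<^bsub>M\<^esub> \<in> carrier M" "x \<in> carrier M \<Longrightarrow> y \<in> carrier M \<Longrightarrow> x \<oplus>\<^bsub>M\<^esub> y \<in> carrier M"
    "x \<in> carrier M \<Longrightarrow> \<ominus>\<^bsub>M\<^esub> x \<in> carrier M" "x \<in> carrier M \<Longrightarrow> \<zero>\<^bsub>M\<^esub> \<oplus>\<^bsub>M\<^esub> x = x"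
    "x \<in> carrier M \<Longrightarrow> y \<in> carrier M \<Longrightarrow> z \<in> carrier M \<Longrightarrow> x \<oplus>\<^bsub>M\<^esub> y \<oplus>\<^bsub>M\<^esub> z = x \<oplus>\<^bsub>M\<^esub> (y \<oplus>\<^bsub>M\<^esub> z)"
    "x \<in> carrier M \<Longrightarrow> \<ominus>\<^bsub>M\<^esub> x \<oplus>\<^bsub>M\<^esub> x = \<zero>\<^bsub>M\<^esub>"
    by (simp_all add: M.a_assoc M.l_neg)
  show "x \<in> carrier M \<Longrightarrow> y \<in> carrier M \<Longrightarrow> x \<oplus>\<^bsub>M\<^esub> y = y \<oplus>\<^bsub>M\<^esub> x" by (rule M.a_comm)
  show "x \<ominus>\<^bsub>M\<^esub> y = x \<oplus>\<^bsub>M\<^esub> (\<ominus>\<^bsub>M\<^esub> y)" by (simp add: a_minus_def)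
qed

instantiation module_family :: (type, type, type, type) ab_group_add
begin

definition "0 = mk_module_family (\<lambda>R M. \<zero>\<^bsub>M\<^esub>)"
definition "p + q = mk_module_family (\<lambda>R M. module_at R M p \<oplus>\<^bsub>M\<^esub> module_at R M q)"
definition "- p = mk_module_family (\<lambda>R M. \<ominus>\<^bsub>M\<^esub> module_at R M p)"
definition "p - q = mk_module_family (\<lambda>R M. module_at R M p \<ominus>\<^bsub>M\<^esub> module_at R M q)"

lemma module_at_simps:
  fixes p q :: "('a, 'b, 'c, 'd) module_family"
  assumes "module R M"
  shows "module_at R M (0 :: ('a, 'b, 'c, 'd) module_family) = \<zero>\<^bsub>M\<^esub>"
  "module_at R M (p + q) = module_at R M p \<oplus>\<^bsub>M\<^esub> module_at R M q"
  "module_at R M (- p) = \<ominus>\<^bsub>M\<^esub> module_at R M p"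
  "module_at R M (p - q) = module_at R M p \<ominus>\<^bsub>M\<^esub> module_at R M q"
  unfolding zero_module_family_def plus_module_family_def uminus_module_family_def minus_module_family_def
  using assms by (simp_all add: mk_module_family module_at_closed module_abelian_simprules)

instance
proof
  fix a b c :: "('a, 'b, 'c, 'd) module_family"
  note simps = module_at_simps module_at_closed
  show "a + b + c = a + (b + c)"
    by (rule module_family_eqI) (simp add: simps module_abelian_simprules(5))
  show "a + b = b + a" by (rule module_family_eqI) (simp add: simps module_abelian_simprules(6))
  show "0 + a = a" by (rule module_family_eqI) (simp add: simps module_abelian_simprules(4))
  show "- a + a = 0" by (rule module_family_eqI) (simp add: simps module_abelian_simprules(7))
  show "a - b = a + - b" by (rule module_family_eqI) (simp add: simps module_abelian_simprules(8))
qed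

end

lemma module_at_surj:
  assumes "module R M" "x \<in> carrier M" shows "\<exists>p. module_at R M p = x"
proof -
  have "module_at R M (mk_module_family (\<lambda>R' M'. if R' = R \<and> M' = M then x else \<zero>\<^bsub>M'\<^esub>)) = x"
    using assms by (subst mk_module_family) (auto simp: module_abelian_simprules)
  then show ?thesis by blast
qed

definition family_scale :: "('a, 'r) ring_family \<Rightarrow> ('a, 'r, 'b, 'm) module_family \<Rightarrow> ('a, 'r, 'b, 'm) module_family"
  where "family_scale s p = mk_module_family (\<lambda>R M. ring_at R s \<odot>\<^bsub>M\<^esub> module_at R M p)"

lemma module_at_scale:
  "module R M \<Longrightarrow> module_at R M (family_scale s p) = ring_at R s \<odot>\<^bsub>M\<^esub> module_at R M p"
  unfolding family_scale_def
  by (rule mk_module_family) (simp_all add: module.smult_closed module_at_closed ring_at_closed module.axioms(1))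

lemma scalar_module_family:
  "scalar_module (family_scale :: ('a, 'r) ring_family \<Rightarrow> ('a, 'r, 'b, 'm) module_family \<Rightarrow> _)"
proof (unfold scalar_module_def, unfold_locales)
  fix a b :: "('a, 'r) ring_family" and x y :: "('a, 'r, 'b, 'm) module_family"
  note simps = module_at_simps module_at_scale module_at_closed ring_at_closed ring_at_simps module.axioms(1)
  show "family_scale a (x + y) = family_scale a x + family_scale a y"
    by (rule module_family_eqI) (simp add: simps module.smult_r_distr)
  show "family_scale (a + b) x = family_scale a x + family_scale b x"
    by (rule module_family_eqI) (simp add: simps module.smult_l_distr)
  show "family_scale a (family_scale b x) = family_scale (a * b) x"
    by (rule module_family_eqI) (simp add: simps module.smult_assoc1)
  show "family_scale 1 x = x"
    by (rule module_family_eqI) (simp add: simps module.smult_one)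
qed

section \<open>Surjections from type-class rings and modules onto records\<close>

locale ring_cover =
  fixes A :: "('a, 'r) ring_scheme" and \<rho> :: "'s::comm_ring_1 \<Rightarrow> 'a"
  assumes cring_A: "cring A"
    and rho_closed [simp]: "\<rho> s \<in> carrier A"
    and rho_add: "\<rho> (s + t) = \<rho> s \<oplus>\<^bsub>A\<^esub> \<rho> t"
    and rho_mult: "\<rho> (s * t) = \<rho> s \<otimes>\<^bsub>A\<^esub> \<rho> t"
    and rho_one: "\<rho> 1 = \<one>\<^bsub>A\<^esub>"
    and rho_surj: "x \<in> carrier A \<Longrightarrow> \<exists>s. \<rho> s = x"
begin

sublocale A: cring A by (rule cring_A)

lemma rho_zero: "\<rho> 0 = \<zero>\<^bsub>A\<^esub>"
proof -
  have "\<rho> 0 \<oplus>\<^bsub>A\<^esub> \<rho> 0 = \<rho> 0" using rho_add[of 0 0] by simp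
  then show ?thesis by (metis A.add.r_cancel_one rho_closed)
qed

lemma rho_minus: "\<rho> (- s) = \<ominus>\<^bsub>A\<^esub> \<rho> s"
proof -
  have "\<rho> (- s) \<oplus>\<^bsub>A\<^esub> \<rho> s = \<zero>\<^bsub>A\<^esub>" using rho_add[of "- s" s] by (simp add: rho_zero)
  then show ?thesis by (metis A.minus_equality rho_closed)
qed

lemma rho_diff: "\<rho> (s - t) = \<rho> s \<ominus>\<^bsub>A\<^esub> \<rho> t"
  using rho_add[of s "- t"] by (simp add: rho_minus a_minus_def)

lemma rho_power: "\<rho> (s ^ n) = \<rho> s [^]\<^bsub>A\<^esub> (n::nat)"
  by (induction n) (simp_all add: rho_one rho_mult A.m_comm)

lemma ring_ideal_vimage:
  assumes "ideal I A" shows "ring_ideal (\<rho> -` I)"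
proof -
  interpret ideal I A by fact
  show ?thesis unfolding ring_ideal_def
    by (auto simp: rho_zero rho_add rho_mult I_l_closed)
qed

lemma ideal_image:
  assumes P: "ring_ideal P" shows "ideal (\<rho> ` P) A"
proof (rule idealI)
  show "subgroup (\<rho> ` P) (add_monoid A)"
  proof (rule A.add.subgroupI)
    show "\<rho> ` P \<noteq> {}" using ring_idealD(1)[OF P] by blast
    fix a assume "a \<in> \<rho> ` P"
    then obtain s where "s \<in> P" "a = \<rho> s" by blast
    then show "\<ominus>\<^bsub>A\<^esub> a \<in> \<rho> ` P"
      using ring_idealD(5)[OF P ring_idealD(1)[OF P], of s] by (auto simp: rho_minus[symmetric])
  next
    fix a b assume "a \<in> \<rho> ` P" "b \<in> \<rho> ` P"
    then obtain s t where "s \<in> P" "a = \<rho> s" "t \<in> P" "b = \<rho> t" by blast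
    then show "a \<oplus>\<^bsub>A\<^esub> b \<in> \<rho> ` P"
      using ring_idealD(2)[OF P, of s t] by (auto simp: rho_add[symmetric])
  qed auto
next
  fix a x assume "a \<in> \<rho> ` P" "x \<in> carrier A"
  then obtain s t where "s \<in> P" "a = \<rho> s" "x = \<rho> t" using rho_surj by blast
  then show "x \<otimes>\<^bsub>A\<^esub> a \<in> \<rho> ` P" "a \<otimes>\<^bsub>A\<^esub> x \<in> \<rho> ` P"
    using ring_idealD(3,4)[OF P, of s t] by (auto simp: rho_mult[symmetric])
qed (rule A.ring_axioms)

lemma in_image_iff:
  assumes P: "ring_ideal P" and ker: "\<And>s. \<rho> s = \<zero>\<^bsub>A\<^esub> \<Longrightarrow> s \<in> P"
  shows "\<rho> s \<in> \<rho> ` P \<longleftrightarrow> s \<in> P"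
proof
  assume "\<rho> s \<in> \<rho> ` P"
  then obtain t where t: "t \<in> P" "\<rho> s = \<rho> t" by blast
  then have "\<rho> (s - t) = \<zero>\<^bsub>A\<^esub>" unfolding rho_diff by (simp add: A.r_neg a_minus_def)
  then have "(s - t) + t \<in> P" using t(1) ker ring_idealD(2)[OF P] by blast
  then show "s \<in> P" by simp
qed blast

lemma primeideal_image:
  assumes P: "prime_ring_ideal P" and ker: "\<And>s. \<rho> s = \<zero>\<^bsub>A\<^esub> \<Longrightarrow> s \<in> P"
  shows "primeideal (\<rho> ` P) A"
proof (rule primeidealI)
  have Pi: "ring_ideal P" using P by (simp add: prime_ring_ideal_def)
  note iff = in_image_iff[OF Pi ker]
  show "ideal (\<rho> ` P) A" by (rule ideal_image[OF Pi])
  have "\<rho> 1 \<notin> \<rho> ` P" using iff[of 1] P by (simp add: prime_ring_ideal_def)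
  then show "carrier A \<noteq> \<rho> ` P" using rho_closed by metis
  fix a b assume "a \<in> carrier A" "b \<in> carrier A" "a \<otimes>\<^bsub>A\<^esub> b \<in> \<rho> ` P"
  then obtain s t where "a = \<rho> s" "b = \<rho> t" "\<rho> (s * t) \<in> \<rho> ` P"
    using rho_surj rho_mult by metis
  then show "a \<in> \<rho> ` P \<or> b \<in> \<rho> ` P" using iff P by (auto simp: prime_ring_ideal_def)
qed (rule cring_A)

lemma krull_dim_ge:
  assumes "\<And>i. i \<le> n \<Longrightarrow> prime_ring_ideal (P i)" "\<And>i. i < n \<Longrightarrow> P i \<subset> P (Suc i)"
    and ker: "\<And>s. \<rho> s = \<zero>\<^bsub>A\<^esub> \<Longrightarrow> s \<in> P 0"
  shows "enat n \<le> krull_dim A"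
proof -
  have le: "i \<le> n \<Longrightarrow> P 0 \<subseteq> P i" for i
  proof (induction i)
    case (Suc i) then show ?case using assms(2)[of i] by auto
  qed simp
  have ker': "s \<in> P i" if "i \<le> n" "\<rho> s = \<zero>\<^bsub>A\<^esub>" for s i using le[OF that(1)] ker[OF that(2)] by blast
  have iff: "\<rho> s \<in> \<rho> ` P i \<longleftrightarrow> s \<in> P i" if "i \<le> n" for i s
    using assms(1)[OF that] ker'[OF that] by (intro in_image_iff) (auto simp: prime_ring_ideal_def)
  have "\<forall>i\<le>n. primeideal (\<rho> ` P i) A" using assms(1) ker' by (auto intro: primeideal_image)
  moreover have "\<forall>i<n. \<rho> ` P i \<subset> \<rho> ` P (Suc i)"
  proof (intro allI impI psubsetI)
    fix i assume i: "i < n"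
    then show "\<rho> ` P i \<subseteq> \<rho> ` P (Suc i)" using assms(2) by blast
    obtain s where "s \<in> P (Suc i)" "s \<notin> P i" using assms(2)[OF i] by blast
    then have "\<rho> s \<in> \<rho> ` P (Suc i)" "\<rho> s \<notin> \<rho> ` P i" using iff[of i s] i by auto
    then show "\<rho> ` P i \<noteq> \<rho> ` P (Suc i)" by metis
  qed
  ultimately show ?thesis unfolding krull_dim_def
    by (intro Sup_upper CollectI exI[of _ n] conjI refl exI[of _ "\<lambda>i. \<rho> ` P i"])
qed

text \<open>If the ideal generated by \<open>s\<close> and the kernel missed \<open>1\<close>, the
  image of a maximal ideal above it would be \<open>\<mm>\<close> by uniqueness, and would contain
  \<open>\<rho> s\<close>.\<close>

lemma ex_inverse_outside_maximal:
  assumes "local_ring A \<mm>" and s: "\<rho> s \<notin> \<mm>"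
  shows "\<exists>c. \<rho> (c * s - 1) = \<zero>\<^bsub>A\<^esub>"
proof (rule ccontr)
  interpret L: local_ring A \<mm> by fact
  assume no: "\<not> ?thesis"
  define J where "J = {k + c * s |k c. k \<in> \<rho> -` {\<zero>\<^bsub>A\<^esub>}}"
  have J: "ring_ideal J" unfolding J_def
    by (intro ring_ideal_add_principal ring_ideal_vimage A.zeroideal)
  have kerJ: "k \<in> J" if "\<rho> k = \<zero>\<^bsub>A\<^esub>" for k
    unfolding J_def using that by (intro CollectI exI[of _ k] exI[of _ 0]) simp
  have sJ: "s \<in> J" unfolding J_def
    by (intro CollectI exI[of _ 0] exI[of _ 1]) (simp add: rho_zero)
  have "1 \<notin> J"
  proof
    assume "1 \<in> J"
    then obtain k c where k: "1 = k + c * s" "\<rho> k = \<zero>\<^bsub>A\<^esub>" by (auto simp: J_def)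
    have "c * s - 1 = - k" unfolding k(1) by simp
    then have "\<rho> (c * s - 1) = \<zero>\<^bsub>A\<^esub>" using k(2) by (simp add: rho_minus)
    then show False using no by blast
  qed
  then obtain P where P: "prime_ring_ideal P" "J \<subseteq> P" "P \<inter> {1} = {}"
    and max: "\<And>P'. ring_ideal P' \<Longrightarrow> P' \<inter> {1} = {} \<Longrightarrow> P \<subseteq> P' \<Longrightarrow> P' = P"
    using ex_prime_avoiding[OF J, of "{1}"] by (metis Int_insert_right_if0 inf_bot_right mult_1 singletonD singletonI)
  have Pi: "ring_ideal P" using P(1) by (simp add: prime_ring_ideal_def)
  have iff: "\<rho> t \<in> \<rho> ` P \<longleftrightarrow> t \<in> P" for t
    using kerJ P(2) by (intro in_image_iff[OF Pi]) blast
  have "maximalideal (\<rho> ` P) A"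
  proof (rule maximalidealI)
    show "ideal (\<rho> ` P) A" by (rule ideal_image[OF Pi])
    have "\<rho> 1 \<notin> \<rho> ` P" using iff[of 1] P(3) by blast
    then show "carrier A \<noteq> \<rho> ` P" using rho_closed by metis
    fix J' assume J': "ideal J' A" "\<rho> ` P \<subseteq> J'" "J' \<subseteq> carrier A"
    show "J' = \<rho> ` P \<or> J' = carrier A"
    proof (cases "\<one>\<^bsub>A\<^esub> \<in> J'")
      case True then show ?thesis using ideal.one_imp_carrier[OF J'(1)] by blast
    next
      case False
      have "\<rho> -` J' = P"
        using False J'(2) by (intro max ring_ideal_vimage J'(1)) (auto simp: rho_one)
      moreover have "J' \<subseteq> \<rho> ` (\<rho> -` J')"
      proof
        fix x assume x: "x \<in> J'"
        then obtain t where "\<rho> t = x" using J'(3) rho_surj by blast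
        then show "x \<in> \<rho> ` (\<rho> -` J')" using x by blast
      qed
      ultimately have "J' = \<rho> ` P" using J'(2) by auto
      then show ?thesis ..
    qed
  qed
  then have "\<rho> ` P = \<mm>" by (rule L.max_unique)
  then show False using s sJ P(2) by blast
qed

end

text \<open>The interface for the transfer: submodules of \<open>B\<close> correspond to subspaces
  above the kernel of \<open>\<pi>\<close>. It is kept apart from the families because quotients of
  \<open>B\<close> are covered by the same module.\<close>

locale module_cover = ring_cover A \<rho> + scalar_module scale
  for A :: "('a, 'r) ring_scheme" and \<rho> :: "'s::comm_ring_1 \<Rightarrow> 'a"
    and scale :: "'s \<Rightarrow> 'f::ab_group_add \<Rightarrow> 'f" (infixr \<open>*s\<close> 75) +
  fixes B :: "('a, 'c, 'm) module_scheme" and \<pi> :: "'f \<Rightarrow> 'c"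
  assumes pi_closed [simp]: "\<pi> f \<in> carrier B"
    and pi_zero: "\<pi> 0 = \<zero>\<^bsub>B\<^esub>"
    and pi_add: "\<pi> (f + g) = \<pi> f \<oplus>\<^bsub>B\<^esub> \<pi> g"
    and pi_scale: "\<pi> (s *s f) = \<rho> s \<odot>\<^bsub>B\<^esub> \<pi> f"
    and pi_surj: "x \<in> carrier B \<Longrightarrow> \<exists>f. \<pi> f = x"
begin

text \<open>Each axiom is the image of one upstairs. Quotients of \<open>B\<close> thereby become
  modules as soon as they are covered.\<close>

lemma module_B: "module A B"
proof (rule moduleI)
  show "cring A" by (rule cring_A)
  show "abelian_group B"
  proof (rule abelian_groupI)
    show "\<zero>\<^bsub>B\<^esub> \<in> carrier B" unfolding pi_zero[symmetric] by simp
  next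
    fix x assume "x \<in> carrier B"
    then obtain f where f: "x = \<pi> f" using pi_surj by blast
    show "\<zero>\<^bsub>B\<^esub> \<oplus>\<^bsub>B\<^esub> x = x" unfolding f pi_zero[symmetric] pi_add[symmetric] by simp
    show "\<exists>y\<in>carrier B. y \<oplus>\<^bsub>B\<^esub> x = \<zero>\<^bsub>B\<^esub>"
      unfolding f pi_zero[symmetric] by (rule bexI[of _ "\<pi> (- f)"]) (simp_all flip: pi_add)
  next
    fix x y assume "x \<in> carrier B" "y \<in> carrier B"
    then obtain f g where fg: "x = \<pi> f" "y = \<pi> g" using pi_surj by blast
    show "x \<oplus>\<^bsub>B\<^esub> y \<in> carrier B" unfolding fg pi_add[symmetric] by simp
    show "x \<oplus>\<^bsub>B\<^esub> y = y \<oplus>\<^bsub>B\<^esub> x" unfolding fg pi_add[symmetric] by (simp add: add.commute)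
  next
    fix x y z assume "x \<in> carrier B" "y \<in> carrier B" "z \<in> carrier B"
    then obtain f g h where fg: "x = \<pi> f" "y = \<pi> g" "z = \<pi> h" using pi_surj by metis
    show "x \<oplus>\<^bsub>B\<^esub> y \<oplus>\<^bsub>B\<^esub> z = x \<oplus>\<^bsub>B\<^esub> (y \<oplus>\<^bsub>B\<^esub> z)"
      unfolding fg pi_add[symmetric] by (simp add: add.assoc)
  qed
next
  fix a x assume "a \<in> carrier A" "x \<in> carrier B"
  then obtain s f where sf: "a = \<rho> s" "x = \<pi> f" using pi_surj rho_surj by metis
  show "a \<odot>\<^bsub>B\<^esub> x \<in> carrier B" unfolding sf pi_scale[symmetric] by simp
next
  fix a b x assume "a \<in> carrier A" "b \<in> carrier A" "x \<in> carrier B"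
  then obtain s t f where sf: "a = \<rho> s" "b = \<rho> t" "x = \<pi> f" using pi_surj rho_surj by metis
  show "(a \<oplus>\<^bsub>A\<^esub> b) \<odot>\<^bsub>B\<^esub> x = (a \<odot>\<^bsub>B\<^esub> x) \<oplus>\<^bsub>B\<^esub> (b \<odot>\<^bsub>B\<^esub> x)"
    unfolding sf rho_add[symmetric] pi_scale[symmetric] pi_add[symmetric] by (simp add: scale_left_distrib)
  show "(a \<otimes>\<^bsub>A\<^esub> b) \<odot>\<^bsub>B\<^esub> x = a \<odot>\<^bsub>B\<^esub> (b \<odot>\<^bsub>B\<^esub> x)"
    unfolding sf rho_mult[symmetric] pi_scale[symmetric] by simp
next
  fix a x y assume "a \<in> carrier A" "x \<in> carrier B" "y \<in> carrier B"
  then obtain s f g where sf: "a = \<rho> s" "x = \<pi> f" "y = \<pi> g" using pi_surj rho_surj by metis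
  show "a \<odot>\<^bsub>B\<^esub> (x \<oplus>\<^bsub>B\<^esub> y) = (a \<odot>\<^bsub>B\<^esub> x) \<oplus>\<^bsub>B\<^esub> (a \<odot>\<^bsub>B\<^esub> y)"
    unfolding sf pi_scale[symmetric] pi_add[symmetric] by (simp add: scale_right_distrib)
next
  fix x assume "x \<in> carrier B"
  then obtain f where f: "x = \<pi> f" using pi_surj by blast
  show "\<one>\<^bsub>A\<^esub> \<odot>\<^bsub>B\<^esub> x = x" unfolding f rho_one[symmetric] pi_scale[symmetric] by simp
qed

sublocale B: module A B by (rule module_B)

definition ker :: "'f set" where "ker = {f. \<pi> f = \<zero>\<^bsub>B\<^esub>}"

lemma pi_minus: "\<pi> (- f) = \<ominus>\<^bsub>B\<^esub> \<pi> f"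
proof -
  have "\<pi> (- f) \<oplus>\<^bsub>B\<^esub> \<pi> f = \<zero>\<^bsub>B\<^esub>" by (simp add: pi_zero flip: pi_add)
  then show ?thesis by (metis B.minus_equality pi_closed)
qed

lemma subspace_vimage:
  assumes N: "submodule N A B" shows "subspace (\<pi> -` N)" "ker \<subseteq> \<pi> -` N"
proof -
  interpret N: submodule N A B by fact
  have zero: "\<zero>\<^bsub>B\<^esub> \<in> N" using N.one_closed by simp
  show "subspace (\<pi> -` N)"
    using zero N.m_closed by (intro subspaceI) (auto simp: pi_zero pi_add pi_scale)
  show "ker \<subseteq> \<pi> -` N" using zero by (auto simp: ker_def)
qed

lemma subspace_ker: "subspace ker"
  unfolding ker_def by (rule subspaceI) (auto simp: pi_zero pi_add pi_scale)

lemma submodule_image: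
  assumes P: "subspace P" shows "submodule (\<pi> ` P) A B"
proof (rule B.submoduleI)
  show "\<zero>\<^bsub>B\<^esub> \<in> \<pi> ` P" using subspace_0[OF P] pi_zero by (metis imageI)
  show "\<ominus>\<^bsub>B\<^esub> a \<in> \<pi> ` P" if "a \<in> \<pi> ` P" for a
    using that subspace_neg[OF P] by (auto simp flip: pi_minus)
  show "a \<oplus>\<^bsub>B\<^esub> b \<in> \<pi> ` P" if "a \<in> \<pi> ` P" "b \<in> \<pi> ` P" for a b
    using that subspace_add[OF P] by (auto simp flip: pi_add)
  show "a \<odot>\<^bsub>B\<^esub> x \<in> \<pi> ` P" if ax: "a \<in> carrier A" "x \<in> \<pi> ` P" for a x
  proof -
    obtain s f where sf: "a = \<rho> s" "x = \<pi> f" "f \<in> P" using ax rho_surj by blast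
    have "\<pi> (s *s f) \<in> \<pi> ` P" by (intro imageI subspace_scale[OF P] sf)
    then show ?thesis using sf(1,2) by (simp add: pi_scale)
  qed
qed auto

lemma image_vimage:
  assumes "N \<subseteq> carrier B" shows "\<pi> ` (\<pi> -` N) = N"
proof (intro equalityI subsetI)
  fix x assume x: "x \<in> N"
  then obtain f where "\<pi> f = x" using assms pi_surj by blast
  then show "x \<in> \<pi> ` (\<pi> -` N)" using x by blast
qed auto

lemma vimage_image:
  assumes P: "subspace P" "ker \<subseteq> P" shows "\<pi> -` (\<pi> ` P) = P"
proof
  show "\<pi> -` (\<pi> ` P) \<subseteq> P"
  proof
    fix f assume "f \<in> \<pi> -` (\<pi> ` P)"
    then obtain g where g: "g \<in> P" "\<pi> f = \<pi> g" by auto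
    have "\<pi> (f + - g) = \<zero>\<^bsub>B\<^esub>" unfolding pi_add pi_minus g(2) by (simp add: B.r_neg)
    then have "f + - g \<in> P" using P(2) by (auto simp: ker_def)
    then have "(f + - g) + g \<in> P" using g(1) subspace_add[OF P(1)] by blast
    then show "f \<in> P" by simp
  qed
qed blast

lemma vimage_module_span:
  "\<pi> -` module_span A B (\<pi> ` Z) = span (Z \<union> ker)"
proof
  have "submodule (\<pi> ` span (Z \<union> ker)) A B" by (intro submodule_image subspace_span)
  moreover have "\<pi> ` Z \<subseteq> \<pi> ` span (Z \<union> ker)" using span_superset by blast
  ultimately have "module_span A B (\<pi> ` Z) \<subseteq> \<pi> ` span (Z \<union> ker)"
    unfolding module_span_def by blast
  moreover have "ker \<subseteq> span (Z \<union> ker)" using span_superset by blast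
  ultimately show "\<pi> -` module_span A B (\<pi> ` Z) \<subseteq> span (Z \<union> ker)"
    using vimage_image[OF subspace_span] by blast
  show "span (Z \<union> ker) \<subseteq> \<pi> -` module_span A B (\<pi> ` Z)"
  proof
    fix f assume f: "f \<in> span (Z \<union> ker)"
    have "\<pi> f \<in> N" if "submodule N A B" "\<pi> ` Z \<subseteq> N" for N
    proof -
      have "span (Z \<union> ker) \<subseteq> \<pi> -` N"
        using that(2) subspace_vimage[OF that(1)] by (intro span_minimal) auto
      then show ?thesis using f by blast
    qed
    then show "f \<in> \<pi> -` module_span A B (\<pi> ` Z)" by (simp add: module_span_def)
  qed
qed

lemma submodule_module_span:
  assumes "Z \<subseteq> carrier B" shows "submodule (module_span A B Z) A B"
proof (rule B.submoduleI)
  have zero: "\<zero>\<^bsub>B\<^esub> \<in> N" if "submodule N A B" for N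
  proof -
    interpret N: submodule N A B by fact
    show ?thesis using N.one_closed by simp
  qed
  show "module_span A B Z \<subseteq> carrier B" using B.carrier_is_submodule assms unfolding module_span_def by blast
  show "\<zero>\<^bsub>B\<^esub> \<in> module_span A B Z" using zero by (simp add: module_span_def)
  show "\<ominus>\<^bsub>B\<^esub> a \<in> module_span A B Z" if "a \<in> module_span A B Z" for a
    using that B.submoduleE(3) by (simp add: module_span_def)
  show "a \<oplus>\<^bsub>B\<^esub> b \<in> module_span A B Z" if "a \<in> module_span A B Z" "b \<in> module_span A B Z" for a b
    using that B.submoduleE(5) by (simp add: module_span_def)
  show "a \<odot>\<^bsub>B\<^esub> b \<in> module_span A B Z" if "a \<in> carrier A" "b \<in> module_span A B Z" for a b
    using that B.submoduleE(4) by (simp add: module_span_def)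
qed

lemma submodule_ideal_times:
  assumes "I \<subseteq> carrier A" shows "submodule (ideal_times_module A B I) A B"
  unfolding ideal_times_module_def using assms by (intro submodule_module_span) auto

lemma vimage_ideal_times:
  assumes "I \<subseteq> carrier A"
  shows "\<pi> -` ideal_times_module A B I = act (\<rho> -` I) UNIV + ker"
proof -
  have "{a \<odot>\<^bsub>B\<^esub> x |a x. a \<in> I \<and> x \<in> carrier B} = \<pi> ` {s *s f |s f. s \<in> \<rho> -` I \<and> f \<in> UNIV}"
  proof (intro equalityI subsetI)
    fix y assume "y \<in> {a \<odot>\<^bsub>B\<^esub> x |a x. a \<in> I \<and> x \<in> carrier B}"
    then obtain a x where ax: "y = a \<odot>\<^bsub>B\<^esub> x" "a \<in> I" "x \<in> carrier B" by blast
    then have "a \<in> carrier A" using assms by blast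
    then obtain s where s: "\<rho> s = a" using rho_surj by blast
    obtain f where f: "\<pi> f = x" using pi_surj ax(3) by blast
    have "y = \<pi> (s *s f)" using ax(1) s f by (simp add: pi_scale)
    moreover have "s \<in> \<rho> -` I" using ax(2) s by simp
    ultimately show "y \<in> \<pi> ` {s *s f |s f. s \<in> \<rho> -` I \<and> f \<in> UNIV}" by blast
  next
    fix y assume "y \<in> \<pi> ` {s *s f |s f. s \<in> \<rho> -` I \<and> f \<in> UNIV}"
    then obtain s f where "y = \<pi> (s *s f)" "\<rho> s \<in> I" by blast
    then have "y = \<rho> s \<odot>\<^bsub>B\<^esub> \<pi> f" "\<rho> s \<in> I" by (simp_all add: pi_scale)
    then show "y \<in> {a \<odot>\<^bsub>B\<^esub> x |a x. a \<in> I \<and> x \<in> carrier B}" using pi_closed by blast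
  qed
  then have "\<pi> -` ideal_times_module A B I = span ({s *s f |s f. s \<in> \<rho> -` I \<and> f \<in> UNIV} \<union> ker)"
    unfolding ideal_times_module_def by (simp only: vimage_module_span)
  also have "\<dots> = act (\<rho> -` I) UNIV + span ker" unfolding span_Un_plus act_def ..
  finally show ?thesis using subspace_ker by (metis span_eq_iff)
qed

lemma scale_diff_ker: "\<rho> s = \<rho> t \<Longrightarrow> s *s f - t *s f \<in> ker"
  using subspace_diff[OF subspace_ker] pi_add[of "s *s f" "- (t *s f)"]
  by (simp add: ker_def pi_minus pi_scale B.r_neg)

text \<open>Products of ideals are built from sums in \<open>A\<close>, whose lifts are unique only
  up to elements acting into \<open>ker\<close>; therefore the induction over the product treats an
  arbitrary lift \<open>s\<close>.\<close>

lemma vimage_ideal_prod: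
  assumes P: "ideal P A" and I: "ideal I A"
  shows "\<pi> -` ideal_times_module A B (P \<cdot>\<^bsub>A\<^esub> I) =
    act (\<rho> -` I) (\<pi> -` ideal_times_module A B P) + ker" (is "?L = ?R")
proof
  have sub: "P \<subseteq> carrier A" "I \<subseteq> carrier A" "P \<cdot>\<^bsub>A\<^esub> I \<subseteq> carrier A"
    using ideal.Icarr[OF P] ideal.Icarr[OF I] A.ideal_prod_in_carrier[OF P I] by auto
  have subR: "subspace ?R" "ker \<subseteq> ?R"
    using subspace_ker by (auto intro!: subspace_plus plus_upper2[THEN subsetD])
  have mem: "s *s f \<in> ?R" if "a \<in> P \<cdot>\<^bsub>A\<^esub> I" "\<rho> s = a" for a s f
    using that
  proof (induction a arbitrary: s rule: ideal_prod.induct)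
    case (prod i j)
    then obtain p t where pt: "i = \<rho> p" "j = \<rho> t" using sub rho_surj by (metis subsetD)
    have "p *s f \<in> \<pi> -` ideal_times_module A B P"
      unfolding vimage_ideal_times[OF sub(1)] using prod(1) pt(1) subspace_ker
      by (intro plus_upper1[THEN subsetD] scale_in_act) auto
    then have "t *s p *s f \<in> act (\<rho> -` I) (\<pi> -` ideal_times_module A B P)"
      using prod(2) pt(2) by (intro scale_in_act) auto
    then have tp: "t *s p *s f \<in> ?R" using plus_upper1[OF subspace_ker] by blast
    have "\<rho> s = \<rho> (t * p)" using prod(3) pt by (simp add: rho_mult A.m_comm)
    then have "s *s f - (t * p) *s f \<in> ?R" using scale_diff_ker subR(2) by blast
    then have "(s *s f - (t * p) *s f) + t *s p *s f \<in> ?R" using tp by (rule subspace_add[OF subR(1)])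
    then show ?case by simp
  next
    case (sum a b)
    obtain p t where pt: "\<rho> p = a" "\<rho> t = b" using sum(1,2) sub(3) rho_surj by (metis subsetD)
    have "p *s f + t *s f \<in> ?R" by (intro subspace_add[OF subR(1)] sum.IH pt)
    moreover have "\<rho> s = \<rho> (p + t)" using sum.prems pt by (simp add: rho_add)
    then have "s *s f - (p + t) *s f \<in> ?R" using scale_diff_ker subR(2) by blast
    ultimately have "(s *s f - (p + t) *s f) + (p *s f + t *s f) \<in> ?R"
      using subspace_add[OF subR(1)] by blast
    then show ?case by (simp add: scale_left_distrib)
  qed
  show "?L \<subseteq> ?R"
    unfolding vimage_ideal_times[OF sub(3)] using mem by (intro plus_least act_least subR) auto
  have subL: "subspace ?L" "ker \<subseteq> ?L"
    using subspace_vimage[OF submodule_ideal_times[OF sub(3)]] by auto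
  have "act (\<rho> -` I) (act (\<rho> -` P) UNIV + ker) \<subseteq> ?L"
    unfolding act_plus[OF subspace_act subspace_ker]
  proof (intro plus_least subL)
    show "act (\<rho> -` I) ker \<subseteq> ?L" using act_le[OF subspace_ker] subL(2) by blast
    have "act (\<rho> -` P) (act (\<rho> -` I) UNIV) \<subseteq> ?L"
    proof (rule act_least[OF subL(1)])
      fix p u assume p: "p \<in> \<rho> -` P" and u: "u \<in> act (\<rho> -` I) UNIV"
      have "act (\<rho> -` I) UNIV \<subseteq> colon ?L p"
      proof (rule act_least[OF subspace_colon[OF subL(1)]])
        fix t f assume t: "t \<in> \<rho> -` I"
        have "\<rho> (p * t) \<in> P \<cdot>\<^bsub>A\<^esub> I" unfolding rho_mult using p t by (intro ideal_prod.prod) auto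
        then have "(p * t) *s f \<in> act (\<rho> -` (P \<cdot>\<^bsub>A\<^esub> I)) UNIV" by (intro scale_in_act) auto
        then have "(p * t) *s f \<in> ?L"
          unfolding vimage_ideal_times[OF sub(3)] using plus_upper1[OF subspace_ker] by blast
        then show "t *s f \<in> colon ?L p" by (simp add: colon_def)
      qed
      then show "p *s u \<in> ?L" using u by (auto simp: colon_def)
    qed
    then show "act (\<rho> -` I) (act (\<rho> -` P) UNIV) \<subseteq> ?L" by (simp only: act_commute)
  qed
  then show "?R \<subseteq> ?L" unfolding vimage_ideal_times[OF sub(1)] by (intro plus_least subL)
qed

lemma ideal_power:
  assumes "ideal I A" shows "ideal (I [^]\<^bsub>ideals_set A\<^esub> (n::nat)) A"
proof -
  interpret I: comm_monoid "ideals_set A" by (rule A.ideals_set_is_comm_monoid)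
  have "I \<in> carrier (ideals_set A)" using assms by (simp add: ideals_set_def)
  then have "I [^]\<^bsub>ideals_set A\<^esub> n \<in> carrier (ideals_set A)" by (rule I.nat_pow_closed)
  then show ?thesis by (simp add: ideals_set_def)
qed

text \<open>Through this the submodules divided out in \<open>hilbert_samuel\<close> become members
  of \<open>filt\<close>.\<close>

lemma vimage_ideal_power:
  assumes I: "ideal I A"
  shows "\<pi> -` ideal_times_module A B (I [^]\<^bsub>ideals_set A\<^esub> (n::nat)) = filt (\<rho> -` I) ker n"
proof (induction n)
  case 0
  have pow: "I [^]\<^bsub>ideals_set A\<^esub> (0::nat) = carrier A" by (simp add: ideals_set_def)
  have "f \<in> act (\<rho> -` carrier A) UNIV + ker" for f
  proof -
    have "1 *s f \<in> act (\<rho> -` carrier A) UNIV" by (intro scale_in_act) auto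
    then show ?thesis using plus_upper1[OF subspace_ker] by auto
  qed
  then show ?case unfolding pow vimage_ideal_times[OF order_refl] by auto
next
  case (Suc n)
  have "I [^]\<^bsub>ideals_set A\<^esub> Suc n = (I [^]\<^bsub>ideals_set A\<^esub> n) \<cdot>\<^bsub>A\<^esub> I"
    by (simp add: ideals_set_def)
  then show ?case using vimage_ideal_prod[OF ideal_power[OF I] I] Suc by (simp add: filt.simps)
qed

text \<open>\<open>ys\<close> generates \<open>J\<close> modulo the annihilator of the covered module.\<close>

definition generates :: "'s set \<Rightarrow> 's set \<Rightarrow> bool" where
  "generates ys J \<longleftrightarrow> ys \<subseteq> J \<and>
    (\<forall>s\<in>J. \<forall>P u. subspace P \<longrightarrow> ker \<subseteq> P \<longrightarrow> (\<forall>y\<in>ys. y *s u \<in> P) \<longrightarrow> s *s u \<in> P)"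

lemma generates_vimage_Idl: "generates ys (\<rho> -` (Idl\<^bsub>A\<^esub> (\<rho> ` ys)))"
  unfolding generates_def
proof (intro conjI ballI allI impI)
  have sub: "\<rho> ` ys \<subseteq> carrier A" by auto
  show "ys \<subseteq> \<rho> -` (Idl\<^bsub>A\<^esub> (\<rho> ` ys))" using A.genideal_self[OF sub] by blast
  fix s P u assume s: "s \<in> \<rho> -` (Idl\<^bsub>A\<^esub> (\<rho> ` ys))" and P: "subspace P" "ker \<subseteq> P" "\<forall>y\<in>ys. y *s u \<in> P"
  define J where "J = {s. s *s u \<in> P}"
  have J: "ring_ideal J" unfolding ring_ideal_def J_def
    using P(1) by (auto simp: subspace_0 scale_left_distrib subspace_add
        scale_scale[symmetric] subspace_scale simp del: scale_scale)
  have kerJ: "t \<in> J" if "\<rho> t = \<zero>\<^bsub>A\<^esub>" for t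
  proof -
    have "\<rho> t = \<rho> 0" using that by (simp add: rho_zero)
    then have "t *s u - 0 *s u \<in> ker" by (rule scale_diff_ker)
    then show ?thesis using P(2) by (auto simp: J_def)
  qed
  have "\<rho> ` ys \<subseteq> \<rho> ` J" using P(3) by (auto simp: J_def)
  then have "Idl\<^bsub>A\<^esub> (\<rho> ` ys) \<subseteq> \<rho> ` J" by (rule A.genideal_minimal[OF ideal_image[OF J]])
  then have "\<rho> s \<in> \<rho> ` J" using s by auto
  then show "s *s u \<in> P" using in_image_iff[OF J kerJ] by (simp add: J_def)
qed

lemma generatesD:
  "generates ys J \<Longrightarrow> s \<in> J \<Longrightarrow> subspace P \<Longrightarrow> ker \<subseteq> P \<Longrightarrow> (\<And>y. y \<in> ys \<Longrightarrow> y *s u \<in> P) \<Longrightarrow> s *s u \<in> P"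
  unfolding generates_def by blast

lemma ex_generates:
  assumes "noetherian_ring A" "ideal I A"
  obtains ys where "generates (set ys) (\<rho> -` I)"
proof -
  obtain C where C: "C \<subseteq> carrier A" "finite C" "I = Idl\<^bsub>A\<^esub> C"
    using noetherian_ring.finetely_gen[OF assms] by blast
  have "\<forall>c\<in>C. \<exists>s. \<rho> s = c" using C(1) rho_surj by blast
  then obtain h where h: "\<And>c. c \<in> C \<Longrightarrow> \<rho> (h c) = c" by metis
  obtain ys where ys: "set ys = h ` C" using finite_list[OF finite_imageI[OF C(2)]] by metis
  have "\<rho> ` set ys = C" unfolding ys image_image using h by simp
  then show ?thesis using that[of ys] generates_vimage_Idl[of "set ys"] C(3) by simp
qed

lemma filt_generates:
  assumes "generates ys J" shows "filt ys ker n = filt J ker n"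
proof (induction n)
  case (Suc n)
  have sub: "subspace (act ys P + ker)" "ker \<subseteq> act ys P + ker" for P
    using subspace_ker by (auto intro!: subspace_plus plus_upper2[THEN subsetD])
  have "act J P \<subseteq> act ys P + ker" for P
  proof (rule act_least[OF sub(1)])
    fix s f assume sf: "s \<in> J" "f \<in> P"
    show "s *s f \<in> act ys P + ker"
    proof (rule generatesD[OF assms sf(1) sub])
      fix y assume "y \<in> ys"
      then have "y *s f \<in> act ys P" using sf(2) by (rule scale_in_act)
      then show "y *s f \<in> act ys P + ker" using plus_upper1[OF subspace_ker, of "act ys P"] by blast
    qed
  qed
  then have "act J P + ker = act ys P + ker" for P
    using sub assms by (intro equalityI plus_least[OF sub(1)] set_plus_mono2 act_mono order_refl)
      (auto simp: generates_def)
  then show ?case using Suc by (simp add: filt.simps)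
qed simp

text \<open>Induction on the generators: the coefficients at \<open>m\<close> of elements of
  \<open>N\<close>, modulo the span of the other generators, form an ideal \<open>J\<close>.
  Finitely many elements of \<open>N\<close> realize generators of \<open>J\<close>, and generators
  of \<open>N \<inter> ?Y\<close> complete them.\<close>

lemma finitely_generated_above_ker:
  assumes noeth: "noetherian_ring A"
  shows "finite Y \<Longrightarrow> subspace N \<Longrightarrow> ker \<subseteq> N \<Longrightarrow> N \<subseteq> span (Y \<union> ker) \<Longrightarrow>
    \<exists>Z. finite Z \<and> N = span (Z \<union> ker)"
proof (induction Y arbitrary: N rule: finite_induct)
  case empty
  have eq: "span ({} \<union> ker) = ker"
    unfolding Un_empty_left by (rule iffD2[OF span_eq_iff subspace_ker])
  then have "N = span ({} \<union> ker)" using empty(2,3) unfolding eq by blast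
  then show ?case by blast
next
  case (insert m Y)
  let ?Y = "span (Y \<union> ker)"
  have kerY: "ker \<subseteq> ?Y" using span_superset by blast
  obtain Z where Z: "finite Z" "N \<inter> ?Y = span (Z \<union> ker)"
    using insert.IH[of "N \<inter> ?Y"] insert.prems(1,2) kerY subspace_inter by auto
  define J where "J = {s. s *s m \<in> N + ?Y}"
  have subNY: "subspace (N + ?Y)" using insert.prems by (intro subspace_plus) auto
  have J: "ring_ideal J" unfolding ring_ideal_def J_def
    using subNY by (auto simp: subspace_0 scale_left_distrib subspace_add
        scale_scale[symmetric] subspace_scale simp del: scale_scale)
  have kerJ: "t \<in> J" if "\<rho> t = \<zero>\<^bsub>A\<^esub>" for t
  proof -
    have "\<rho> t = \<rho> 0" using that by (simp add: rho_zero)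
    then have "t *s m - 0 *s m \<in> ker" by (rule scale_diff_ker)
    moreover have "ker \<subseteq> N + ?Y" using insert.prems(2) plus_upper1[of ?Y N] by auto
    ultimately show ?thesis by (auto simp: J_def)
  qed
  obtain ys where "generates (set ys) (\<rho> -` (\<rho> ` J))"
    using ex_generates[OF noeth ideal_image[OF J]] by blast
  moreover have "\<rho> -` (\<rho> ` J) = J" using in_image_iff[OF J kerJ] by auto
  ultimately have ys: "generates (set ys) J" by simp
  have "\<forall>y\<in>set ys. \<exists>n. n \<in> N \<and> y *s m - n \<in> ?Y"
  proof
    fix y assume "y \<in> set ys"
    then have "y *s m \<in> N + ?Y" using ys by (auto simp: generates_def J_def)
    then obtain n w where nw: "y *s m = n + w" "n \<in> N" "w \<in> ?Y" by (auto elim!: set_plus_elim)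
    have "y *s m - n = w" unfolding nw(1) by simp
    then show "\<exists>n. n \<in> N \<and> y *s m - n \<in> ?Y" using nw by blast
  qed
  then obtain h where h: "\<And>y. y \<in> set ys \<Longrightarrow> h y \<in> N \<and> y *s m - h y \<in> ?Y" by metis
  let ?Z = "h ` set ys \<union> Z"
  have "N = span (?Z \<union> ker)"
  proof
    have "Z \<subseteq> N" using Z(2) span_superset[of "Z \<union> ker"] by blast
    then show "span (?Z \<union> ker) \<subseteq> N" using insert.prems(1,2) h by (intro span_minimal) auto
    show "N \<subseteq> span (?Z \<union> ker)"
    proof
      fix n assume n: "n \<in> N"
      then obtain s where s: "n - s *s m \<in> ?Y" using insert.prems(3) span_breakdown_eq[of n m "Y \<union> ker"] by auto
      have "s *s m \<in> N + ?Y"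
      proof -
        have "- (n - s *s m) \<in> ?Y" by (rule span_neg[OF s])
        then have "n + - (n - s *s m) \<in> N + ?Y" using n by blast
        then show ?thesis by simp
      qed
      then have "s \<in> J" by (simp add: J_def)
      let ?H = "span (h ` set ys \<union> ker)"
      have "s *s m \<in> ?H + ?Y"
      proof (rule generatesD[OF ys \<open>s \<in> J\<close>])
        show "subspace (?H + ?Y)" by (intro subspace_plus) auto
        show "ker \<subseteq> ?H + ?Y" using kerY plus_upper2[of ?H ?Y] by auto
        fix y assume y: "y \<in> set ys"
        then have "h y \<in> ?H" by (intro span_base) simp
        then have "h y + (y *s m - h y) \<in> ?H + ?Y" using h[OF y] by (intro set_plus_intro) simp_all
        then show "y *s m \<in> ?H + ?Y" by simp
      qed
      then obtain n' w' where w': "s *s m = n' + w'" "n' \<in> ?H" "w' \<in> ?Y" by (rule set_plus_elim)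
      have "?H \<subseteq> N" using insert.prems(1,2) h by (intro span_minimal) auto
      then have "n - n' \<in> N" using n w'(2) subspace_diff[OF insert.prems(1)] by blast
      moreover have eq: "n - n' = (n - s *s m) + w'" unfolding w'(1) by simp
      have "n - n' \<in> ?Y" unfolding eq by (rule span_add[OF s w'(3)])
      ultimately have "n - n' \<in> span (Z \<union> ker)" using Z(2) by blast
      then have "n - n' \<in> span (?Z \<union> ker)" using span_mono[of "Z \<union> ker" "?Z \<union> ker"] by blast
      moreover have "n' \<in> span (?Z \<union> ker)" using w'(2) span_mono[of "h ` set ys \<union> ker" "?Z \<union> ker"] by blast
      ultimately have "(n - n') + n' \<in> span (?Z \<union> ker)" by (rule span_add)
      then show "n \<in> span (?Z \<union> ker)" by simp
    qed
  qed
  then show ?case using Z(1) by (intro exI[of _ ?Z]) simp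
qed

lemma has_chain_ker_iff:
  "has_chain n ker UNIV \<longleftrightarrow> (\<exists>N. (\<forall>i\<le>n. submodule (N i) A B) \<and> (\<forall>i<n. N i \<subset> N (Suc i)))"
proof
  have ex: "has_chain n ker P \<Longrightarrow> subspace P \<Longrightarrow>
      \<exists>N. (\<forall>i\<le>n. subspace (N i) \<and> ker \<subseteq> N i) \<and> (\<forall>i<n. N i \<subset> N (Suc i)) \<and> N n = P" for P
  proof (induction n arbitrary: P)
    case 0 then show ?case by (intro exI[of _ "\<lambda>_. P"]) simp
  next
    case (Suc n)
    then obtain P' where P': "subspace P'" "P' \<subset> P" "has_chain n ker P'" by auto
    then obtain N where N: "\<forall>i\<le>n. subspace (N i) \<and> ker \<subseteq> N i" "\<forall>i<n. N i \<subset> N (Suc i)" "N n = P'"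
      using Suc.IH by blast
    have "ker \<subseteq> P" using Suc.prems(1) by (rule has_chain_subset)
    then show ?case using N P'(2) Suc.prems(2)
      by (intro exI[of _ "N(Suc n := P)"]) (auto simp: le_Suc_eq less_Suc_eq)
  qed
  assume "has_chain n ker UNIV"
  from ex[OF this subspace_UNIV] obtain N where
    N: "\<forall>i\<le>n. subspace (N i) \<and> ker \<subseteq> N i" "\<forall>i<n. N i \<subset> N (Suc i)" by blast
  show "\<exists>N. (\<forall>i\<le>n. submodule (N i) A B) \<and> (\<forall>i<n. N i \<subset> N (Suc i))"
  proof (intro exI[of _ "\<lambda>i. \<pi> ` N i"] conjI allI impI)
    show "submodule (\<pi> ` N i) A B" if "i \<le> n" for i using that N(1) submodule_image by blast
    fix i assume i: "i < n"
    have "\<pi> -` (\<pi> ` N i) = N i" "\<pi> -` (\<pi> ` N (Suc i)) = N (Suc i)"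
      using i N(1) by (intro vimage_image; simp)+
    then have "\<pi> ` N i \<noteq> \<pi> ` N (Suc i)" using N(2) i by (metis psubset_eq)
    moreover have "N i \<subseteq> N (Suc i)" using N(2) i by blast
    then have "\<pi> ` N i \<subseteq> \<pi> ` N (Suc i)" by (rule image_mono)
    ultimately show "\<pi> ` N i \<subset> \<pi> ` N (Suc i)" by blast
  qed
next
  assume "\<exists>N. (\<forall>i\<le>n. submodule (N i) A B) \<and> (\<forall>i<n. N i \<subset> N (Suc i))"
  then obtain N where N: "\<And>i. i \<le> n \<Longrightarrow> submodule (N i) A B" "\<And>i. i < n \<Longrightarrow> N i \<subset> N (Suc i)" by blast
  have "i \<le> n \<Longrightarrow> has_chain i ker (\<pi> -` N i)" for i
  proof (induction i)
    case 0 then show ?case using subspace_vimage[OF N(1)[of 0]] by simp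
  next
    case (Suc i)
    have sub: "submodule (N i) A B" "submodule (N (Suc i)) A B" using Suc.prems N(1) by auto
    have "N i \<subset> N (Suc i)" using N(2) Suc.prems by simp
    moreover have "\<pi> ` (\<pi> -` N i) = N i" "\<pi> ` (\<pi> -` N (Suc i)) = N (Suc i)"
      using B.submoduleE(1)[OF sub(1)] B.submoduleE(1)[OF sub(2)] image_vimage by auto
    ultimately have "\<pi> -` N i \<subset> \<pi> -` N (Suc i)" by (metis psubset_eq vimage_mono)
    then show ?case using Suc subspace_vimage(1)[OF sub(1)] unfolding has_chain.simps by auto
  qed
  then show "has_chain n ker UNIV" using has_chain_top[of n ker "\<pi> -` N n" UNIV] by simp
qed

lemma module_length_eq:
  assumes "finite_length ker UNIV" shows "module_length A B = enat (len ker UNIV)"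
proof -
  have "{enat n |n. \<exists>N. (\<forall>i\<le>n. submodule (N i) A B) \<and> (\<forall>i<n. N i \<subset> N (Suc i))} = enat ` {..len ker UNIV}"
    unfolding has_chain_ker_iff[symmetric] has_chain_iff_len[OF assms subset_UNIV] by auto
  then have "module_length A B = Sup (enat ` {..len ker UNIV})" by (simp add: module_length_def)
  also have "\<dots> = enat (len ker UNIV)"
    by (rule antisym) (auto intro!: Sup_least Sup_upper)
  finally show ?thesis .
qed

lemma FactModule_cover:
  assumes N: "submodule N A B"
  shows "module_cover A \<rho> scale (FactModule B N) (\<lambda>f. N +>\<^bsub>B\<^esub> \<pi> f)"
proof -
  interpret N: submodule N A B by fact
  have "additive_subgroup N B" by (rule additive_subgroup.intro) (rule N.subgroup_axioms)
  then interpret NB: abelian_subgroup N B by (intro abelian_subgroupI3 B.abelian_group_axioms)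
  show ?thesis
  proof
    fix f g s
    show "N +>\<^bsub>B\<^esub> \<pi> f \<in> carrier (FactModule B N)"
      by (auto simp: FactModule_def A_RCOSETS_def' intro: pi_closed)
    show "N +>\<^bsub>B\<^esub> \<pi> 0 = \<zero>\<^bsub>FactModule B N\<^esub>"
      using NB.a_rcos_const[of "\<zero>\<^bsub>B\<^esub>"] N.one_closed by (simp add: FactModule_def pi_zero)
    show "N +>\<^bsub>B\<^esub> \<pi> (f + g) = (N +>\<^bsub>B\<^esub> \<pi> f) \<oplus>\<^bsub>FactModule B N\<^esub> (N +>\<^bsub>B\<^esub> \<pi> g)"
      by (simp add: FactModule_def pi_add NB.a_rcos_sum)
    have "N +>\<^bsub>B\<^esub> (\<rho> s \<odot>\<^bsub>B\<^esub> x) = N +>\<^bsub>B\<^esub> (\<rho> s \<odot>\<^bsub>B\<^esub> \<pi> f)" if x: "x \<in> N +>\<^bsub>B\<^esub> \<pi> f" for x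
    proof -
      obtain n where n: "n \<in> N" "x = n \<oplus>\<^bsub>B\<^esub> \<pi> f" using x by (auto simp: a_r_coset_def')
      have nB: "n \<in> carrier B" using n(1) N.subset by auto
      have "\<rho> s \<odot>\<^bsub>B\<^esub> x = (\<rho> s \<odot>\<^bsub>B\<^esub> n) \<oplus>\<^bsub>B\<^esub> (\<rho> s \<odot>\<^bsub>B\<^esub> \<pi> f)"
        unfolding n(2) using nB by (simp add: B.smult_r_distr)
      moreover have "\<rho> s \<odot>\<^bsub>B\<^esub> n \<in> N" using n(1) by (intro N.smult_closed) auto
      ultimately have "\<rho> s \<odot>\<^bsub>B\<^esub> x \<in> N +>\<^bsub>B\<^esub> (\<rho> s \<odot>\<^bsub>B\<^esub> \<pi> f)" by (auto simp: a_r_coset_def')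
      then show ?thesis using NB.a_repr_independence'[of "\<rho> s \<odot>\<^bsub>B\<^esub> x" "\<rho> s \<odot>\<^bsub>B\<^esub> \<pi> f"] by simp
    qed
    moreover have "\<pi> f \<in> N +>\<^bsub>B\<^esub> \<pi> f" by (simp add: NB.a_rcos_self)
    then have "N +>\<^bsub>B\<^esub> \<pi> f \<noteq> {}" by blast
    ultimately have "(\<Union>x\<in>N +>\<^bsub>B\<^esub> \<pi> f. N +>\<^bsub>B\<^esub> (\<rho> s \<odot>\<^bsub>B\<^esub> x)) = N +>\<^bsub>B\<^esub> (\<rho> s \<odot>\<^bsub>B\<^esub> \<pi> f)"
      by (intro SUP_eq_const)
    then show "N +>\<^bsub>B\<^esub> \<pi> (s *s f) = \<rho> s \<odot>\<^bsub>FactModule B N\<^esub> (N +>\<^bsub>B\<^esub> \<pi> f)"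
      by (simp add: FactModule_def pi_scale)
  next
    fix x assume "x \<in> carrier (FactModule B N)"
    then obtain y where "y \<in> carrier B" "x = N +>\<^bsub>B\<^esub> y" by (auto simp: FactModule_def A_RCOSETS_def')
    then show "\<exists>f. N +>\<^bsub>B\<^esub> \<pi> f = x" using pi_surj by blast
  qed
qed

lemma FactModule_ker:
  assumes N: "submodule N A B"
  shows "module_cover.ker (FactModule B N) (\<lambda>f. N +>\<^bsub>B\<^esub> \<pi> f) = \<pi> -` N"
proof -
  interpret N: submodule N A B by fact
  have "additive_subgroup N B" by (rule additive_subgroup.intro) (rule N.subgroup_axioms)
  then interpret NB: abelian_subgroup N B by (intro abelian_subgroupI3 B.abelian_group_axioms)
  have "N +>\<^bsub>B\<^esub> \<pi> f = N \<longleftrightarrow> \<pi> f \<in> N" for f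
    using NB.a_rcos_self[of "\<pi> f"] NB.a_rcos_const by auto
  then show ?thesis
    unfolding module_cover.ker_def[OF FactModule_cover[OF N]] by (auto simp: FactModule_def)
qed

end

section \<open>Transfer to the covered module\<close>

context scalar_module
begin

lemma foldl_cut:
  assumes "subspace Q"
  shows "subspace (foldl cut Q ss)" "Q \<subseteq> foldl cut Q ss" "s \<in> set ss \<Longrightarrow> s *s f \<in> foldl cut Q ss"
proof -
  have "subspace (foldl cut Q ss) \<and> Q \<subseteq> foldl cut Q ss \<and> (\<forall>s\<in>set ss. s *s f \<in> foldl cut Q ss)"
  proof (induction ss rule: rev_induct)
    case (snoc s ss)
    then have *: "subspace (foldl cut Q ss)" by blast
    then show ?case using snoc cut_upper[OF *, of s] scale_in_cut[OF *, of s f] subspace_cut[OF *, of s] by auto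
  qed (use assms in simp)
  then show "subspace (foldl cut Q ss)" "Q \<subseteq> foldl cut Q ss" "s \<in> set ss \<Longrightarrow> s *s f \<in> foldl cut Q ss" by auto
qed

lemma foldl_cut_least:
  assumes "subspace N" "Q \<subseteq> N" "\<And>s f. s \<in> set ss \<Longrightarrow> s *s f \<in> N"
  shows "foldl cut Q ss \<subseteq> N"
  using assms(3)
proof (induction ss rule: rev_induct)
  case (snoc s ss)
  then have "foldl cut Q ss \<subseteq> N" by simp
  moreover have "range (scale s) \<subseteq> N" using snoc.prems[of s] by auto
  ultimately show ?case using plus_least[OF assms(1)] by (simp add: cut_def[of "foldl cut Q ss"])
qed (use assms in simp)

end

context local_scalar_module
begin

lemma depth_ge_regular_list:
  "(\<And>i. i < length ss \<Longrightarrow> regular (foldl cut Q (take i ss)) (ss ! i)) \<Longrightarrow> set ss \<subseteq> mm \<Longrightarrow>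
    foldl cut Q ss \<noteq> UNIV \<Longrightarrow> depth_ge (length ss) Q"
proof (induction ss arbitrary: Q)
  case (Cons s ss)
  have "depth_ge (length ss) (cut Q s)"
  proof (rule Cons.IH)
    fix i assume "i < length ss"
    then show "regular (foldl cut (cut Q s) (take i ss)) (ss ! i)" using Cons.prems(1)[of "Suc i"] by simp
  qed (use Cons.prems in auto)
  moreover have "regular Q s" using Cons.prems(1)[of 0] by simp
  ultimately show ?case using Cons.prems(2) by auto
qed simp

end

context module_cover
begin

text \<open>In \<open>regular_sequence\<close> an initial segment is divided out at once, in
  \<open>depth_ge\<close> one element after the other; this identifies the two.\<close>

lemma vimage_ideal_times_Idl_list:
  "\<pi> -` ideal_times_module A B (Idl\<^bsub>A\<^esub> (\<rho> ` set ss)) = foldl cut ker ss"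
proof -
  let ?I = "Idl\<^bsub>A\<^esub> (\<rho> ` set ss)"
  have sub: "\<rho> ` set ss \<subseteq> carrier A" by auto
  have I: "?I \<subseteq> carrier A" using ideal.Icarr[OF A.genideal_ideal[OF sub]] by auto
  note F = foldl_cut[OF subspace_ker]
  show ?thesis unfolding vimage_ideal_times[OF I]
  proof
    show "act (\<rho> -` ?I) UNIV + ker \<subseteq> foldl cut ker ss"
    proof (intro plus_least act_least F(1,2))
      fix s f assume "s \<in> \<rho> -` ?I"
      then show "s *s f \<in> foldl cut ker ss" by (rule generatesD[OF generates_vimage_Idl _ F(1,2)]) (rule F(3))
    qed
    show "foldl cut ker ss \<subseteq> act (\<rho> -` ?I) UNIV + ker"
    proof (rule foldl_cut_least)
      show "subspace (act (\<rho> -` ?I) UNIV + ker)" by (intro subspace_plus subspace_ker subspace_act)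
      show "ker \<subseteq> act (\<rho> -` ?I) UNIV + ker" by (intro plus_upper2 subspace_act)
      fix s f assume "s \<in> set ss"
      then have "s \<in> \<rho> -` ?I" using A.genideal_self[OF sub] by blast
      then have "s *s f \<in> act (\<rho> -` ?I) UNIV" by (intro scale_in_act) auto
      then show "s *s f \<in> act (\<rho> -` ?I) UNIV + ker" using plus_upper1[OF subspace_ker] by blast
    qed
  qed
qed

lemma nonzerodivisor_imp_regular:
  assumes N: "submodule N A B" and nz: "module_nonzerodivisor (FactModule B N) (\<rho> s)"
  shows "regular (\<pi> -` N) s"
proof -
  interpret Q: module_cover A \<rho> scale "FactModule B N" "\<lambda>f. N +>\<^bsub>B\<^esub> \<pi> f" by (rule FactModule_cover[OF N])
  have mem: "f \<in> \<pi> -` N \<longleftrightarrow> N +>\<^bsub>B\<^esub> \<pi> f = \<zero>\<^bsub>FactModule B N\<^esub>" for f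
    unfolding FactModule_ker[OF N, symmetric] by (simp add: Q.ker_def)
  show ?thesis unfolding regular_def mem
    using nz Q.pi_closed Q.pi_scale unfolding module_nonzerodivisor_def by metis
qed

lemma regular_sequence_depth:
  assumes loc: "local_scalar_module scale ker (\<rho> -` \<mm>) T zs gs"
    and as: "set as \<subseteq> \<mm>" "regular_sequence A B as"
  shows "local_scalar_module.depth_ge scale (\<rho> -` \<mm>) (length as) ker"
proof -
  interpret L: local_scalar_module scale ker "\<rho> -` \<mm>" T zs gs by (rule loc)
  have carr: "set as \<subseteq> carrier A" using as(2) by (simp add: regular_sequence_def)
  then have "\<forall>a\<in>set as. \<exists>s. \<rho> s = a" using rho_surj by blast
  then obtain h where h: "\<And>a. a \<in> set as \<Longrightarrow> \<rho> (h a) = a" by metis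
  define ss where "ss = map h as"
  have rho_take: "\<rho> ` set (take i ss) = set (take i as)" for i
  proof -
    have "\<rho> ` set (take i ss) = (\<lambda>a. \<rho> (h a)) ` set (take i as)"
      by (simp add: ss_def take_map image_image)
    also have "\<dots> = (\<lambda>a. a) ` set (take i as)" by (rule image_cong) (auto intro!: h dest: in_set_takeD)
    finally show ?thesis by simp
  qed
  have "L.depth_ge (length ss) ker"
  proof (rule L.depth_ge_regular_list)
    show "set ss \<subseteq> \<rho> -` \<mm>" using as(1) h by (auto simp: ss_def)
    show "foldl cut ker ss \<noteq> UNIV"
    proof
      assume "foldl cut ker ss = UNIV"
      then have "\<pi> -` ideal_times_module A B (Idl\<^bsub>A\<^esub> (set as)) = UNIV"
        using vimage_ideal_times_Idl_list[of ss] rho_take[of "length as"] by (simp add: ss_def)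
      moreover have "Idl\<^bsub>A\<^esub> (set as) \<subseteq> carrier A"
        using ideal.Icarr[OF A.genideal_ideal[OF carr]] by auto
      then have "ideal_times_module A B (Idl\<^bsub>A\<^esub> (set as)) \<subseteq> carrier B"
        using B.submoduleE(1)[OF submodule_ideal_times] by blast
      ultimately have "ideal_times_module A B (Idl\<^bsub>A\<^esub> (set as)) = carrier B"
        using pi_surj by blast
      then show False using as(2) by (simp add: regular_sequence_def)
    qed
    fix i assume i: "i < length ss"
    let ?I = "Idl\<^bsub>A\<^esub> (set (take i as))"
    have "set (take i as) \<subseteq> carrier A" using carr set_take_subset[of i as] by blast
    from ideal.Icarr[OF A.genideal_ideal[OF this]] have "?I \<subseteq> carrier A" by auto
    then have "submodule (ideal_times_module A B ?I) A B" by (rule submodule_ideal_times)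
    moreover have "module_nonzerodivisor (FactModule B (ideal_times_module A B ?I)) (\<rho> (ss ! i))"
      using as(2) i h[of "as ! i"] by (simp add: regular_sequence_def ss_def)
    ultimately have "regular (\<pi> -` ideal_times_module A B ?I) (ss ! i)" by (rule nonzerodivisor_imp_regular)
    then show "regular (foldl cut ker (take i ss)) (ss ! i)"
      using vimage_ideal_times_Idl_list[of "take i ss"] rho_take[of i] by simp
  qed
  then show ?thesis by (simp add: ss_def)
qed

lemma module_dim_imp_dim_le:
  assumes "module_dim A B = enat d" shows "dim_le d ker"
proof -
  let ?a = "annihilator A B"
  have mem: "\<rho> s \<in> ?a \<longleftrightarrow> s \<in> ann ker" for s
  proof
    assume "\<rho> s \<in> ?a"
    then show "s \<in> ann ker" by (simp add: annihilator_def ann_def ker_def pi_scale)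
  next
    assume s: "s \<in> ann ker"
    have "\<rho> s \<odot>\<^bsub>B\<^esub> x = \<zero>\<^bsub>B\<^esub>" if "x \<in> carrier B" for x
    proof -
      obtain f where "\<pi> f = x" using pi_surj \<open>x \<in> carrier B\<close> by blast
      then show ?thesis using s by (auto simp: ann_def ker_def pi_scale)
    qed
    then show "\<rho> s \<in> ?a" by (simp add: annihilator_def)
  qed
  have "?a = \<rho> ` ann ker"
  proof (intro equalityI subsetI)
    fix a assume a: "a \<in> ?a"
    then have "a \<in> carrier A" by (simp add: annihilator_def)
    then obtain s where "\<rho> s = a" using rho_surj by blast
    then show "a \<in> \<rho> ` ann ker" using a mem[of s] by blast
  qed (use mem in blast)
  then have idl: "ideal ?a A" using ideal_image[OF ring_ideal_ann[OF subspace_ker]] by simp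
  interpret a: ideal ?a A by (rule idl)
  note hom = a.rcos_ring_hom
  \<comment> \<open>The same type-class ring also covers \<open>A\<close> modulo the annihilator, so
    chains of primes above \<open>ann ker\<close> have images there.\<close>
  have cover: "ring_cover (A Quot ?a) (\<lambda>s. ?a +>\<^bsub>A\<^esub> \<rho> s)"
  proof (rule ring_cover.intro)
    show "cring (A Quot ?a)" by (rule a.quotient_is_cring[OF cring_A])
    fix s t
    show "?a +>\<^bsub>A\<^esub> \<rho> s \<in> carrier (A Quot ?a)" by (rule ring_hom_closed[OF hom]) simp
    show "?a +>\<^bsub>A\<^esub> \<rho> (s + t) = (?a +>\<^bsub>A\<^esub> \<rho> s) \<oplus>\<^bsub>A Quot ?a\<^esub> (?a +>\<^bsub>A\<^esub> \<rho> t)"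
      unfolding rho_add by (rule ring_hom_add[OF hom]) simp_all
    show "?a +>\<^bsub>A\<^esub> \<rho> (s * t) = (?a +>\<^bsub>A\<^esub> \<rho> s) \<otimes>\<^bsub>A Quot ?a\<^esub> (?a +>\<^bsub>A\<^esub> \<rho> t)"
      unfolding rho_mult by (rule ring_hom_mult[OF hom]) simp_all
    show "?a +>\<^bsub>A\<^esub> \<rho> 1 = \<one>\<^bsub>A Quot ?a\<^esub>" unfolding rho_one by (rule ring_hom_one[OF hom])
  next
    fix x assume "x \<in> carrier (A Quot ?a)"
    then obtain y where "y \<in> carrier A" "x = ?a +>\<^bsub>A\<^esub> y" by (auto simp: FactRing_def A_RCOSETS_def')
    then show "\<exists>s. ?a +>\<^bsub>A\<^esub> \<rho> s = x" using rho_surj by blast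
  qed
  interpret C: ring_cover "A Quot ?a" "\<lambda>s. ?a +>\<^bsub>A\<^esub> \<rho> s" by (rule cover)
  have kerC: "s \<in> ann ker" if "?a +>\<^bsub>A\<^esub> \<rho> s = \<zero>\<^bsub>A Quot ?a\<^esub>" for s
  proof -
    have "\<rho> s \<in> ?a +>\<^bsub>A\<^esub> \<rho> s" by (rule a.a_rcos_self) simp
    then have "\<rho> s \<in> ?a" using that by (simp add: FactRing_def)
    then show ?thesis using mem by blast
  qed
  show ?thesis unfolding dim_le_def
  proof (intro allI impI)
    fix n P assume P: "(\<forall>i\<le>n. prime_ring_ideal (P i)) \<and> (\<forall>i<n. P i \<subset> P (Suc i)) \<and> ann ker \<subseteq> P 0"
    have "enat n \<le> krull_dim (A Quot ?a)" using P kerC by (intro C.krull_dim_ge[of n P]) auto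
    then show "n \<le> d" using assms by (simp add: module_dim_def)
  qed
qed

lemma ex_local_scalar_module:
  assumes loc: "local_ring A \<mm>" and noeth: "noetherian_ring A"
    and inf: "infinite (carrier (A Quot \<mm>))" and fg: "finitely_generated A B"
    and I: "primary_to A \<mm> I"
  obtains T zs gs where "local_scalar_module scale ker (\<rho> -` \<mm>) T zs gs" "generates (set gs) (\<rho> -` I)"
proof -
  interpret L: local_ring A \<mm> by (rule loc)
  interpret m: maximalideal \<mm> A by (rule L.max_ideal)
  have idl: "ideal \<mm> A" "ideal I A" using m.ideal_axioms I by (auto simp: primary_to_def)
  obtain zs where zs: "generates (set zs) (\<rho> -` \<mm>)" using ex_generates[OF noeth idl(1)] by blast
  obtain gs where gs: "generates (set gs) (\<rho> -` I)" using ex_generates[OF noeth idl(2)] by blast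
  have I_m: "I \<subseteq> \<mm>"
  proof
    fix a assume a: "a \<in> I"
    then have "a \<in> carrier A" using ideal.Icarr[OF idl(2)] by blast
    then have "a \<in> ideal_radical A I" using a by (auto simp: ideal_radical_def intro!: exI[of _ "1::nat"])
    then show "a \<in> \<mm>" using I by (simp add: primary_to_def)
  qed
  have "\<forall>C\<in>carrier (A Quot \<mm>). \<exists>s. \<mm> +>\<^bsub>A\<^esub> \<rho> s = C"
  proof
    fix C assume "C \<in> carrier (A Quot \<mm>)"
    then obtain y where "y \<in> carrier A" "C = \<mm> +>\<^bsub>A\<^esub> y" by (auto simp: FactRing_def A_RCOSETS_def')
    then show "\<exists>s. \<mm> +>\<^bsub>A\<^esub> \<rho> s = C" using rho_surj by blast
  qed
  then obtain rep where rep: "\<And>C. C \<in> carrier (A Quot \<mm>) \<Longrightarrow> \<mm> +>\<^bsub>A\<^esub> \<rho> (rep C) = C" by metis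
  define T where "T = rep ` carrier (A Quot \<mm>)"
  have "inj_on rep (carrier (A Quot \<mm>))" by (rule inj_onI) (metis rep)
  then have infT: "infinite T" unfolding T_def using inf by (simp add: finite_image_iff)
  have T_diff: "s - t \<notin> \<rho> -` \<mm>" if "s \<in> T" "t \<in> T" "s \<noteq> t" for s t
  proof
    assume "s - t \<in> \<rho> -` \<mm>"
    then have "\<rho> s \<ominus>\<^bsub>A\<^esub> \<rho> t \<in> \<mm>" by (simp add: rho_diff)
    then have "\<rho> s \<in> \<mm> +>\<^bsub>A\<^esub> \<rho> t" using m.a_rcos_module_minus[OF A.ring_axioms] by simp
    then have "\<mm> +>\<^bsub>A\<^esub> \<rho> t = \<mm> +>\<^bsub>A\<^esub> \<rho> s" using m.a_repr_independence' by simp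
    then show False using that rep by (auto simp: T_def)
  qed
  obtain S where S: "finite S" "S \<subseteq> carrier B" "module_span A B S = carrier B"
    using fg by (auto simp: finitely_generated_def)
  have "\<forall>x\<in>S. \<exists>f. \<pi> f = x" using S(2) pi_surj by blast
  then obtain h where h: "\<And>x. x \<in> S \<Longrightarrow> \<pi> (h x) = x" by metis
  have "\<pi> ` h ` S = S" unfolding image_image using h by simp
  then have "span (h ` S \<union> ker) = UNIV" using vimage_module_span[of "h ` S"] S(3) by auto
  then have fg_above: "\<exists>Y. finite Y \<and> N = span (Y \<union> ker)" if "subspace N" "ker \<subseteq> N" for N
    using finitely_generated_above_ker[OF noeth, of "h ` S" N] S(1) that by simp
  have "local_scalar_module scale ker (\<rho> -` \<mm>) T zs gs"
  proof
    show "subspace ker" by (rule subspace_ker)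
    show "\<exists>Y. finite Y \<and> N = span (Y \<union> ker)" if "subspace N" "ker \<subseteq> N" for N
      by (rule fg_above[OF that])
    show "ring_ideal (\<rho> -` \<mm>)" by (rule ring_ideal_vimage[OF idl(1)])
    show "1 \<notin> \<rho> -` \<mm>" using m.one_imp_carrier m.I_notcarr by (auto simp: rho_one)
    show "\<exists>c. \<forall>f. (c * s) *s f - f \<in> ker" if s: "s \<notin> \<rho> -` \<mm>" for s
    proof -
      obtain c where c: "\<rho> (c * s - 1) = \<zero>\<^bsub>A\<^esub>"
        using ex_inverse_outside_maximal[OF loc, of s] s by auto
      have "(c * s) *s f - f \<in> ker" for f
        using scale_diff_ker[of "c * s - 1" 0 f] c by (simp add: rho_zero scale_left_diff_distrib)
      then show ?thesis by blast
    qed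
    show "set zs \<subseteq> \<rho> -` \<mm>" using zs by (simp add: generates_def)
    show "a *s u \<in> P" if "a \<in> \<rho> -` \<mm>" "subspace P" "ker \<subseteq> P" "\<And>z. z \<in> set zs \<Longrightarrow> z *s u \<in> P" for a P u
      by (rule generatesD[OF zs that])
    show "set gs \<subseteq> \<rho> -` \<mm>" using gs I_m by (auto simp: generates_def)
    show "\<exists>k. \<forall>P u. subspace P \<and> ker \<subseteq> P \<and> (\<forall>g\<in>set gs. g *s u \<in> P) \<longrightarrow> a ^ k *s u \<in> P"
      if a: "a \<in> \<rho> -` \<mm>" for a
    proof -
      have "\<rho> a \<in> ideal_radical A I" using a I by (simp add: primary_to_def)
      then obtain k :: nat where "\<rho> a [^]\<^bsub>A\<^esub> k \<in> I" by (auto simp: ideal_radical_def)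
      then have ak: "a ^ k \<in> \<rho> -` I" by (simp add: rho_power)
      have "a ^ k *s u \<in> P" if "subspace P \<and> ker \<subseteq> P \<and> (\<forall>g\<in>set gs. g *s u \<in> P)" for P u
        using that by (intro generatesD[OF gs ak]) blast+
      then show ?thesis by blast
    qed
    show "infinite T" by (rule infT)
    show "s - t \<notin> \<rho> -` \<mm>" if "s \<in> T" "t \<in> T" "s \<noteq> t" for s t by (rule T_diff[OF that])
  qed
  then show ?thesis using that gs by blast
qed

end

text \<open>A difference in \<open>n\<close> removes the last, constant term and lowers the degree
  of the others by one; these vanish by induction, and then so does the constant.\<close>

lemma binomial_combination_zero:
  fixes c :: "nat \<Rightarrow> int"
  assumes "\<forall>\<^sub>F n in sequentially. (\<Sum>i\<le>d. c i * int ((n + d - i) choose (d - i))) = 0"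
  shows "i \<le> d \<Longrightarrow> c i = 0"
  using assms
proof (induction d arbitrary: i)
  case 0 then show ?case by (simp add: eventually_const)
next
  case (Suc d)
  let ?f = "\<lambda>n. \<Sum>i\<le>Suc d. c i * int ((n + Suc d - i) choose (Suc d - i))"
  obtain n0 where n0: "\<And>n. n \<ge> n0 \<Longrightarrow> ?f n = 0" using Suc.prems(2) unfolding eventually_sequentially by blast
  have step: "?f (Suc n) = ?f n + (\<Sum>i\<le>d. c i * int ((Suc n + d - i) choose (d - i)))" for n
    using binomial_combination_Suc[of c n d] by simp
  have "\<forall>\<^sub>F n in sequentially. (\<Sum>i\<le>d. c i * int ((n + d - i) choose (d - i))) = 0"
    unfolding eventually_sequentially
  proof (intro exI[of _ "Suc n0"] allI impI)
    fix n assume "Suc n0 \<le> n"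
    then obtain m where m: "n = Suc m" "n0 \<le> m" by (cases n) auto
    show "(\<Sum>i\<le>d. c i * int ((n + d - i) choose (d - i))) = 0"
      using step[of m] n0[of m] n0[of "Suc m"] m by simp
  qed
  then have low: "c i = 0" if "i \<le> d" for i using Suc.IH that by blast
  have "?f n0 = 0" by (rule n0) simp
  then have "c (Suc d) = 0" using low by simp
  then show ?case using low Suc.prems(1) by (cases "i = Suc d") auto
qed

lemma hilbert_coeff_eqI:
  assumes dim: "module_dim R M = enat d" and e: "\<And>i. i > d \<Longrightarrow> e i = 0"
    and poly: "\<forall>\<^sub>F n in sequentially. \<exists>l::nat. hilbert_samuel R M I n = enat l \<and>
      int l = (\<Sum>i\<le>d. (- 1) ^ i * e i * int ((n + d - i) choose (d - i)))"
  shows "hilbert_coeff R M I = e"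
  unfolding hilbert_coeff_def Let_def dim the_enat.simps
proof (rule the_equality)
  show "(\<forall>i>d. e i = 0) \<and> (\<forall>\<^sub>F n in sequentially. \<exists>l::nat. hilbert_samuel R M I n = enat l \<and>
      int l = (\<Sum>i\<le>d. (- 1) ^ i * e i * int ((n + d - i) choose (d - i))))"
    using e poly by blast
  fix e' assume e': "(\<forall>i>d. e' i = 0) \<and> (\<forall>\<^sub>F n in sequentially. \<exists>l::nat. hilbert_samuel R M I n = enat l \<and>
      int l = (\<Sum>i\<le>d. (- 1) ^ i * e' i * int ((n + d - i) choose (d - i))))"
  have "\<forall>\<^sub>F n in sequentially. (\<Sum>i\<le>d. ((- 1) ^ i * (e' i - e i)) * int ((n + d - i) choose (d - i))) = 0"
    using poly conjunct2[OF e']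
  proof eventually_elim
    case (elim n)
    then have "(\<Sum>i\<le>d. (- 1) ^ i * e' i * int ((n + d - i) choose (d - i))) =
        (\<Sum>i\<le>d. (- 1) ^ i * e i * int ((n + d - i) choose (d - i)))" by auto
    then show ?case by (simp add: algebra_simps sum_subtractf)
  qed
  then have "(- 1) ^ i * (e' i - e i) = 0" if "i \<le> d" for i
    by (rule binomial_combination_zero[where c = "\<lambda>i. (- 1) ^ i * (e' i - e i)"]) (rule that)
  then have "e' i = e i" if "i \<le> d" for i using that by simp
  then show "e' = e" using e e' by (metis ext not_less)
qed

text \<open>A finite positive supremum in \<open>enat\<close> is attained: a set with a finite bound
  is finite, and the empty set has supremum zero.\<close>

lemma module_depth_attained:
  assumes "module_depth R \<mm> M = enat d" "d > 0"
  obtains as where "length as = d" "set as \<subseteq> \<mm>" "regular_sequence R M as"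
proof -
  define S where "S = {enat (length as) |as. set as \<subseteq> \<mm> \<and> regular_sequence R M as}"
  have sup: "Sup S = enat d" using assms(1) by (simp add: module_depth_def S_def)
  have "S \<noteq> {}"
  proof
    assume *: "S = {}"
    have "Sup S = 0" unfolding * by (simp add: bot_enat_def)
    then show False using sup assms(2) by (simp add: zero_enat_def)
  qed
  moreover have "finite S"
  proof (rule finite_subset)
    show "S \<subseteq> enat ` {..d}"
    proof
      fix x assume "x \<in> S"
      then have "x \<le> enat d" unfolding sup[symmetric] by (rule Sup_upper)
      then show "x \<in> enat ` {..d}" by (cases x) auto
    qed
  qed simp
  ultimately have "enat d \<in> S" unfolding sup[symmetric] by (simp add: Sup_enat_def)
  then obtain as where "enat d = enat (length as)" "set as \<subseteq> \<mm>" "regular_sequence R M as"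
    unfolding S_def by blast
  then show ?thesis using that[of as] by simp
qed

theorem theorem5p1:
  fixes A :: "('a, 'r) ring_scheme" and \<mm> :: "'a set"
    and M :: "('a, 'b, 'm) module_scheme"
    and I :: "'a set" and b d :: nat
  assumes "local_ring A \<mm>" and "noetherian_ring A"
    and "infinite (carrier (A Quot \<mm>))"
    and "module A M" and "finitely_generated A M"
    and "cohen_macaulay_module A \<mm> M"
    and "module_dim A M = enat d" and "d \<ge> 2"
    and "primary_to A \<mm> I"
    and "b > 0"
    and "ideal_times_module A M I \<subseteq> ideal_times_module A M (\<mm> [^]\<^bsub>ideals_set A\<^esub> b)"
  shows "real_of_int (hilbert_coeff A M I 2)
    \<le> real_of_int (hilbert_coeff A M I 0 - int b + 1) gchoose 3"
proof -
  have cr: "cring A" by (rule module.axioms(1)[OF assms(4)])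
  have idl: "ideal \<mm> A" "ideal I A"
    using local_ring.max_ideal[OF assms(1)] assms(9) by (auto simp: maximalideal_def primary_to_def)
  interpret S: scalar_module "family_scale :: ('a, 'r) ring_family \<Rightarrow> ('a, 'r, 'b, 'm) module_family \<Rightarrow> _"
    by (rule scalar_module_family)
  interpret C: module_cover A "ring_at A" "family_scale :: _ \<Rightarrow> ('a, 'r, 'b, 'm) module_family \<Rightarrow> _"
    M "module_at A M"
    by (intro module_cover.intro ring_cover.intro module_cover_axioms.intro scalar_module_family)
      (simp_all add: cr assms(4) ring_at_closed ring_at_simps ring_at_surj module_at_closed
        module_at_simps module_at_scale module_at_surj)
  obtain T zs gs where loc: "local_scalar_module family_scale C.ker (ring_at A -` \<mm>) T zs gs"
    and gs: "C.generates (set gs) (ring_at A -` I)"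
    by (rule C.ex_local_scalar_module[OF assms(1-3,5,9)])
  interpret L: local_scalar_module family_scale C.ker "ring_at A -` \<mm>" T zs gs by (rule loc)
  have filt_I: "S.filt (set gs) C.ker n = S.filt (ring_at A -` I) C.ker n" for n
    by (rule C.filt_generates[OF gs])
  have dim: "S.dim_le d C.ker" by (rule C.module_dim_imp_dim_le[OF assms(7)])
  have "module_depth A \<mm> M = enat d" using assms(6,7) by (simp add: cohen_macaulay_module_def)
  then obtain as where "length as = d" "set as \<subseteq> \<mm>" "regular_sequence A M as"
    using module_depth_attained assms(8) by (metis less_le_trans pos2)
  then have depth: "L.depth_ge d C.ker" using C.regular_sequence_depth[OF loc] by blast
  have act_b: "S.act (set gs) UNIV \<subseteq> (S.act (ring_at A -` \<mm>) ^^ b) UNIV + C.ker"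
  proof -
    have "S.act (set gs) UNIV \<subseteq> S.act (ring_at A -` I) UNIV + C.ker"
      using gs S.plus_upper1[OF C.subspace_ker] S.act_mono[of "set gs" "ring_at A -` I" UNIV UNIV]
      by (auto simp: C.generates_def)
    also have "\<dots> = module_at A M -` ideal_times_module A M I"
      using ideal.Icarr[OF idl(2)] by (intro C.vimage_ideal_times[symmetric]) auto
    also have "\<dots> \<subseteq> module_at A M -` ideal_times_module A M (\<mm> [^]\<^bsub>ideals_set A\<^esub> b)"
      using assms(11) by (rule vimage_mono)
    also have "\<dots> = S.filt (ring_at A -` \<mm>) C.ker b" by (rule C.vimage_ideal_power[OF idl(1)])
    \<comment> \<open>The filtration adds the kernel at every step, the iterated product only at the
      end; the difference is absorbed because \<open>act\<close> maps the kernel into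
      itself.\<close>
    also have "\<dots> \<subseteq> (S.act (ring_at A -` \<mm>) ^^ b) UNIV + C.ker"
    proof (induction b)
      case 0 then show ?case using S.plus_upper1[OF C.subspace_ker, of UNIV] by simp
    next
      case (Suc b)
      let ?m = "ring_at A -` \<mm>"
      have sub: "S.subspace ((S.act ?m ^^ b) UNIV)" by (cases b) auto
      have subR: "S.subspace ((S.act ?m ^^ Suc b) UNIV + C.ker)"
        by (intro S.subspace_plus C.subspace_ker) simp
      have kerR: "C.ker \<subseteq> (S.act ?m ^^ Suc b) UNIV + C.ker" by (intro S.plus_upper2) simp
      have "S.act ?m (S.filt ?m C.ker b) \<subseteq> S.act ?m ((S.act ?m ^^ b) UNIV + C.ker)"
        using Suc by (intro S.act_mono) auto
      also have "\<dots> = (S.act ?m ^^ Suc b) UNIV + S.act ?m C.ker"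
        by (simp add: S.act_plus[OF sub C.subspace_ker])
      also have "\<dots> \<subseteq> (S.act ?m ^^ Suc b) UNIV + C.ker"
        by (intro set_plus_mono2 S.act_le C.subspace_ker order_refl)
      finally show ?case unfolding S.filt.simps using kerR by (intro S.plus_least subR)
    qed
    finally show ?thesis .
  qed
  obtain e m where e: "L.hilbert_form d C.ker e" "e 0 = int b + int m"
    "6 * e 2 \<le> (int m + 1) * int m * (int m - 1)"
    using L.second_coefficient_bound[OF assms(10) act_b C.subspace_ker order_refl assms(8) depth dim] by blast
  have hs: "hilbert_samuel A M I n = enat (S.len (S.filt (set gs) C.ker (Suc n)) UNIV)" for n
  proof -
    let ?N = "ideal_times_module A M (I [^]\<^bsub>ideals_set A\<^esub> Suc n)"
    have "I [^]\<^bsub>ideals_set A\<^esub> Suc n \<subseteq> carrier A"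
      using ideal.Icarr[OF C.ideal_power[OF idl(2), of "Suc n"]] by (intro subsetI)
    then have N: "submodule ?N A M" by (rule C.submodule_ideal_times)
    interpret Q: module_cover A "ring_at A" family_scale "FactModule M ?N"
      "\<lambda>f. ?N +>\<^bsub>M\<^esub> module_at A M f" by (rule C.FactModule_cover[OF N])
    have ker: "Q.ker = S.filt (set gs) C.ker (Suc n)"
      unfolding C.FactModule_ker[OF N] C.vimage_ideal_power[OF idl(2)] filt_I ..
    have "S.finite_length Q.ker UNIV"
      unfolding ker by (rule L.finite_length_filt[OF C.subspace_ker order_refl])
    from Q.module_length_eq[OF this] show ?thesis unfolding hilbert_samuel_def ker .
  qed
  \<comment> \<open>\<open>hilbert_coeff\<close> is normalized to vanish beyond \<open>d\<close>,
    about which \<open>hilbert_form\<close> says nothing.\<close>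
  define e' where "e' i = (if i \<le> d then e i else 0)" for i
  have "hilbert_coeff A M I = e'"
  proof (rule hilbert_coeff_eqI[OF assms(7)])
    show "\<forall>\<^sub>F n in sequentially. \<exists>l::nat. hilbert_samuel A M I n = enat l \<and>
      int l = (\<Sum>i\<le>d. (- 1) ^ i * e' i * int ((n + d - i) choose (d - i)))"
      using e(1) unfolding L.hilbert_form_def hs
    proof eventually_elim
      case (elim n)
      have "(\<Sum>i\<le>d. (- 1) ^ i * e' i * int ((n + d - i) choose (d - i))) =
          (\<Sum>i\<le>d. (- 1) ^ i * e i * int ((n + d - i) choose (d - i)))"
        by (intro sum.cong) (simp_all add: e'_def)
      then show ?case using elim by auto
    qed
  qed (simp add: e'_def)
  then have h: "hilbert_coeff A M I 0 = int b + int m" "hilbert_coeff A M I 2 = e 2"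
    using assms(8) e(2) by (simp_all add: e'_def)
  \<comment> \<open>Since \<open>e 0 - b = m\<close>, the upper argument is \<open>m + 1\<close>, in
    agreement with \<open>cubic_sum\<close>.\<close>
  have "real_of_int (hilbert_coeff A M I 0 - int b + 1) gchoose 3 = (real m + 1) * real m * (real m - 1) / 6"
    unfolding h by (simp add: gbinomial_prod_rev numeral_3_eq_3 fact_numeral algebra_simps)
  moreover have "6 * real_of_int (e 2) \<le> (real m + 1) * real m * (real m - 1)"
  proof -
    have "real_of_int (6 * e 2) \<le> real_of_int ((int m + 1) * int m * (int m - 1))"
      unfolding of_int_le_iff by (rule e(3))
    then show ?thesis by simp
  qed
  ultimately show ?thesis unfolding h(2) by simp
qed

end
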